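(* Let $f,g$ satisfy the regularity assumption (R) of the context, and let $P\in C^2(\mathbb{R}^d,\mathbb{R})$ have uniformly bounded first and second derivatives. Then there exists a constant $C$, independent of $N$ (equivalently of $\Delta t=T/N$), such that for all $N\ge1$ $$\mathbb{V}\Big[\tfrac12\big(P(X^f_N)+P(X^a_N)\big)-P(X^c_N)\Big]\le C\,\Delta t^2 ,$$ where $\mathbb{V}$ denotes variance.
   Context: Let $d,D\ge 1$ be integers and $T>0$. On a complete probability space with a filtration $\{\mathcal F_t\}_{t\ge0}$ satisfying the usual conditions, let $w=(w_1,\dots,w_D)$ be a $D$-dimensional Brownian motion with respect to $\{\mathcal F_t\}$ with correlation matrix $\Omega=(\Omega_{jk})$, i.e. for $s<t$ the increment $w(t)-w(s)$ is independent of $\mathcal F_s$ and is centred Gaussian with covariance matrix $(t-s)\Omega$, $\Omega_{jj}=1$. Let $x_0\in\mathbb{R}^d$ be deterministic, $f\in C^2(\mathbb{R}^d,\mathbb{R}^d)$, $g\in C^2(\mathbb{R}^d,\mathbb{R}^{d\times D})$ (the drift and diffusion coefficients of the SDE $\mathrm{d}x(t)=f(x(t))\,\mathrm{d}t+g(x(t))\,\mathrm{d}w(t)$, $x(0)=x_0$). Put $$h_{ijk}(x)=\tfrac12\sum_{l=1}^d g_{lk}(x)\frac{\partial g_{ij}}{\partial x_l}(x),\quad 1\le i\le d,\ 1\le j,k\le D.$$ Assumption (R): there is a constant bounding, uniformly over $\mathbb{R}^d$ and over all indices, the absolute values of all first partial derivatives of all $f_i$, $g_{ij}$, $h_{ijk}$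 and all second partial derivatives of all $f_i$, $g_{ij}$. For an integer $N\ge1$ let $\Delta t=T/N$, $t_n=n\Delta t$, $t_{n+1/2}=(n+\tfrac12)\Delta t$, $\Delta w_n=w(t_{n+1})-w(t_n)$, $\delta w_n=w(t_{n+1/2})-w(t_n)$, $\delta w_{n+1/2}=w(t_{n+1})-w(t_{n+1/2})$. For a state $X\in\mathbb{R}^d$, a step $\tau>0$ and an increment $v\in\mathbb{R}^D$ define $\Phi(X,\tau,v)\in\mathbb{R}^d$ by $$\Phi_i(X,\tau,v)=X_i+f_i(X)\tau+\sum_{j=1}^D g_{ij}(X)v_j+\sum_{j,k=1}^D h_{ijk}(X)\,(v_jv_k-\Omega_{jk}\tau).$$ Coarse path: $X^c_0=x_0$, $X^c_{n+1}=\Phi(X^c_n,\Delta t,\Delta w_n)$. Fine path: $X^f_0=x_0$, $X^f_{n+1/2}=\Phi(X^f_n,\Delta t/2,\delta w_n)$, $X^f_{n+1}=\Phi(X^f_{n+1/2},\Delta t/2,\delta w_{n+1/2})$. Antithetic path: $X^a_0=x_0$, $X^a_{n+1/2}=\Phi(X^a_n,\Delta t/2,\delta w_{n+1/2})$, $X^a_{n+1}=\Phi(X^a_{n+1/2},\Delta t/2,\delta w_n)$. Here $0\le n\le N-1$. *)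

theory Defs
  imports "HOL-Probability.Probability"
begin

section \<open>Filtrations and correlated Brownian motion\<close>

text \<open>The time index is of type \<^typ>\<open>real\<close>; only the values at nonnegative times
  are constrained.\<close>

locale usual_filtered_prob_space = prob_space M + complete_measure M
  for M :: "'w measure" +
  fixes F :: "real \<Rightarrow> 'w measure"
  assumes subalgebra_F: "\<And>t. 0 \<le> t \<Longrightarrow> subalgebra M (F t)"
    and sets_F_mono: "\<And>s t. 0 \<le> s \<Longrightarrow> s \<le> t \<Longrightarrow> sets (F s) \<subseteq> sets (F t)"
    and null_sets_F: "null_sets M \<subseteq> sets (F 0)"
    and right_continuous_F: "\<And>t. 0 \<le> t \<Longrightarrow> sets (F t) = (\<Inter>u\<in>{t<..}. sets (F u))"

text \<open>The degenerate case of variance zero has to be separated, because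
  \<^const>\<open>normal_density\<close> with standard deviation zero is not a density.\<close>

definition centred_normal_law :: "real \<Rightarrow> real measure" where
  "centred_normal_law v =
     (if v = 0 then return borel 0
      else density lborel (\<lambda>x. ennreal (normal_density 0 (sqrt v) x)))"

text \<open>A possibly degenerate multivariate Gaussian law: every linear functional is Gaussian, and
  its variance is given by the covariance matrix.\<close>

definition centred_gaussian :: "(real^'n) measure \<Rightarrow> real^'n^'n \<Rightarrow> bool" where
  "centred_gaussian \<mu> \<Sigma> \<longleftrightarrow>
     transpose \<Sigma> = \<Sigma> \<and>
     (\<forall>a. 0 \<le> a \<bullet> (\<Sigma> *v a)) \<and>
     (\<forall>a. distr \<mu> borel (\<lambda>x. a \<bullet> x) = centred_normal_law (a \<bullet> (\<Sigma> *v a)))"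

locale correlated_brownian_motion = usual_filtered_prob_space M F
  for M :: "'w measure" and F +
  fixes w :: "real \<Rightarrow> 'w \<Rightarrow> real^'D" and \<Omega> :: "real^'D^'D"
  assumes adapted: "\<And>t. 0 \<le> t \<Longrightarrow> w t \<in> borel_measurable (F t)"
    and start: "AE \<omega> in M. w 0 \<omega> = 0"
    and continuous_paths: "AE \<omega> in M. continuous_on {0..} (\<lambda>t. w t \<omega>)"
    and increment_indep: "\<And>s t. 0 \<le> s \<Longrightarrow> s < t \<Longrightarrow>
      indep_set (sets (F s)) {(\<lambda>\<omega>. w t \<omega> - w s \<omega>) -` A \<inter> space M | A. A \<in> sets borel}"
    and increment_law: "\<And>s t. 0 \<le> s \<Longrightarrow> s < t \<Longrightarrow>
      centred_gaussian (distr M borel (\<lambda>\<omega>. w t \<omega> - w s \<omega>)) ((t - s) *\<^sub>R \<Omega>)"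
    and unit_diagonal: "\<And>j. \<Omega> $ j $ j = 1"


section \<open>Partial derivatives and regularity of the coefficients\<close>

definition partial_deriv :: "'d \<Rightarrow> (real^'d \<Rightarrow> real) \<Rightarrow> real^'d \<Rightarrow> real" where
  "partial_deriv l \<phi> x = deriv (\<lambda>s. \<phi> (x + s *\<^sub>R axis l 1)) 0"

definition C1 :: "(real^'d \<Rightarrow> real) \<Rightarrow> bool" where
  "C1 \<phi> \<longleftrightarrow> \<phi> differentiable_on UNIV \<and> (\<forall>l. continuous_on UNIV (partial_deriv l \<phi>))"

definition C2 :: "(real^'d \<Rightarrow> real) \<Rightarrow> bool" where
  "C2 \<phi> \<longleftrightarrow> C1 \<phi> \<and> (\<forall>l. C1 (partial_deriv l \<phi>))"

definition bounded_first_partials :: "(real^'d \<Rightarrow> real) \<Rightarrow> real \<Rightarrow> bool" where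
  "bounded_first_partials \<phi> K \<longleftrightarrow> (\<forall>l x. \<bar>partial_deriv l \<phi> x\<bar> \<le> K)"

definition bounded_second_partials :: "(real^'d \<Rightarrow> real) \<Rightarrow> real \<Rightarrow> bool" where
  "bounded_second_partials \<phi> K \<longleftrightarrow> (\<forall>l m x. \<bar>partial_deriv m (partial_deriv l \<phi>) x\<bar> \<le> K)"

text \<open>The diffusion coefficient takes values in the matrices with rows indexed by \<open>'d\<close> and
  columns indexed by \<open>'D\<close>; its \<open>(i,j)\<close> entry at \<open>x\<close> is \<open>g x $ i $ j\<close>.\<close>

definition milstein_h ::
  "(real^'d \<Rightarrow> real^'D^'d) \<Rightarrow> 'd \<Rightarrow> 'D \<Rightarrow> 'D \<Rightarrow> real^'d \<Rightarrow> real" where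
  "milstein_h g i j k x =
     1 / 2 * (\<Sum>l\<in>UNIV. g x $ l $ k * partial_deriv l (\<lambda>y. g y $ i $ j) x)"

definition bounded_coefficient_derivs ::
  "(real^'d \<Rightarrow> real^'d) \<Rightarrow> (real^'d \<Rightarrow> real^'D^'d) \<Rightarrow> bool" where
  "bounded_coefficient_derivs f g \<longleftrightarrow>
     (\<exists>K. (\<forall>i. bounded_first_partials (\<lambda>x. f x $ i) K \<and>
               bounded_second_partials (\<lambda>x. f x $ i) K) \<and>
          (\<forall>i j. bounded_first_partials (\<lambda>x. g x $ i $ j) K \<and>
                 bounded_second_partials (\<lambda>x. g x $ i $ j) K) \<and>
          (\<forall>i j k. bounded_first_partials (milstein_h g i j k) K))"


section \<open>The antithetic Milstein scheme\<close>

definition milstein_step ::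
  "(real^'d \<Rightarrow> real^'d) \<Rightarrow> (real^'d \<Rightarrow> real^'D^'d) \<Rightarrow> real^'D^'D \<Rightarrow>
   real^'d \<Rightarrow> real \<Rightarrow> real^'D \<Rightarrow> real^'d" where
  "milstein_step f g \<Omega> X \<tau> v =
     (\<chi> i. X $ i + f X $ i * \<tau> + (\<Sum>j\<in>UNIV. g X $ i $ j * v $ j)
        + (\<Sum>j\<in>UNIV. \<Sum>k\<in>UNIV. milstein_h g i j k X * (v $ j * v $ k - \<Omega> $ j $ k * \<tau>)))"

text \<open>In the following, \<open>dt\<close> is the coarse time step and \<open>W\<close> is one trajectory of the driving
  Brownian motion.\<close>

definition first_half_increment :: "real \<Rightarrow> (real \<Rightarrow> real^'D) \<Rightarrow> nat \<Rightarrow> real^'D" where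
  "first_half_increment dt W n = W ((real n + 1 / 2) * dt) - W (real n * dt)"

definition second_half_increment :: "real \<Rightarrow> (real \<Rightarrow> real^'D) \<Rightarrow> nat \<Rightarrow> real^'D" where
  "second_half_increment dt W n = W (real (n + 1) * dt) - W ((real n + 1 / 2) * dt)"

primrec coarse_path ::
  "(real^'d \<Rightarrow> real^'d) \<Rightarrow> (real^'d \<Rightarrow> real^'D^'d) \<Rightarrow> real^'D^'D \<Rightarrow> real^'d \<Rightarrow>
   real \<Rightarrow> (real \<Rightarrow> real^'D) \<Rightarrow> nat \<Rightarrow> real^'d" where
  "coarse_path f g \<Omega> x0 dt W 0 = x0"
| "coarse_path f g \<Omega> x0 dt W (Suc n) =
     milstein_step f g \<Omega> (coarse_path f g \<Omega> x0 dt W n) dt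
       (W (real (n + 1) * dt) - W (real n * dt))"

primrec fine_path ::
  "(real^'d \<Rightarrow> real^'d) \<Rightarrow> (real^'d \<Rightarrow> real^'D^'d) \<Rightarrow> real^'D^'D \<Rightarrow> real^'d \<Rightarrow>
   real \<Rightarrow> (real \<Rightarrow> real^'D) \<Rightarrow> nat \<Rightarrow> real^'d" where
  "fine_path f g \<Omega> x0 dt W 0 = x0"
| "fine_path f g \<Omega> x0 dt W (Suc n) =
     milstein_step f g \<Omega>
       (milstein_step f g \<Omega> (fine_path f g \<Omega> x0 dt W n) (dt / 2) (first_half_increment dt W n))
       (dt / 2) (second_half_increment dt W n)"

primrec antithetic_path ::
  "(real^'d \<Rightarrow> real^'d) \<Rightarrow> (real^'d \<Rightarrow> real^'D^'d) \<Rightarrow> real^'D^'D \<Rightarrow> real^'d \<Rightarrow>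
   real \<Rightarrow> (real \<Rightarrow> real^'D) \<Rightarrow> nat \<Rightarrow> real^'d" where
  "antithetic_path f g \<Omega> x0 dt W 0 = x0"
| "antithetic_path f g \<Omega> x0 dt W (Suc n) =
     milstein_step f g \<Omega>
       (milstein_step f g \<Omega> (antithetic_path f g \<Omega> x0 dt W n) (dt / 2)
         (second_half_increment dt W n))
       (dt / 2) (first_half_increment dt W n)"

definition antithetic_difference ::
  "(real^'d \<Rightarrow> real^'d) \<Rightarrow> (real^'d \<Rightarrow> real^'D^'d) \<Rightarrow> real^'D^'D \<Rightarrow> real^'d \<Rightarrow>
   (real^'d \<Rightarrow> real) \<Rightarrow> real \<Rightarrow> nat \<Rightarrow> (real \<Rightarrow> real^'D) \<Rightarrow> real" where
  "antithetic_difference f g \<Omega> x0 P dt N W =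
     1 / 2 * (P (fine_path f g \<Omega> x0 dt W N) + P (antithetic_path f g \<Omega> x0 dt W N))
       - P (coarse_path f g \<Omega> x0 dt W N)"

end

theory Submission
  imports Defs
begin

text \<open>Write \<open>x\<close>, \<open>y\<close>, \<open>c\<close> for the fine, antithetic and coarse states, \<open>d = x - y\<close>,
  \<open>e = (x + y) / 2 - c\<close> and \<open>s\<^sup>2 = \<Delta>t\<close>. A two-term Taylor expansion bounds the square of the
  payoff difference by a multiple of \<open>|e|\<^sup>2 + |d|\<^sup>4\<close>. One coarse step changes the fine state by the
  coarse Milstein increment, plus a Levy-area term that changes sign when the two half increments
  are swapped, plus a remainder of size \<open>s\<^sup>3\<close> whose mean is of order \<open>s\<^sup>4\<close>. In the mean
  over a fine and an antithetic state the Levy-area terms cancel up to a factor \<open>|d|\<close>. Hence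
  one step increases the expectation of
  \<open>|e|\<^sup>2 + |d|\<^sup>4 + s\<^sup>4 ((1 + |x|\<^sup>2)\<^sup>4 + (1 + |y|\<^sup>2)\<^sup>4)\<close>
  at most by a factor \<open>1 + O(s\<^sup>2)\<close>. Its initial value is of order \<open>s\<^sup>4\<close>, so after
  \<open>T / s\<^sup>2\<close> steps it is still of order \<open>s\<^sup>4 = \<Delta>t\<^sup>2\<close>.\<close>

section \<open>Pointwise estimates for one step\<close>

text \<open>The solution of the SDE never enters; the three schemes are compared with one another.
  The scales behind the exponents are \<open>d\<close> of order \<open>s\<close> and
  \<open>e\<close> of order \<open>s^2\<close>, so that \<open>|e|^2\<close> and
  \<open>|d|^4\<close> both have the target order \<open>s^4\<close>. One obstacle is that a step
  fluctuates by order \<open>s\<close> while there are \<open>T / s^2\<close> steps, so sizes cannot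
  simply be summed. Every increment is therefore used in two ways: linearly through its mean, which
  is of order \<open>s^2\<close>, and otherwise through its second or higher powers. Each
  contribution then carries a factor \<open>s^2\<close>. Another obstacle is that the coefficients
  are unbounded. The Taylor remainder of the diffusion coefficient grows like
  \<open>(1 + |x|)^2\<close>, and its fourth power enters the estimate for \<open>|d|^4\<close>;
  this is where the exponent in \<open>(1 + |x|^2)^4\<close> comes from. Gaussian increments are
  unbounded as well, so the pointwise bounds carry powers of a random size \<open>\<rho>\<close>, of
  which only moments matter. Finally, h is merely Lipschitz, so its midpoint error is linear in
  \<open>d\<close>; this is affordable because it always comes with a factor
  \<open>s^2\<close>.\<close>

lemma norm_sum5_le:
  fixes a b c d e :: "'a::real_normed_vector"
  shows "norm (a + b + c + d - e) \<le> norm a + norm b + norm c + norm d + norm e"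
  by (intro order_trans[OF norm_triangle_ineq4] add_right_mono norm_triangle_le) simp

lemma midpoint_diff:
  fixes x y :: "'a::real_normed_vector"
  defines "m \<equiv> (1/2) *\<^sub>R (x + y)"
  shows "x - m = (1/2) *\<^sub>R (x - y)" "y - m = - (x - m)" "norm (x - m) \<le> norm (x - y)" "norm (y - m) \<le> norm (x - y)"
proof -
  show 1: "x - m = (1/2) *\<^sub>R (x - y)"
    using scaleR_half_double[of x] by (simp add: m_def algebra_simps)
  show 2: "y - m = - (x - m)"
    using scaleR_half_double[of x] scaleR_half_double[of y] by (simp add: m_def algebra_simps flip: scaleR_add_left)
  show "norm (x - m) \<le> norm (x - y)" unfolding 1 by simp
  then show "norm (y - m) \<le> norm (x - y)" by (metis 2 norm_minus_cancel)
qed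

lemma half_sum_diff: "(1/2) *\<^sub>R (a + b) - c = (1/2) *\<^sub>R ((a - c) + (b - c))" for a b c :: "'a::real_normed_vector"
  using scaleR_half_double[of c] by (simp add: algebra_simps flip: scaleR_add_left)

text \<open>The SDE is reduced to what one step uses. \<open>G x u\<close> is the diffusion matrix
  applied to an increment, \<open>H x\<close> the bilinear form with coefficients h_ijk,
  \<open>HO\<close> its contraction with the correlation matrix. \<open>DG_G\<close> is the
  definition of h without coordinates: the factor 2 undoes the one half in it, and the second
  argument of \<open>H\<close> is the direction inserted into the derivative. \<open>G_cont\<close>
  and \<open>H_cont\<close> serve measurability.\<close>

locale milstein_coefficients =
  fixes f :: "'e::euclidean_space \<Rightarrow> 'e" and Df :: "'e \<Rightarrow> 'e \<Rightarrow> 'e"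
    and G :: "'e \<Rightarrow> 'u::euclidean_space \<Rightarrow> 'e" and DG :: "'e \<Rightarrow> 'e \<Rightarrow> 'u \<Rightarrow> 'e"
    and H :: "'e \<Rightarrow> 'u \<Rightarrow> 'u \<Rightarrow> 'e" and HO :: "'e \<Rightarrow> 'e" and K :: real
  assumes K_ge_1: "1 \<le> K"
    and f_growth: "norm (f x) \<le> K * (1 + norm x)"
    and f_lip: "norm (f x - f y) \<le> K * norm (x - y)"
    and f_taylor: "norm (f y - f x - Df x (y - x)) \<le> K * (norm (y - x))\<^sup>2"
    and Df_linear: "linear (Df x)"
    and Df_bound: "norm (Df x z) \<le> K * norm z"
    and G_linear: "linear (G x)"
    and G_growth: "norm (G x u) \<le> K * (1 + norm x) * norm u"
    and G_lip: "norm (G x u - G y u) \<le> K * norm (x - y) * norm u"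
    and G_taylor: "norm (G y u - G x u - DG x (y - x) u) \<le> K * (norm (y - x))\<^sup>2 * norm u"
    and DG_linear: "linear (\<lambda>z. DG x z u)"
    and DG_bound: "norm (DG x z u) \<le> K * norm z * norm u"
    and DG_G: "DG x (G x u) v = 2 *\<^sub>R H x v u"
    and H_bilinear: "bilinear (H x)"
    and H_growth: "norm (H x u v) \<le> K * (1 + norm x) * norm u * norm v"
    and H_lip: "norm (H x u v - H y u v) \<le> K * norm (x - y) * norm u * norm v"
    and HO_growth: "norm (HO x) \<le> K * (1 + norm x)"
    and HO_lip: "norm (HO x - HO y) \<le> K * norm (x - y)"
    and G_cont: "continuous_on UNIV (\<lambda>(x, u). G x u)"
    and H_cont: "continuous_on UNIV (\<lambda>(x, u). H x u u)"
begin

section \<open>The Milstein step and the splitting of two half steps\<close>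

definition step :: "real \<Rightarrow> 'e \<Rightarrow> 'u \<Rightarrow> 'e" where
  "step \<tau> x u = x + \<tau> *\<^sub>R f x + G x u + H x u u - \<tau> *\<^sub>R HO x"

definition two_step :: "real \<Rightarrow> 'e \<Rightarrow> 'u \<Rightarrow> 'u \<Rightarrow> 'e" where
  "two_step \<tau> x u v = step (\<tau> / 2) (step (\<tau> / 2) x u) v"

definition coarse_increment :: "real \<Rightarrow> 'e \<Rightarrow> 'u \<Rightarrow> 'e" where
  "coarse_increment \<tau> x u = \<tau> *\<^sub>R f x + G x u + H x u u - \<tau> *\<^sub>R HO x"

text \<open>The discrete Levy area. Two half steps produce the mixed term
  \<open>2 *\<^sub>R H x v u\<close>, whereas one coarse step produces
  \<open>H x u v + H x v u\<close>; this is the difference. It is antisymmetric in the two half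
  increments.\<close>

definition levy_term :: "'e \<Rightarrow> 'u \<Rightarrow> 'u \<Rightarrow> 'e" where
  "levy_term x u v = H x v u - H x u v"

definition remainder :: "real \<Rightarrow> 'e \<Rightarrow> 'u \<Rightarrow> 'u \<Rightarrow> 'e" where
  "remainder \<tau> x u v = two_step \<tau> x u v - x - coarse_increment \<tau> x (u + v) - levy_term x u v"

lemma step_eq: "step \<tau> x u = x + coarse_increment \<tau> x u"
  by (simp add: step_def coarse_increment_def)

lemma two_step_decomp:
  "two_step \<tau> x u v = x + coarse_increment \<tau> x (u + v) + levy_term x u v + remainder \<tau> x u v"
  by (simp add: remainder_def)

lemma H_add: "H x (u + v) (u + v) = H x u u + H x u v + H x v u + H x v v"
  using H_bilinear by (simp add: bilinear_ladd bilinear_radd algebra_simps)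

text \<open>Evaluating \<open>G\<close> at the intermediate state instead of \<open>x\<close> adds,
  to leading order, \<open>DG x (G x u) v\<close>, which is \<open>2 *\<^sub>R H x v u\<close>. The
  coarse quadratic term and the Levy term together account for exactly this, so only differences of
  coefficients, a Taylor remainder and the part of \<open>y - x\<close> beyond \<open>G x u\<close>
  are left.\<close>

lemma remainder_eq:
  fixes x u v \<tau>
  defines "y \<equiv> step (\<tau> / 2) x u"
  shows "remainder \<tau> x u v = (\<tau> / 2) *\<^sub>R (f y - f x) + (G y v - G x v - DG x (y - x) v)
     + DG x (y - x - G x u) v + (H y v v - H x v v) - (\<tau> / 2) *\<^sub>R (HO y - HO x)"
proof -
  have d: "DG x (y - x - G x u) v = DG x (y - x) v - 2 *\<^sub>R H x v u"
    by (simp add: linear_diff[OF DG_linear] DG_G)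
  have g: "G x (u + v) = G x u + G x v"
    using G_linear by (simp add: linear_add)
  have h: "(2::real) *\<^sub>R H x v u = H x v u + H x v u" by (simp add: scaleR_2)
  have t: "\<tau> *\<^sub>R w = (\<tau> / 2) *\<^sub>R w + (\<tau> / 2) *\<^sub>R w" for w :: 'e
    by (simp flip: scaleR_add_left)
  have y: "y = x + (\<tau> / 2) *\<^sub>R f x + G x u + H x u u - (\<tau> / 2) *\<^sub>R HO x"
    by (simp add: y_def step_def)
  have "two_step \<tau> x u v = y + (\<tau> / 2) *\<^sub>R f y + G y v + H y v v - (\<tau> / 2) *\<^sub>R HO y"
    by (simp add: two_step_def y_def[symmetric] step_def[of _ y])
  then have "remainder \<tau> x u v = (y - x - (\<tau> / 2) *\<^sub>R f x - G x u - H x u u + (\<tau> / 2) *\<^sub>R HO x)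
     + (\<tau> / 2) *\<^sub>R (f y - f x) + (G y v - G x v - DG x (y - x) v)
     + DG x (y - x - G x u) v + (H y v v - H x v v) - (\<tau> / 2) *\<^sub>R (HO y - HO x)"
    unfolding remainder_def coarse_increment_def levy_term_def g H_add d h t[of "f x"] t[of "HO x"]
    by (simp add: scaleR_diff_right)
  then show ?thesis by (simp add: y)
qed

text \<open>At the midpoint the first-order Taylor terms cancel.\<close>

lemma f_midpoint: "norm ((1/2) *\<^sub>R (f x + f y) - f ((1/2) *\<^sub>R (x + y))) \<le> K * (norm (x - y))\<^sup>2"
proof -
  define m where "m = (1/2) *\<^sub>R (x + y)"
  note mid = midpoint_diff[where x = x and y = y, folded m_def]
  have "Df m (y - m) = - Df m (x - m)" unfolding mid(2) by (rule linear_neg[OF Df_linear])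
  then have "(1/2) *\<^sub>R (f x + f y) - f m = (1/2) *\<^sub>R ((f x - f m - Df m (x - m)) + (f y - f m - Df m (y - m)))"
    by (simp add: half_sum_diff)
  also have "norm \<dots> \<le> 1/2 * (norm (f x - f m - Df m (x - m)) + norm (f y - f m - Df m (y - m)))"
    by (simp add: norm_triangle_ineq)
  also have "\<dots> \<le> 1/2 * (K * (norm (x - m))\<^sup>2 + K * (norm (y - m))\<^sup>2)"
    by (intro mult_left_mono add_mono f_taylor) auto
  also have "\<dots> \<le> 1/2 * (K * (norm (x - y))\<^sup>2 + K * (norm (x - y))\<^sup>2)"
    by (intro mult_left_mono add_mono power_mono mid) (use K_ge_1 in auto)
  finally show ?thesis by (simp add: m_def)
qed

lemma G_midpoint:
  "norm ((1/2) *\<^sub>R (G x u + G y u) - G ((1/2) *\<^sub>R (x + y)) u) \<le> K * (norm (x - y))\<^sup>2 * norm u"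
proof -
  define m where "m = (1/2) *\<^sub>R (x + y)"
  note mid = midpoint_diff[where x = x and y = y, folded m_def]
  have "DG m (y - m) u = - DG m (x - m) u" unfolding mid(2) by (rule linear_neg[OF DG_linear])
  then have "(1/2) *\<^sub>R (G x u + G y u) - G m u
    = (1/2) *\<^sub>R ((G x u - G m u - DG m (x - m) u) + (G y u - G m u - DG m (y - m) u))"
    by (simp add: half_sum_diff)
  also have "norm \<dots> \<le> 1/2 * (norm (G x u - G m u - DG m (x - m) u) + norm (G y u - G m u - DG m (y - m) u))"
    by (simp add: norm_triangle_ineq)
  also have "\<dots> \<le> 1/2 * (K * (norm (x - m))\<^sup>2 * norm u + K * (norm (y - m))\<^sup>2 * norm u)"
    by (intro mult_left_mono add_mono G_taylor) auto
  also have "\<dots> \<le> 1/2 * (K * (norm (x - y))\<^sup>2 * norm u + K * (norm (x - y))\<^sup>2 * norm u)"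
    by (intro mult_left_mono mult_right_mono add_mono power_mono mid) (use K_ge_1 in auto)
  finally show ?thesis by (simp add: m_def mult_ac)
qed

text \<open>For \<open>H\<close> and \<open>HO\<close> a Lipschitz bound has to suffice, since only
  first derivatives of h are bounded. The midpoint error is then linear in the distance instead of
  quadratic.\<close>

lemma lipschitz_midpoint:
  fixes \<phi> :: "'e \<Rightarrow> 'e"
  assumes "\<And>x y. norm (\<phi> x - \<phi> y) \<le> C * norm (x - y)" "0 \<le> C"
  shows "norm ((1/2) *\<^sub>R (\<phi> x + \<phi> y) - \<phi> ((1/2) *\<^sub>R (x + y))) \<le> C * norm (x - y)"
proof -
  define m where "m = (1/2) *\<^sub>R (x + y)"
  note mid = midpoint_diff[where x = x and y = y, folded m_def]
  have "norm ((1/2) *\<^sub>R (\<phi> x + \<phi> y) - \<phi> m) \<le> 1/2 * (norm (\<phi> x - \<phi> m) + norm (\<phi> y - \<phi> m))"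
    by (simp add: half_sum_diff norm_triangle_ineq)
  also have "\<dots> \<le> 1/2 * (C * norm (x - m) + C * norm (y - m))"
    by (intro mult_left_mono add_mono assms) auto
  also have "\<dots> \<le> 1/2 * (C * norm (x - y) + C * norm (x - y))"
    by (intro mult_left_mono add_mono mid assms) auto
  finally show ?thesis by (simp add: m_def)
qed

lemma H_midpoint:
  "norm ((1/2) *\<^sub>R (H x u v + H y u v) - H ((1/2) *\<^sub>R (x + y)) u v) \<le> K * norm (x - y) * norm u * norm v"
  using lipschitz_midpoint[of "\<lambda>x. H x u v" "K * norm u * norm v"] H_lip[of _ u v] K_ge_1
  by (simp add: mult_ac)

lemma HO_midpoint: "norm ((1/2) *\<^sub>R (HO x + HO y) - HO ((1/2) *\<^sub>R (x + y))) \<le> K * norm (x - y)"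
  using lipschitz_midpoint[OF HO_lip] K_ge_1 by simp

end

text \<open>The size \<open>\<rho>\<close> of the increments is measured in units of the square root \<open>s\<close> of the time step.\<close>

locale milstein_pointwise = milstein_coefficients f Df G DG H HO K
  for f :: "'e::euclidean_space \<Rightarrow> 'e" and Df
    and G :: "'e \<Rightarrow> 'u::euclidean_space \<Rightarrow> 'e" and DG H HO K +
  fixes s \<rho> :: real and u v :: 'u
  assumes s_pos: "0 < s" and s_le: "s \<le> K" and rho_ge_1: "1 \<le> \<rho>"
    and u_le: "norm u \<le> s * \<rho>" and v_le: "norm v \<le> s * \<rho>"
begin

section \<open>Deterministic one-step bounds in powers of \<open>s\<close> and
  \<open>\<rho>\<close>\<close>

lemma monomials:
  "s\<^sup>2 \<le> K * s * \<rho>\<^sup>2" "s * \<rho> \<le> K * s * \<rho>\<^sup>2" "s\<^sup>2 * \<rho>\<^sup>2 \<le> K * s * \<rho>\<^sup>2" "s\<^sup>2 \<le> s\<^sup>2 * \<rho>\<^sup>2" "s * \<rho> \<le> s * \<rho>\<^sup>2"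
proof -
  have r: "1 \<le> \<rho>\<^sup>2" "\<rho> \<le> \<rho>\<^sup>2" using rho_ge_1 by (auto simp: power2_eq_square intro: mult_mono order_trans)
  \<comment> \<open>A surplus power of \<open>s\<close> is paid for by the constant, and low powers
    of \<open>\<rho>\<close> may be raised because \<open>1 \<le> \<rho>\<close>. The later bounds
    are collected into single monomials by these two rules.\<close>
  have s2: "s\<^sup>2 \<le> K * s" using s_le s_pos by (simp add: power2_eq_square)
  show "s\<^sup>2 * \<rho>\<^sup>2 \<le> K * s * \<rho>\<^sup>2" using s2 by (simp add: mult_right_mono)
  show "s\<^sup>2 \<le> s\<^sup>2 * \<rho>\<^sup>2" using mult_left_mono[OF r(1), of "s\<^sup>2"] by simp
  then show "s\<^sup>2 \<le> K * s * \<rho>\<^sup>2" using \<open>s\<^sup>2 * \<rho>\<^sup>2 \<le> K * s * \<rho>\<^sup>2\<close> by linarith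
  show sr: "s * \<rho> \<le> s * \<rho>\<^sup>2" using r s_pos by simp
  have "1 * (s * \<rho>\<^sup>2) \<le> K * (s * \<rho>\<^sup>2)" by (rule mult_right_mono) (use K_ge_1 s_pos in auto)
  with sr show "s * \<rho> \<le> K * s * \<rho>\<^sup>2" by (simp add: mult.assoc)
qed

lemma norm_u_sq: "(norm u)\<^sup>2 \<le> s\<^sup>2 * \<rho>\<^sup>2"
  using power_mono[OF u_le, of 2] by (simp add: power_mult_distrib)

lemma norm_v_sq: "(norm v)\<^sup>2 \<le> s\<^sup>2 * \<rho>\<^sup>2"
  using power_mono[OF v_le, of 2] by (simp add: power_mult_distrib)

lemma norm_uv: "norm u * norm v \<le> s\<^sup>2 * \<rho>\<^sup>2"
  using mult_mono[OF u_le v_le] s_pos rho_ge_1 by (simp add: power2_eq_square mult_ac)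

text \<open>\<open>G x u\<close> is the only part of a half step of order \<open>s\<close>; drift,
  quadratic term and correction are of order \<open>s^2\<close>. Removing it makes the term
  \<open>DG x (y - x - G x u) v\<close> of \<open>remainder_eq\<close> of order
  \<open>s^3\<close>.\<close>

lemma half_step_minus_G: "norm (step (s\<^sup>2 / 2) x u - x - G x u) \<le> 2 * K * (1 + norm x) * s\<^sup>2 * \<rho>\<^sup>2"
proof -
  let ?b = "K * (1 + norm x)"
  have b: "0 \<le> ?b" using K_ge_1 by simp
  have "step (s\<^sup>2 / 2) x u - x - G x u = (s\<^sup>2 / 2) *\<^sub>R f x + H x u u - (s\<^sup>2 / 2) *\<^sub>R HO x"
    by (simp add: step_def)
  also have "norm \<dots> \<le> s\<^sup>2 / 2 * norm (f x) + norm (H x u u) + s\<^sup>2 / 2 * norm (HO x)"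
    by (rule order_trans[OF norm_triangle_ineq4] add_mono norm_triangle_le)+ auto
  also have "\<dots> \<le> s\<^sup>2 / 2 * ?b + ?b * (norm u)\<^sup>2 + s\<^sup>2 / 2 * ?b"
    by (intro add_mono mult_left_mono f_growth HO_growth)
       (use H_growth[of x u u] in \<open>auto simp: power2_eq_square mult_ac\<close>)
  also have "\<dots> \<le> ?b * (s\<^sup>2 * \<rho>\<^sup>2) + ?b * (s\<^sup>2 * \<rho>\<^sup>2)"
    using mult_left_mono[OF norm_u_sq b] mult_left_mono[OF monomials(4) b] by (simp add: algebra_simps)
  finally show ?thesis by (simp add: algebra_simps)
qed

lemma half_step_bound: "norm (step (s\<^sup>2 / 2) x u - x) \<le> 3 * K\<^sup>2 * (1 + norm x) * s * \<rho>\<^sup>2"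
proof -
  let ?b = "K * (1 + norm x)"
  have b: "0 \<le> ?b" using K_ge_1 by simp
  have "norm (step (s\<^sup>2 / 2) x u - x) \<le> norm (step (s\<^sup>2 / 2) x u - x - G x u) + norm (G x u)"
    by (metis norm_triangle_sub add.commute)
  also have "\<dots> \<le> 2 * ?b * (s\<^sup>2 * \<rho>\<^sup>2) + ?b * (s * \<rho>)"
    using half_step_minus_G[of x] G_growth[of x u] mult_left_mono[OF u_le b]
    by (simp add: mult_ac)
  also have "\<dots> \<le> 2 * ?b * (K * s * \<rho>\<^sup>2) + ?b * (K * s * \<rho>\<^sup>2)"
    by (intro add_mono mult_left_mono monomials) (use b in auto)
  finally show ?thesis by (simp add: algebra_simps power2_eq_square)
qed

text \<open>This relative bound lets the second half step, which starts at the intermediate state,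
  be estimated in terms of the initial state.\<close>

lemma half_step_growth: "1 + norm (step (s\<^sup>2 / 2) x u) \<le> 4 * K^3 * \<rho>\<^sup>2 * (1 + norm x)"
proof -
  have "1 + norm (step (s\<^sup>2 / 2) x u) \<le> (1 + norm x) + 3 * K\<^sup>2 * (1 + norm x) * s * \<rho>\<^sup>2"
    using half_step_bound[of x] norm_triangle_sub[of "step (s\<^sup>2 / 2) x u" x] by linarith
  also have "\<dots> = (1 + norm x) * 1 + 3 * K\<^sup>2 * (1 + norm x) * \<rho>\<^sup>2 * s" by simp
  also have "\<dots> \<le> (1 + norm x) * (K^3 * \<rho>\<^sup>2) + 3 * K\<^sup>2 * (1 + norm x) * \<rho>\<^sup>2 * K"
    using mult_mono[OF one_le_power[OF K_ge_1, of 3] one_le_power[OF rho_ge_1, of 2]] K_ge_1 s_le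
    by (intro add_mono mult_left_mono) auto
  finally show ?thesis by (simp add: algebra_simps power2_eq_square power3_eq_cube)
qed

lemma swapped: "milstein_pointwise f Df G DG H HO K s \<rho> v u"
  by unfold_locales (use s_pos s_le rho_ge_1 u_le v_le in auto)

text \<open>\<open>half_step_bound\<close> is applied at both starting states. The growth of the
  intermediate state turns its 3 into 12, and the other half step adds 3.\<close>

lemma two_step_bound: "norm (two_step (s\<^sup>2) x u v - x) \<le> 15 * K^5 * (1 + norm x) * s * \<rho>^4"
proof -
  interpret sw: milstein_pointwise f Df G DG H HO K s \<rho> v u by (rule swapped)
  define y where "y = step (s\<^sup>2 / 2) x u"
  have nn: "0 \<le> 3 * K\<^sup>2 * s * \<rho>\<^sup>2" using K_ge_1 s_pos rho_ge_1 by simp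
  have "norm (step (s\<^sup>2 / 2) y v - x) \<le> norm (step (s\<^sup>2 / 2) y v - y) + norm (y - x)"
    using norm_triangle_ineq[of "step (s\<^sup>2 / 2) y v - y" "y - x"] by simp
  also have "\<dots> \<le> 3 * K\<^sup>2 * s * \<rho>\<^sup>2 * (1 + norm y) + 3 * K\<^sup>2 * s * \<rho>\<^sup>2 * (1 + norm x)"
    using sw.half_step_bound[of y] half_step_bound[of x] by (simp add: y_def mult_ac)
  also have "\<dots> \<le> 3 * K\<^sup>2 * s * \<rho>\<^sup>2 * (4 * K^3 * \<rho>\<^sup>2 * (1 + norm x)) + 3 * K\<^sup>2 * s * \<rho>\<^sup>2 * (K^3 * \<rho>\<^sup>2 * (1 + norm x))"
  proof (intro add_mono mult_left_mono nn)
    show "1 + norm y \<le> 4 * K^3 * \<rho>\<^sup>2 * (1 + norm x)" unfolding y_def by (rule half_step_growth)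
    have "1 \<le> K^3 * \<rho>\<^sup>2"
      using mult_mono[OF one_le_power[OF K_ge_1, of 3] one_le_power[OF rho_ge_1, of 2]] K_ge_1 by simp
    then show "1 + norm x \<le> K^3 * \<rho>\<^sup>2 * (1 + norm x)"
      using mult_right_mono[of 1 _ "1 + norm x"] by simp
  qed
  also have "\<dots> = 15 * K^5 * (1 + norm x) * s * \<rho>^4" by algebra
  finally show ?thesis by (simp add: two_step_def y_def)
qed

text \<open>The Taylor remainder of \<open>G\<close> dominates:
  \<open>K * Y\<^sup>2 * (s * \<rho>)\<close> has the factors \<open>K^5\<close>,
  \<open>(1 + norm x)^2\<close>, \<open>s^3\<close> and \<open>\<rho>^5\<close> all at once. The
  other terms are raised to this monomial, and the weights 3, 9, 2, 3 add up to 17.\<close>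

lemma remainder_bound: "norm (remainder (s\<^sup>2) x u v) \<le> 17 * K^5 * (1 + norm x)\<^sup>2 * s^3 * \<rho>^5"
proof -
  define y where "y = step (s\<^sup>2 / 2) x u"
  define b where "b = 1 + norm x"
  have b: "1 \<le> b" by (simp add: b_def)
  define Y where "Y = 3 * K\<^sup>2 * b * s * \<rho>\<^sup>2"
  have y: "norm (y - x) \<le> Y" using half_step_bound[of x] by (simp add: y_def Y_def b_def)
  have Y0: "0 \<le> Y" using K_ge_1 b s_pos by (simp add: Y_def)
  have "norm (remainder (s\<^sup>2) x u v) \<le> s\<^sup>2 / 2 * norm (f y - f x)
     + norm (G y v - G x v - DG x (y - x) v)
     + norm (DG x (y - x - G x u) v) + norm (H y v v - H x v v) + s\<^sup>2 / 2 * norm (HO y - HO x)"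
    unfolding remainder_eq y_def[symmetric]
    by (rule order_trans[OF norm_triangle_ineq4] add_mono norm_triangle_le)+ auto
  also have "\<dots> \<le> s\<^sup>2 / 2 * (K * Y) + K * Y\<^sup>2 * (s * \<rho>) + K * (2 * K * b * s\<^sup>2 * \<rho>\<^sup>2) * (s * \<rho>)
     + K * Y * (s\<^sup>2 * \<rho>\<^sup>2) + s\<^sup>2 / 2 * (K * Y)"
  proof (intro add_mono)
    show 1: "s\<^sup>2 / 2 * norm (f y - f x) \<le> s\<^sup>2 / 2 * (K * Y)"
      by (intro mult_left_mono order_trans[OF f_lip] y) (use K_ge_1 in auto)
    show "s\<^sup>2 / 2 * norm (HO y - HO x) \<le> s\<^sup>2 / 2 * (K * Y)"
      by (intro mult_left_mono order_trans[OF HO_lip] y) (use K_ge_1 in auto)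
    show "norm (G y v - G x v - DG x (y - x) v) \<le> K * Y\<^sup>2 * (s * \<rho>)"
      by (intro order_trans[OF G_taylor] mult_mono v_le power_mono y) (use K_ge_1 Y0 in auto)
    show "norm (DG x (y - x - G x u) v) \<le> K * (2 * K * b * s\<^sup>2 * \<rho>\<^sup>2) * (s * \<rho>)"
      using half_step_minus_G[of x] unfolding y_def b_def
      by (intro order_trans[OF DG_bound] mult_mono v_le) (use K_ge_1 rho_ge_1 in auto)
    have "norm (H y v v - H x v v) \<le> K * norm (y - x) * (norm v)\<^sup>2"
      using H_lip[of y v v x] by (simp add: power2_eq_square mult_ac)
    also have "\<dots> \<le> K * Y * (s\<^sup>2 * \<rho>\<^sup>2)"
      by (intro mult_mono norm_v_sq y) (use K_ge_1 Y0 in auto)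
    finally show "norm (H y v v - H x v v) \<le> K * Y * (s\<^sup>2 * \<rho>\<^sup>2)" .
  qed
  also have "\<dots> = 3 * (K^3 * b * s^3 * \<rho>\<^sup>2) + 9 * (K^5 * b\<^sup>2 * s^3 * \<rho>^5) + 2 * (K\<^sup>2 * b * s^3 * \<rho>^3)
     + 3 * (K^3 * b * s^3 * \<rho>^4)" unfolding Y_def by algebra
  also have "\<dots> \<le> 3 * (K^5 * b\<^sup>2 * s^3 * \<rho>^5) + 9 * (K^5 * b\<^sup>2 * s^3 * \<rho>^5) + 2 * (K^5 * b\<^sup>2 * s^3 * \<rho>^5)
     + 3 * (K^5 * b\<^sup>2 * s^3 * \<rho>^5)"
    using K_ge_1 b s_pos rho_ge_1
    by (intro add_mono mult_left_mono[of _ _ "3::real"] mult_left_mono[of _ _ "2::real"] order_refl mult_mono power_increasing self_le_power)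
       (auto)
  finally show ?thesis by (simp add: b_def mult_ac)
qed

lemma norm_u_plus_v: "norm (u + v) \<le> 2 * (s * \<rho>)" "(norm (u + v))\<^sup>2 \<le> 4 * (s\<^sup>2 * \<rho>\<^sup>2)"
proof -
  show *: "norm (u + v) \<le> 2 * (s * \<rho>)" using norm_triangle_ineq[of u v] u_le v_le by linarith
  show "(norm (u + v))\<^sup>2 \<le> 4 * (s\<^sup>2 * \<rho>\<^sup>2)"
    using power_mono[OF *, of 2] by (simp add: power_mult_distrib)
qed

lemma coarse_increment_diff:
  "norm (coarse_increment (s\<^sup>2) x (u + v) - coarse_increment (s\<^sup>2) y (u + v))
     \<le> 8 * K\<^sup>2 * norm (x - y) * s * \<rho>\<^sup>2"
proof -
  let ?d = "K * norm (x - y)"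
  have d: "0 \<le> ?d" using K_ge_1 by simp
  have "coarse_increment (s\<^sup>2) x (u + v) - coarse_increment (s\<^sup>2) y (u + v)
     = s\<^sup>2 *\<^sub>R (f x - f y) + (G x (u + v) - G y (u + v)) + (H x (u + v) (u + v) - H y (u + v) (u + v))
       - s\<^sup>2 *\<^sub>R (HO x - HO y)"
    by (simp add: coarse_increment_def scaleR_diff_right)
  also have "norm \<dots> \<le> s\<^sup>2 * norm (f x - f y) + norm (G x (u + v) - G y (u + v))
     + norm (H x (u + v) (u + v) - H y (u + v) (u + v)) + s\<^sup>2 * norm (HO x - HO y)"
    by (rule order_trans[OF norm_triangle_ineq4] add_mono norm_triangle_le)+ auto
  also have "\<dots> \<le> s\<^sup>2 * ?d + ?d * norm (u + v) + ?d * (norm (u + v))\<^sup>2 + s\<^sup>2 * ?d"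
    by (intro add_mono mult_left_mono f_lip HO_lip G_lip)
       (use H_lip[of x "u + v" "u + v" y] in \<open>auto simp: power2_eq_square mult_ac\<close>)
  also have "\<dots> \<le> ?d * (K * s * \<rho>\<^sup>2) + ?d * (2 * (K * s * \<rho>\<^sup>2)) + ?d * (4 * (K * s * \<rho>\<^sup>2)) + ?d * (K * s * \<rho>\<^sup>2)"
    unfolding mult.commute[of "s\<^sup>2" ?d]
    by (intro add_mono mult_left_mono d) (use norm_u_plus_v monomials in auto)
  finally show ?thesis by (simp add: algebra_simps power2_eq_square)
qed

lemma levy_term_bound: "norm (levy_term x u v) \<le> 2 * K * (1 + norm x) * s\<^sup>2 * \<rho>\<^sup>2"
proof -
  let ?b = "K * (1 + norm x)"
  have "norm (levy_term x u v) \<le> norm (H x v u) + norm (H x u v)"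
    unfolding levy_term_def by (rule norm_triangle_ineq4)
  also have "\<dots> \<le> ?b * (norm u * norm v) + ?b * (norm u * norm v)"
    by (intro add_mono) (use H_growth[of x u v] H_growth[of x v u] in \<open>simp_all add: mult_ac\<close>)
  also have "\<dots> \<le> ?b * (s\<^sup>2 * \<rho>\<^sup>2) + ?b * (s\<^sup>2 * \<rho>\<^sup>2)"
    by (intro add_mono mult_left_mono norm_uv) (use K_ge_1 in auto)
  finally show ?thesis by (simp add: algebra_simps)
qed

text \<open>In the mean over a fine and an antithetic step the Levy terms survive only as this
  difference, which gains the factor \<open>norm (x - y)\<close> over
  \<open>levy_term_bound\<close>.\<close>

lemma levy_term_diff: "norm (levy_term x u v - levy_term y u v) \<le> 2 * K * norm (x - y) * s\<^sup>2 * \<rho>\<^sup>2"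
proof -
  let ?b = "K * norm (x - y)"
  have "levy_term x u v - levy_term y u v = (H x v u - H y v u) - (H x u v - H y u v)"
    by (simp add: levy_term_def)
  also have "norm \<dots> \<le> norm (H x v u - H y v u) + norm (H x u v - H y u v)"
    by (rule norm_triangle_ineq4)
  also have "\<dots> \<le> ?b * (norm u * norm v) + ?b * (norm u * norm v)"
    by (intro add_mono) (use H_lip[of x u v y] H_lip[of x v u y] in \<open>simp_all add: mult_ac\<close>)
  also have "\<dots> \<le> ?b * (s\<^sup>2 * \<rho>\<^sup>2) + ?b * (s\<^sup>2 * \<rho>\<^sup>2)"
    by (intro add_mono mult_left_mono norm_uv) (use K_ge_1 in auto)
  finally show ?thesis by (simp add: algebra_simps)
qed

lemma levy_term_swap: "levy_term x v u = - levy_term x u v"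
  by (simp add: levy_term_def)

text \<open>Swapping the half increments reverses the Levy term, so in the difference of the two
  steps the Levy terms add up. They contribute order \<open>s^2\<close> without a factor
  \<open>norm (x - y)\<close>, which is what drives the two states apart. The 19 is 2 from a Levy
  term plus 17 from a remainder, after one \<open>s\<close> of \<open>s^3\<close> has been bounded
  by \<open>K\<close>.\<close>

lemma fine_antithetic_increment_bound:
  "norm ((two_step (s\<^sup>2) x u v - x) - (two_step (s\<^sup>2) y v u - y))
     \<le> 19 * K^6 * s * \<rho>^5 * (norm (x - y) + s * ((1 + norm x)\<^sup>2 + (1 + norm y)\<^sup>2))"
proof -
  interpret sw: milstein_pointwise f Df G DG H HO K s \<rho> v u by (rule swapped)
  define a b where "a = 1 + norm x" and "b = 1 + norm y"
  have ab: "1 \<le> a" "1 \<le> b" by (auto simp: a_def b_def)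
  have eq: "(two_step (s\<^sup>2) x u v - x) - (two_step (s\<^sup>2) y v u - y) =
    (coarse_increment (s\<^sup>2) x (u + v) - coarse_increment (s\<^sup>2) y (u + v)) + levy_term x u v + levy_term y u v
     + remainder (s\<^sup>2) x u v - remainder (s\<^sup>2) y v u"
    by (simp add: two_step_decomp levy_term_swap[of y] add.commute[of v u])
  have "norm ((two_step (s\<^sup>2) x u v - x) - (two_step (s\<^sup>2) y v u - y))
     \<le> norm (coarse_increment (s\<^sup>2) x (u + v) - coarse_increment (s\<^sup>2) y (u + v))
     + norm (levy_term x u v) + norm (levy_term y u v)
     + norm (remainder (s\<^sup>2) x u v) + norm (remainder (s\<^sup>2) y v u)"
    unfolding eq by (rule norm_sum5_le)
  also have "\<dots> \<le> 8 * K\<^sup>2 * norm (x - y) * s * \<rho>\<^sup>2 + 2 * K * a * s\<^sup>2 * \<rho>\<^sup>2 + 2 * K * b * s\<^sup>2 * \<rho>\<^sup>2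
     + 17 * K^5 * a\<^sup>2 * s^3 * \<rho>^5 + 17 * K^5 * b\<^sup>2 * s^3 * \<rho>^5"
    unfolding a_def b_def
    by (intro add_mono coarse_increment_diff levy_term_bound remainder_bound sw.remainder_bound)
  also have "\<dots> = 8 * (K\<^sup>2 * norm (x - y) * s * \<rho>\<^sup>2) + 2 * (K * a * s\<^sup>2 * \<rho>\<^sup>2) + 2 * (K * b * s\<^sup>2 * \<rho>\<^sup>2)
     + 17 * (K^5 * a\<^sup>2 * (s\<^sup>2 * s) * \<rho>^5) + 17 * (K^5 * b\<^sup>2 * (s\<^sup>2 * s) * \<rho>^5)" by algebra
  also have "\<dots> \<le> 8 * (K^6 * norm (x - y) * s * \<rho>^5) + 2 * (K^6 * a\<^sup>2 * s\<^sup>2 * \<rho>^5) + 2 * (K^6 * b\<^sup>2 * s\<^sup>2 * \<rho>^5)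
     + 17 * (K^5 * a\<^sup>2 * (s\<^sup>2 * K) * \<rho>^5) + 17 * (K^5 * b\<^sup>2 * (s\<^sup>2 * K) * \<rho>^5)"
    using K_ge_1 ab s_pos rho_ge_1 s_le
    by (intro add_mono mult_left_mono[of _ _ "8::real"] mult_left_mono[of _ _ "17::real"]
         mult_left_mono[of _ _ "2::real"] order_refl mult_mono power_increasing self_le_power mult_nonneg_nonneg)
       (auto)
  also have "\<dots> \<le> 19 * (K^6 * norm (x - y) * s * \<rho>^5) + 2 * (K^6 * a\<^sup>2 * s\<^sup>2 * \<rho>^5) + 2 * (K^6 * b\<^sup>2 * s\<^sup>2 * \<rho>^5)
     + 17 * (K^5 * a\<^sup>2 * (s\<^sup>2 * K) * \<rho>^5) + 17 * (K^5 * b\<^sup>2 * (s\<^sup>2 * K) * \<rho>^5)"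
    using K_ge_1 s_pos rho_ge_1 by (intro add_right_mono mult_right_mono) auto
  also have "\<dots> = 19 * K^6 * s * \<rho>^5 * (norm (x - y) + s * (a\<^sup>2 + b\<^sup>2))" by algebra
  finally show ?thesis by (simp add: a_def b_def)
qed

text \<open>\<open>f\<close> and \<open>G\<close> have second-order expansions and contribute the
  square of the distance; \<open>H\<close> and \<open>HO\<close> contribute its first power, but
  with \<open>s^2\<close> in front.\<close>

lemma coarse_increment_midpoint:
  "norm ((1/2) *\<^sub>R (coarse_increment (s\<^sup>2) x (u + v) + coarse_increment (s\<^sup>2) y (u + v))
       - coarse_increment (s\<^sup>2) ((1/2) *\<^sub>R (x + y)) (u + v))
     \<le> 3 * K\<^sup>2 * (norm (x - y))\<^sup>2 * s * \<rho>\<^sup>2 + 5 * K * norm (x - y) * s\<^sup>2 * \<rho>\<^sup>2"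
proof -
  define m where "m = (1/2) *\<^sub>R (x + y)"
  let ?w = "u + v"
  let ?d = "norm (x - y)"
  have eq: "(1/2) *\<^sub>R (coarse_increment (s\<^sup>2) x ?w + coarse_increment (s\<^sup>2) y ?w) - coarse_increment (s\<^sup>2) m ?w
     = s\<^sup>2 *\<^sub>R ((1/2) *\<^sub>R (f x + f y) - f m) + ((1/2) *\<^sub>R (G x ?w + G y ?w) - G m ?w)
       + ((1/2) *\<^sub>R (H x ?w ?w + H y ?w ?w) - H m ?w ?w) + 0 - s\<^sup>2 *\<^sub>R ((1/2) *\<^sub>R (HO x + HO y) - HO m)"
    by (simp add: coarse_increment_def algebra_simps)
  have "norm ((1/2) *\<^sub>R (coarse_increment (s\<^sup>2) x ?w + coarse_increment (s\<^sup>2) y ?w) - coarse_increment (s\<^sup>2) m ?w)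
     \<le> norm (s\<^sup>2 *\<^sub>R ((1/2) *\<^sub>R (f x + f y) - f m)) + norm ((1/2) *\<^sub>R (G x ?w + G y ?w) - G m ?w)
       + norm ((1/2) *\<^sub>R (H x ?w ?w + H y ?w ?w) - H m ?w ?w) + norm (0::'e)
       + norm (s\<^sup>2 *\<^sub>R ((1/2) *\<^sub>R (HO x + HO y) - HO m))"
    unfolding eq by (rule norm_sum5_le)
  also have "\<dots> = s\<^sup>2 * norm ((1/2) *\<^sub>R (f x + f y) - f m) + norm ((1/2) *\<^sub>R (G x ?w + G y ?w) - G m ?w)
       + norm ((1/2) *\<^sub>R (H x ?w ?w + H y ?w ?w) - H m ?w ?w)
       + s\<^sup>2 * norm ((1/2) *\<^sub>R (HO x + HO y) - HO m)" by simp
  also have "\<dots> \<le> s\<^sup>2 * (K * ?d\<^sup>2) + K * ?d\<^sup>2 * norm ?w + K * ?d * norm ?w * norm ?w + s\<^sup>2 * (K * ?d)"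
    unfolding m_def by (intro add_mono mult_left_mono f_midpoint G_midpoint H_midpoint HO_midpoint) auto
  also have "\<dots> = K * ?d\<^sup>2 * s\<^sup>2 + K * ?d\<^sup>2 * norm ?w + K * ?d * (norm ?w)\<^sup>2 + K * ?d * s\<^sup>2"
    by algebra
  also have "\<dots> \<le> K * ?d\<^sup>2 * (K * s * \<rho>\<^sup>2) + K * ?d\<^sup>2 * (2 * (K * s * \<rho>\<^sup>2))
      + K * ?d * (4 * (s\<^sup>2 * \<rho>\<^sup>2)) + K * ?d * (s\<^sup>2 * \<rho>\<^sup>2)"
    using norm_u_plus_v monomials K_ge_1 by (intro add_mono mult_left_mono) auto
  also have "\<dots> = 3 * K\<^sup>2 * ?d\<^sup>2 * s * \<rho>\<^sup>2 + 5 * K * ?d * s\<^sup>2 * \<rho>\<^sup>2" by algebra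
  finally show ?thesis by (simp add: m_def)
qed

text \<open>The midpoint of \<open>x\<close> and \<open>y\<close> is interposed between these states
  and \<open>c\<close>. On the scale where \<open>norm (x - y)\<close> is of order \<open>s\<close>
  and \<open>norm e\<close> of order \<open>s^2\<close>, all terms of the last bracket have order
  \<open>s^2\<close>.\<close>

lemma average_coarse_increment_bound:
  fixes x y c
  defines "e \<equiv> (1/2) *\<^sub>R (x + y) - c"
  shows "norm ((1/2) *\<^sub>R ((two_step (s\<^sup>2) x u v - x) + (two_step (s\<^sup>2) y v u - y)) - coarse_increment (s\<^sup>2) c (u + v))
     \<le> 9 * K^5 * s * \<rho>^5 * (norm e + (norm (x - y))\<^sup>2 + s * norm (x - y)
          + s\<^sup>2 * ((1 + norm x)\<^sup>2 + (1 + norm y)\<^sup>2))"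
proof -
  interpret sw: milstein_pointwise f Df G DG H HO K s \<rho> v u by (rule swapped)
  define a b where "a = 1 + norm x" and "b = 1 + norm y"
  define m where "m = (1/2) *\<^sub>R (x + y)"
  let ?S = "\<lambda>x. coarse_increment (s\<^sup>2) x (u + v)"
  let ?d = "norm (x - y)"
  have eq: "(1/2) *\<^sub>R ((two_step (s\<^sup>2) x u v - x) + (two_step (s\<^sup>2) y v u - y)) - ?S c =
    ((1/2) *\<^sub>R (?S x + ?S y) - ?S m) + (?S m - ?S c) + (1/2) *\<^sub>R (levy_term x u v - levy_term y u v)
     + (1/2) *\<^sub>R remainder (s\<^sup>2) x u v - (- ((1/2) *\<^sub>R remainder (s\<^sup>2) y v u))"
    by (simp add: two_step_decomp levy_term_swap[of y] add.commute[of v u] scaleR_add_right scaleR_diff_right)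
  have "norm ((1/2) *\<^sub>R ((two_step (s\<^sup>2) x u v - x) + (two_step (s\<^sup>2) y v u - y)) - ?S c)
     \<le> norm ((1/2) *\<^sub>R (?S x + ?S y) - ?S m) + norm (?S m - ?S c)
     + norm ((1/2) *\<^sub>R (levy_term x u v - levy_term y u v))
     + norm ((1/2) *\<^sub>R remainder (s\<^sup>2) x u v) + norm (- ((1/2) *\<^sub>R remainder (s\<^sup>2) y v u))"
    unfolding eq by (rule norm_sum5_le)
  also have "\<dots> = norm ((1/2) *\<^sub>R (?S x + ?S y) - ?S m) + norm (?S m - ?S c)
     + 1/2 * norm (levy_term x u v - levy_term y u v)
     + 1/2 * norm (remainder (s\<^sup>2) x u v) + 1/2 * norm (remainder (s\<^sup>2) y v u)" by simp
  also have "\<dots> \<le> (3 * K\<^sup>2 * ?d\<^sup>2 * s * \<rho>\<^sup>2 + 5 * K * ?d * s\<^sup>2 * \<rho>\<^sup>2) + 8 * K\<^sup>2 * norm e * s * \<rho>\<^sup>2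
     + 1/2 * (2 * K * ?d * s\<^sup>2 * \<rho>\<^sup>2) + 1/2 * (17 * K^5 * a\<^sup>2 * s^3 * \<rho>^5) + 1/2 * (17 * K^5 * b\<^sup>2 * s^3 * \<rho>^5)"
    unfolding a_def b_def e_def m_def
    by (intro add_mono mult_left_mono coarse_increment_diff coarse_increment_midpoint levy_term_diff
        remainder_bound sw.remainder_bound) auto
  also have "\<dots> = 8 * (K\<^sup>2 * norm e * s * \<rho>\<^sup>2) + 3 * (K\<^sup>2 * ?d\<^sup>2 * s * \<rho>\<^sup>2) + 6 * (K * ?d * s\<^sup>2 * \<rho>\<^sup>2)
     + 17/2 * (K^5 * a\<^sup>2 * s^3 * \<rho>^5) + 17/2 * (K^5 * b\<^sup>2 * s^3 * \<rho>^5)" by simp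
  also have "\<dots> \<le> 9 * (K^5 * norm e * s * \<rho>^5) + 9 * (K^5 * ?d\<^sup>2 * s * \<rho>^5) + 9 * (K^5 * ?d * s\<^sup>2 * \<rho>^5)
     + 9 * (K^5 * a\<^sup>2 * s^3 * \<rho>^5) + 9 * (K^5 * b\<^sup>2 * s^3 * \<rho>^5)"
  proof -
    have "8 * (K\<^sup>2 * norm e * s * \<rho>\<^sup>2) \<le> 9 * (K^5 * norm e * s * \<rho>^5)"
      "3 * (K\<^sup>2 * ?d\<^sup>2 * s * \<rho>\<^sup>2) \<le> 9 * (K^5 * ?d\<^sup>2 * s * \<rho>^5)"
      "6 * (K * ?d * s\<^sup>2 * \<rho>\<^sup>2) \<le> 9 * (K^5 * ?d * s\<^sup>2 * \<rho>^5)"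
      using K_ge_1 s_pos rho_ge_1
      by (intro mult_mono power_increasing self_le_power order_refl; auto)+
    moreover have "0 \<le> K^5 * a\<^sup>2 * s^3 * \<rho>^5" "0 \<le> K^5 * b\<^sup>2 * s^3 * \<rho>^5"
      using K_ge_1 s_pos rho_ge_1 by auto
    ultimately show ?thesis by linarith
  qed
  also have "\<dots> = 9 * K^5 * s * \<rho>^5 * (norm e + ?d\<^sup>2 + s * ?d + s\<^sup>2 * (a\<^sup>2 + b\<^sup>2))" by algebra
  finally show ?thesis by (simp add: a_def b_def)
qed

end

section \<open>Increments with scaled moments\<close>

context milstein_coefficients
begin

text \<open>Here \<open>s\<^sup>2\<close> is the full time step, while \<open>\<mu>\<close> is the law of an increment over half a step.\<close>

definition increment_law :: "real \<Rightarrow> (nat \<Rightarrow> real) \<Rightarrow> 'u measure \<Rightarrow> bool" where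
  "increment_law s c \<mu> \<longleftrightarrow> prob_space \<mu> \<and> sets \<mu> = sets borel \<and> (\<integral>u. u \<partial>\<mu>) = 0
     \<and> (\<forall>x. (\<integral>u. H x u u \<partial>\<mu>) = (s\<^sup>2 / 2) *\<^sub>R HO x)
     \<and> (\<forall>m. integrable \<mu> (\<lambda>u. norm u ^ m) \<and> (\<integral>u. norm u ^ m \<partial>\<mu>) \<le> c m * s ^ m)"

lemma continuous_f: "continuous_on UNIV f"
  by (rule lipschitz_on_continuous_on[OF lipschitz_onI[of _ _ K]]) (use K_ge_1 f_lip in \<open>auto simp: dist_norm\<close>)

lemma continuous_HO: "continuous_on UNIV HO"
  by (rule lipschitz_on_continuous_on[OF lipschitz_onI[of _ _ K]]) (use K_ge_1 HO_lip in \<open>auto simp: dist_norm\<close>)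

lemma borel_measurable_pair_continuous:
  fixes \<phi> :: "'a::second_countable_topology \<times> 'b::second_countable_topology \<Rightarrow> 'c::topological_space"
  assumes "continuous_on UNIV \<phi>" "X \<in> borel_measurable M" "Y \<in> borel_measurable M"
  shows "(\<lambda>\<omega>. \<phi> (X \<omega>, Y \<omega>)) \<in> borel_measurable M"
  using measurable_compose[OF borel_measurable_Pair[OF assms(2,3)] borel_measurable_continuous_onI[OF assms(1)]] .

lemma f_measurable [measurable]: "f \<in> borel_measurable borel"
  by (rule borel_measurable_continuous_onI[OF continuous_f])

lemma HO_measurable [measurable]: "HO \<in> borel_measurable borel"
  by (rule borel_measurable_continuous_onI[OF continuous_HO])

lemma G_measurable [measurable (raw)]:
  assumes "X \<in> borel_measurable M" "Y \<in> borel_measurable M"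
  shows "(\<lambda>\<omega>. G (X \<omega>) (Y \<omega>)) \<in> borel_measurable M"
  using borel_measurable_pair_continuous[OF G_cont assms] by simp

lemma H_measurable [measurable (raw)]:
  assumes "X \<in> borel_measurable M" "Y \<in> borel_measurable M"
  shows "(\<lambda>\<omega>. H (X \<omega>) (Y \<omega>) (Y \<omega>)) \<in> borel_measurable M"
  using borel_measurable_pair_continuous[OF H_cont assms] by simp

lemma step_measurable [measurable (raw)]:
  assumes [measurable]: "X \<in> borel_measurable M" "Y \<in> borel_measurable M"
  shows "(\<lambda>\<omega>. step \<tau> (X \<omega>) (Y \<omega>)) \<in> borel_measurable M"
  unfolding step_def by measurable

lemma coarse_increment_measurable [measurable (raw)]:
  assumes [measurable]: "X \<in> borel_measurable M" "Y \<in> borel_measurable M"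
  shows "(\<lambda>\<omega>. coarse_increment \<tau> (X \<omega>) (Y \<omega>)) \<in> borel_measurable M"
  unfolding coarse_increment_def by measurable

lemma two_step_measurable [measurable (raw)]:
  assumes [measurable]: "X \<in> borel_measurable M" "Y \<in> borel_measurable M" "Z \<in> borel_measurable M"
  shows "(\<lambda>\<omega>. two_step \<tau> (X \<omega>) (Y \<omega>) (Z \<omega>)) \<in> borel_measurable M"
  unfolding two_step_def by measurable

lemma noise_mean:
  assumes "increment_law s c \<mu>"
  shows "integrable \<mu> (\<lambda>u. u)" "integrable \<mu> (\<lambda>u. G x u)" "integrable \<mu> (\<lambda>u. H x u u)"
    "(\<integral>u. G x u \<partial>\<mu>) = 0" "(\<integral>u. H x u u \<partial>\<mu>) = (s\<^sup>2 / 2) *\<^sub>R HO x"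
proof -
  interpret prob_space \<mu> using assms by (simp add: increment_law_def)
  have [measurable_cong]: "sets \<mu> = sets borel" using assms by (simp add: increment_law_def)
  have int: "integrable \<mu> (\<lambda>u. norm u ^ m)" for m using assms by (simp add: increment_law_def)
  show i: "integrable \<mu> (\<lambda>u. u)"
    by (rule Bochner_Integration.integrable_bound[OF int[of 1]]) auto
  have "bounded_linear (G x)" using G_linear by (rule linear_conv_bounded_linear[THEN iffD1])
  from integrable_bounded_linear[OF this i] integral_bounded_linear[OF this i]
  show "integrable \<mu> (\<lambda>u. G x u)" "(\<integral>u. G x u \<partial>\<mu>) = 0"
    using assms linear_0[OF G_linear] by (auto simp: increment_law_def)
  show "integrable \<mu> (\<lambda>u. H x u u)"
  proof (rule Bochner_Integration.integrable_bound)
    show "integrable \<mu> (\<lambda>u. (K * (1 + norm x)) * norm u ^ 2)" using int by (rule integrable_mult_right)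
    show "AE u in \<mu>. norm (H x u u) \<le> norm ((K * (1 + norm x)) * norm u ^ 2)"
      using H_growth[of x] K_ge_1 by (auto simp: power2_eq_square abs_mult mult_ac)
  qed measurable
  show "(\<integral>u. H x u u \<partial>\<mu>) = (s\<^sup>2 / 2) *\<^sub>R HO x" using assms by (simp add: increment_law_def)
qed

text \<open>The correction with \<open>HO\<close> is exactly the mean of the quadratic term, so the
  noise of a half step is centred at every frozen state.\<close>

lemma half_step_noise_mean:
  assumes "increment_law s c \<mu>"
  shows "integrable \<mu> (\<lambda>u. G x u + H x u u - (s\<^sup>2 / 2) *\<^sub>R HO x)"
    "(\<integral>u. (G x u + H x u u - (s\<^sup>2 / 2) *\<^sub>R HO x) \<partial>\<mu>) = 0"
proof -
  interpret prob_space \<mu> using assms by (simp add: increment_law_def)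
  note n = noise_mean[OF assms]
  show "integrable \<mu> (\<lambda>u. G x u + H x u u - (s\<^sup>2 / 2) *\<^sub>R HO x)" using n by simp
  show "(\<integral>u. (G x u + H x u u - (s\<^sup>2 / 2) *\<^sub>R HO x) \<partial>\<mu>) = 0" using n by (simp add: prob_space)
qed

end

section \<open>Moments and means over two independent half increments\<close>

definition moment_constant :: "(nat \<Rightarrow> real) \<Rightarrow> nat \<Rightarrow> real" where
  "moment_constant c m = 3 ^ m * (1 + 2 * c m)"

text \<open>The constant of \<open>two_step_mean_bound\<close>: one summand comes from the Taylor
  remainder of \<open>f\<close>, with 9/2 rounded up to 5, the other from \<open>Df x\<close>
  applied to the mean displacement.\<close>

definition mean_constant :: "real \<Rightarrow> (nat \<Rightarrow> real) \<Rightarrow> real" where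
  "mean_constant K c = 5 * K^5 * moment_constant c 4 + K\<^sup>2"

text \<open>The state is frozen and the two half increments become the coordinates of a product
  measure, which encodes their independence. The two laws are kept apart so that exchanging them
  turns statements about the fine state into statements about the antithetic state.\<close>

locale milstein_noise = milstein_coefficients f Df G DG H HO K
  for f :: "'e::euclidean_space \<Rightarrow> 'e" and Df
    and G :: "'e \<Rightarrow> 'u::euclidean_space \<Rightarrow> 'e" and DG H HO K +
  fixes s :: real and c :: "nat \<Rightarrow> real" and \<mu> \<nu> :: "'u measure"
  assumes s_pos: "0 < s" and s_le: "s \<le> K"
    and law_mu: "increment_law s c \<mu>" and law_nu: "increment_law s c \<nu>"
begin

sublocale mu: prob_space \<mu> using law_mu by (simp add: increment_law_def)
sublocale nu: prob_space \<nu> using law_nu by (simp add: increment_law_def)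
sublocale pair_prob_space \<mu> \<nu> ..

lemma sets_mu [measurable_cong, simp]: "sets \<mu> = sets borel" using law_mu by (simp add: increment_law_def)
lemma sets_nu [measurable_cong, simp]: "sets \<nu> = sets borel" using law_nu by (simp add: increment_law_def)

abbreviation "Q \<equiv> \<mu> \<Otimes>\<^sub>M \<nu>"

text \<open>The parameter of the pointwise estimates, now random: it dominates both increments in
  units of \<open>s\<close>, and the summand 1 keeps it at least 1.\<close>

definition \<rho> :: "'u \<times> 'u \<Rightarrow> real" where "\<rho> p = 1 + (norm (fst p) + norm (snd p)) / s"

lemma rho_measurable [measurable]: "\<rho> \<in> borel_measurable Q"
  unfolding \<rho>_def by measurable

lemma rho_ge_1: "1 \<le> \<rho> p"
  using s_pos by (simp add: \<rho>_def)

lemma pointwise: "milstein_pointwise f Df G DG H HO K s (\<rho> p) (fst p) (snd p)"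
  by unfold_locales (use s_pos s_le rho_ge_1 in \<open>auto simp: \<rho>_def field_simps\<close>)

lemma swapped: "milstein_noise f Df G DG H HO K s c \<nu> \<mu>"
  by unfold_locales (use s_pos s_le law_mu law_nu in auto)

lemma
  fixes \<phi> :: "'u \<Rightarrow> 'b::{banach, second_countable_topology}"
  shows integrable_fst: "integrable \<mu> \<phi> \<Longrightarrow> integrable Q (\<lambda>p. \<phi> (fst p))"
    and integrable_snd: "integrable \<nu> \<phi> \<Longrightarrow> integrable Q (\<lambda>p. \<phi> (snd p))"
proof -
  assume "integrable \<mu> \<phi>"
  then show "integrable Q (\<lambda>p. \<phi> (fst p))"
    by (intro Fubini_integrable) (auto simp: nu.prob_space)
next
  assume "integrable \<nu> \<phi>"
  then show "integrable Q (\<lambda>p. \<phi> (snd p))"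
    by (intro Fubini_integrable) auto
qed

lemma
  fixes \<phi> :: "'u \<Rightarrow> 'b::{banach, second_countable_topology}"
  shows integral_fst_Q: "integrable \<mu> \<phi> \<Longrightarrow> (\<integral>p. \<phi> (fst p) \<partial>Q) = (\<integral>u. \<phi> u \<partial>\<mu>)"
    and integral_snd_Q: "integrable \<nu> \<phi> \<Longrightarrow> (\<integral>p. \<phi> (snd p) \<partial>Q) = (\<integral>v. \<phi> v \<partial>\<nu>)"
  using integral_fst'[OF integrable_fst, of \<phi>] integral_fst'[OF integrable_snd, of \<phi>]
  by (simp_all add: nu.prob_space mu.prob_space)

lemma increment_moment:
  assumes "increment_law s c \<kappa>"
  shows "integrable \<kappa> (\<lambda>u. (norm u / s) ^ m)" "(\<integral>u. (norm u / s) ^ m \<partial>\<kappa>) \<le> c m"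
  using assms s_pos by (simp_all add: increment_law_def power_divide divide_le_eq)

lemma rho_power_le: "\<rho> p ^ m \<le> 3 ^ m * (1 + ((norm (fst p) / s) ^ m + (norm (snd p) / s) ^ m))"
proof -
  define a b where "a = norm (fst p) / s" and "b = norm (snd p) / s"
  \<comment> \<open>Three summands are at most three times their maximum, and a power of the maximum
    is one of the three powers. This is the origin of \<open>3 ^ m\<close> in
    \<open>moment_constant\<close>; the 2 there counts the two increments.\<close>
  define M where "M = max 1 (max a b)"
  have ab: "0 \<le> a" "0 \<le> b" using s_pos by (auto simp: a_def b_def)
  have "\<rho> p = 1 + a + b" by (simp add: \<rho>_def a_def b_def add_divide_distrib)
  also have "\<dots> \<le> 3 * M" by (auto simp: M_def)
  finally have "\<rho> p ^ m \<le> (3 * M) ^ m" using rho_ge_1[of p] by (intro power_mono) auto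
  moreover have "M ^ m \<le> 1 + (a ^ m + b ^ m)" using ab by (auto simp: M_def max_def)
  ultimately show ?thesis unfolding a_def[symmetric] b_def[symmetric] power_mult_distrib
    by (meson mult_left_mono order_trans zero_le_numeral zero_le_power)
qed

lemma
  shows integrable_rho: "integrable Q (\<lambda>p. \<rho> p ^ m)"
    and integral_rho: "(\<integral>p. \<rho> p ^ m \<partial>Q) \<le> moment_constant c m"
proof -
  let ?g = "\<lambda>p. 3 ^ m * (1 + ((norm (fst p) / s) ^ m + (norm (snd p) / s) ^ m))"
  note i = integrable_fst[OF increment_moment(1)[OF law_mu]] integrable_snd[OF increment_moment(1)[OF law_nu]]
  have g: "integrable Q ?g" by (intro integrable_mult_right Bochner_Integration.integrable_add i) simp
  show r: "integrable Q (\<lambda>p. \<rho> p ^ m)"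
  proof (rule Bochner_Integration.integrable_bound[OF g])
    show "AE p in Q. norm (\<rho> p ^ m) \<le> norm (?g p)"
    proof (rule AE_I2)
      fix p
      have "0 \<le> \<rho> p ^ m" using rho_ge_1[of p] by simp
      then show "norm (\<rho> p ^ m) \<le> norm (?g p)"
        using rho_power_le[of p m] abs_ge_self[of "?g p"] unfolding real_norm_def by linarith
    qed
  qed measurable
  have "(\<integral>p. \<rho> p ^ m \<partial>Q) \<le> (\<integral>p. ?g p \<partial>Q)"
    by (intro integral_mono r g rho_power_le)
  also have "\<dots> = 3 ^ m * (1 + ((\<integral>u. (norm u / s) ^ m \<partial>\<mu>) + (\<integral>v. (norm v / s) ^ m \<partial>\<nu>)))"
    using i integral_fst_Q[OF increment_moment(1)[OF law_mu]] integral_snd_Q[OF increment_moment(1)[OF law_nu]]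
    by (simp add: P.prob_space)
  also have "\<dots> \<le> 3 ^ m * (1 + (c m + c m))"
    by (intro mult_left_mono add_mono increment_moment(2)[OF law_mu] increment_moment(2)[OF law_nu]) auto
  finally show "(\<integral>p. \<rho> p ^ m \<partial>Q) \<le> moment_constant c m" by (simp add: moment_constant_def)
qed

lemma moment_constant_ge_1: "1 \<le> moment_constant c m"
proof -
  have "(\<integral>p. 1 \<partial>Q) \<le> (\<integral>p. \<rho> p ^ m \<partial>Q)"
    by (intro integral_mono integrable_rho) (use rho_ge_1 in \<open>auto simp: one_le_power\<close>)
  then show ?thesis using integral_rho[of m] by (simp add: P.prob_space)
qed

text \<open>The passage from the pointwise estimates, all of which end in a constant times a power
  of \<open>\<rho>\<close>, to integrability and to bounds in expectation.\<close>

lemma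
  fixes \<phi> :: "'u \<times> 'u \<Rightarrow> 'b::{banach, second_countable_topology}"
  assumes "\<phi> \<in> borel_measurable Q" "\<And>p. norm (\<phi> p) \<le> C * \<rho> p ^ m"
  shows integrable_rho_bound: "integrable Q \<phi>"
    and norm_integral_rho_bound: "norm (\<integral>p. \<phi> p \<partial>Q) \<le> C * moment_constant c m"
proof -
  have C: "0 \<le> C"
  proof -
    have "0 < \<rho> undefined ^ m" using rho_ge_1[of undefined] by simp
    then show ?thesis
      using order_trans[OF norm_ge_zero assms(2)[of undefined]] by (simp add: zero_le_mult_iff)
  qed
  show i: "integrable Q \<phi>"
    by (rule Bochner_Integration.integrable_bound[of Q "\<lambda>p. C * \<rho> p ^ m"])
       (auto intro!: integrable_rho assms(1) AE_I2 order_trans[OF assms(2)])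
  have "norm (\<integral>p. \<phi> p \<partial>Q) \<le> (\<integral>p. norm (\<phi> p) \<partial>Q)" by (rule integral_norm_bound)
  also have "\<dots> \<le> (\<integral>p. C * \<rho> p ^ m \<partial>Q)"
    by (intro integral_mono integrable_norm i integrable_mult_right integrable_rho assms)
  also have "\<dots> \<le> C * moment_constant c m" using integral_rho[of m] C by (simp add: mult_left_mono)
  finally show "norm (\<integral>p. \<phi> p \<partial>Q) \<le> C * moment_constant c m" .
qed

lemma integral_rho_bound:
  fixes \<phi> :: "'u \<times> 'u \<Rightarrow> real"
  assumes "\<phi> \<in> borel_measurable Q" "\<And>p. \<bar>\<phi> p\<bar> \<le> C * \<rho> p ^ m"
  shows "(\<integral>p. \<phi> p \<partial>Q) \<le> C * moment_constant c m"
  using norm_integral_rho_bound[of \<phi> C m] assms by auto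

text \<open>Given the first half increment, the noise of the second half step is centred. Beyond the
  drift this leaves half a time step times the mean of \<open>f (y p) - f x\<close>. A Taylor
  expansion of \<open>f\<close> reduces that mean to \<open>Df x\<close> of the mean displacement
  and a quadratic remainder, both of order \<open>s^2\<close>, which makes \<open>s^4\<close> in
  all. The second bound uses only the Lipschitz property of \<open>f\<close>: it is coarser in
  \<open>s\<close> but linear in the state, as the estimate for the moment weight requires.\<close>

lemma
  shows two_step_mean_bound: "norm ((\<integral>p. (two_step (s\<^sup>2) x (fst p) (snd p) - x) \<partial>Q) - s\<^sup>2 *\<^sub>R f x)
     \<le> mean_constant K c * s^4 * (1 + norm x)\<^sup>2"
    and two_step_mean_growth: "norm (\<integral>p. (two_step (s\<^sup>2) x (fst p) (snd p) - x) \<partial>Q)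
     \<le> (K + 2 * K^4 * moment_constant c 2) * s\<^sup>2 * (1 + norm x)"
proof -
  define y where "y p = step (s\<^sup>2 / 2) x (fst p)" for p :: "'u \<times> 'u"
  define b where "b = 1 + norm x"
  let ?N = "\<lambda>x u. G x u + H x u u - (s\<^sup>2 / 2) *\<^sub>R HO x"
  note hs = milstein_pointwise.half_step_bound[OF pointwise, of x, folded y_def b_def]
  have y_meas [measurable]: "y \<in> borel_measurable Q" unfolding y_def by measurable
  have y_int: "integrable Q (\<lambda>p. y p - x)"
    by (rule integrable_rho_bound[of _ "3 * K\<^sup>2 * b * s" 2]) (use hs in auto)
  have f_bound: "norm (f (y p) - f x) \<le> 3 * K^3 * b * s * \<rho> p ^ 2" for p
  proof -
    have "norm (f (y p) - f x) \<le> K * (3 * K\<^sup>2 * b * s * \<rho> p ^ 2)"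
      by (rule order_trans[OF f_lip mult_left_mono[OF hs]]) (use K_ge_1 in auto)
    also have "\<dots> = 3 * K^3 * b * s * \<rho> p ^ 2" by algebra
    finally show ?thesis .
  qed
  have f_int: "integrable Q (\<lambda>p. f (y p) - f x)"
    by (rule integrable_rho_bound[OF _ f_bound]) measurable
  have N1: "integrable Q (\<lambda>p. ?N x (fst p))" "(\<integral>p. ?N x (fst p) \<partial>Q) = 0"
    using half_step_noise_mean[OF law_mu, of x]
    by (auto intro: integrable_fst trans[OF integral_fst_Q] simp del: Bochner_Integration.integral_diff Bochner_Integration.integral_add)
  have y_eq: "y p - x = (s\<^sup>2 / 2) *\<^sub>R f x + ?N x (fst p)" for p
    by (simp add: y_def step_def)
  have y_mean: "(\<integral>p. (y p - x) \<partial>Q) = (s\<^sup>2 / 2) *\<^sub>R f x"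
    unfolding y_eq using N1 by (simp add: P.prob_space)
  have N2_eq: "?N (y p) (snd p) = (two_step (s\<^sup>2) x (fst p) (snd p) - x) - s\<^sup>2 *\<^sub>R f x - ?N x (fst p)
        - (s\<^sup>2 / 2) *\<^sub>R (f (y p) - f x)" for p
  proof -
    have "s\<^sup>2 *\<^sub>R f x = (s\<^sup>2 / 2) *\<^sub>R f x + (s\<^sup>2 / 2) *\<^sub>R f x" by (simp flip: scaleR_add_left)
    then show ?thesis
      using y_eq[of p] by (simp add: two_step_def y_def[symmetric] step_def[of _ "y p"] algebra_simps)
  qed
  have two_int: "integrable Q (\<lambda>p. two_step (s\<^sup>2) x (fst p) (snd p) - x)"
    by (rule integrable_rho_bound[of _ "15 * K^5 * b * s" 4])
       (use milstein_pointwise.two_step_bound[OF pointwise, of x] in \<open>auto simp: b_def\<close>)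
  have N2_int: "integrable Q (\<lambda>p. ?N (y p) (snd p))"
    unfolding N2_eq
    by (intro Bochner_Integration.integrable_diff two_int integrable_scaleR_right f_int N1) simp
  \<comment> \<open>\<open>y p\<close> depends on the first coordinate only, so the inner integral
    over the second one runs at a frozen state.\<close>
  have N2: "(\<integral>p. ?N (y p) (snd p) \<partial>Q) = 0"
    using integral_fst'[OF N2_int] half_step_noise_mean[OF law_nu] by (simp add: y_def)
  have eq: "(\<integral>p. (two_step (s\<^sup>2) x (fst p) (snd p) - x) \<partial>Q) - s\<^sup>2 *\<^sub>R f x
      = (s\<^sup>2 / 2) *\<^sub>R (\<integral>p. (f (y p) - f x) \<partial>Q)"
    using N2 N1 two_int f_int unfolding N2_eq by (simp add: P.prob_space)
  have Df_bl: "bounded_linear (Df x)" using Df_linear by (rule linear_conv_bounded_linear[THEN iffD1])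
  have T_bound: "norm (f (y p) - f x - Df x (y p - x)) \<le> 9 * K^5 * b\<^sup>2 * s\<^sup>2 * \<rho> p ^ 4" for p
  proof -
    have "norm (f (y p) - f x - Df x (y p - x)) \<le> K * (3 * K\<^sup>2 * b * s * \<rho> p ^ 2)\<^sup>2"
      by (rule order_trans[OF f_taylor mult_left_mono[OF power_mono[OF hs]]]) (use K_ge_1 in auto)
    also have "\<dots> = 9 * K^5 * b\<^sup>2 * s\<^sup>2 * \<rho> p ^ 4" by algebra
    finally show ?thesis .
  qed
  have D_int: "integrable Q (\<lambda>p. Df x (y p - x))" by (rule integrable_bounded_linear[OF Df_bl y_int])
  have "(\<integral>p. (f (y p) - f x) \<partial>Q) = (\<integral>p. (f (y p) - f x - Df x (y p - x)) \<partial>Q) + (\<integral>p. Df x (y p - x) \<partial>Q)"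
    using f_int D_int by simp
  also have "(\<integral>p. Df x (y p - x) \<partial>Q) = Df x ((s\<^sup>2 / 2) *\<^sub>R f x)"
    unfolding y_mean[symmetric] by (rule integral_bounded_linear[OF Df_bl y_int])
  finally have mean_split: "(\<integral>p. (f (y p) - f x) \<partial>Q)
     = (\<integral>p. (f (y p) - f x - Df x (y p - x)) \<partial>Q) + Df x ((s\<^sup>2 / 2) *\<^sub>R f x)" .
  have "norm (\<integral>p. (f (y p) - f x) \<partial>Q)
     \<le> norm (\<integral>p. (f (y p) - f x - Df x (y p - x)) \<partial>Q) + norm (Df x ((s\<^sup>2 / 2) *\<^sub>R f x))"
    unfolding mean_split by (rule norm_triangle_ineq)
  also have "\<dots> \<le> 9 * K^5 * b\<^sup>2 * s\<^sup>2 * moment_constant c 4 + K * (s\<^sup>2 / 2 * (K * b))"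
  proof (rule add_mono)
    show "norm (\<integral>p. (f (y p) - f x - Df x (y p - x)) \<partial>Q) \<le> 9 * K^5 * b\<^sup>2 * s\<^sup>2 * moment_constant c 4"
      by (rule norm_integral_rho_bound[OF _ T_bound]) (use f_int D_int in measurable)
    show "norm (Df x ((s\<^sup>2 / 2) *\<^sub>R f x)) \<le> K * (s\<^sup>2 / 2 * (K * b))"
      using mult_left_mono[OF f_growth[of x], of "s\<^sup>2 / 2"] K_ge_1
      by (intro order_trans[OF Df_bound] mult_left_mono) (auto simp: b_def)
  qed
  also have "\<dots> \<le> 2 * s\<^sup>2 * b\<^sup>2 * mean_constant K c"
  proof -
    have "b \<le> b\<^sup>2" by (rule self_le_power) (auto simp: b_def)
    then have "K\<^sup>2 * s\<^sup>2 * b \<le> K\<^sup>2 * s\<^sup>2 * b\<^sup>2" by (intro mult_left_mono) auto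
    moreover have "0 \<le> K^5 * b\<^sup>2 * s\<^sup>2 * moment_constant c 4" "0 \<le> K\<^sup>2 * s\<^sup>2 * b\<^sup>2"
      using K_ge_1 moment_constant_ge_1[of 4] by auto
    moreover have "2 * s\<^sup>2 * b\<^sup>2 * mean_constant K c = 10 * (K^5 * b\<^sup>2 * s\<^sup>2 * moment_constant c 4) + 2 * (K\<^sup>2 * s\<^sup>2 * b\<^sup>2)"
      unfolding mean_constant_def by algebra
    moreover have "9 * K^5 * b\<^sup>2 * s\<^sup>2 * moment_constant c 4 + K * (s\<^sup>2 / 2 * (K * b))
       = 9 * (K^5 * b\<^sup>2 * s\<^sup>2 * moment_constant c 4) + (K\<^sup>2 * s\<^sup>2 * b) / 2" by (simp add: power2_eq_square)
    ultimately show ?thesis by linarith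
  qed
  finally have "s\<^sup>2 / 2 * norm (\<integral>p. (f (y p) - f x) \<partial>Q) \<le> s\<^sup>2 / 2 * (2 * s\<^sup>2 * b\<^sup>2 * mean_constant K c)"
    by (rule mult_left_mono) simp
  also have "\<dots> = mean_constant K c * s^4 * b\<^sup>2" by (simp add: power_def)
  finally show "norm ((\<integral>p. (two_step (s\<^sup>2) x (fst p) (snd p) - x) \<partial>Q) - s\<^sup>2 *\<^sub>R f x)
     \<le> mean_constant K c * s^4 * (1 + norm x)\<^sup>2" unfolding eq by (simp add: b_def)
  have "(\<integral>p. (two_step (s\<^sup>2) x (fst p) (snd p) - x) \<partial>Q)
      = s\<^sup>2 *\<^sub>R f x + (s\<^sup>2 / 2) *\<^sub>R (\<integral>p. (f (y p) - f x) \<partial>Q)"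
    using eq by (simp add: algebra_simps)
  also have "norm \<dots> \<le> s\<^sup>2 * norm (f x) + s\<^sup>2 / 2 * norm (\<integral>p. (f (y p) - f x) \<partial>Q)"
    by (rule norm_triangle_le) simp
  also have "\<dots> \<le> s\<^sup>2 * (K * b) + s\<^sup>2 / 2 * (3 * K^3 * b * s * moment_constant c 2)"
    by (intro add_mono mult_left_mono norm_integral_rho_bound[OF _ f_bound])
       (use f_growth in \<open>auto simp: b_def\<close>)
  also have "\<dots> \<le> s\<^sup>2 * (K * b) + s\<^sup>2 / 2 * (4 * K^3 * b * K * moment_constant c 2)"
    using K_ge_1 s_pos s_le moment_constant_ge_1[of 2]
    by (intro add_mono mult_left_mono mult_right_mono mult_mono) (auto simp: b_def)
  also have "\<dots> = (K + 2 * K^4 * moment_constant c 2) * s\<^sup>2 * b" by algebra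
  finally show "norm (\<integral>p. (two_step (s\<^sup>2) x (fst p) (snd p) - x) \<partial>Q)
     \<le> (K + 2 * K^4 * moment_constant c 2) * s\<^sup>2 * (1 + norm x)" by (simp add: b_def)
qed

lemma two_step_mean_bound_swapped:
  "norm ((\<integral>p. (two_step (s\<^sup>2) x (snd p) (fst p) - x) \<partial>Q) - s\<^sup>2 *\<^sub>R f x)
     \<le> mean_constant K c * s^4 * (1 + norm x)\<^sup>2"
proof -
  interpret sw: milstein_noise f Df G DG H HO K s c \<nu> \<mu> by (rule swapped)
  have "(\<integral>p. (two_step (s\<^sup>2) x (snd p) (fst p) - x) \<partial>Q) = (\<integral>p. (two_step (s\<^sup>2) x (fst p) (snd p) - x) \<partial>sw.Q)"
    using sw.integral_product_swap[of "\<lambda>p. two_step (s\<^sup>2) x (fst p) (snd p) - x"] by (simp add: case_prod_unfold)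
  then show ?thesis using sw.two_step_mean_bound by simp
qed

text \<open>The mixed terms are linear in each of two independent centred increments and have mean
  zero, and each square contributes half of the correction. The mean is therefore the drift without
  any error.\<close>

lemma coarse_increment_mean: "(\<integral>p. coarse_increment (s\<^sup>2) x (fst p + snd p) \<partial>Q) = s\<^sup>2 *\<^sub>R f x"
proof -
  have half: "s\<^sup>2 *\<^sub>R HO x = (s\<^sup>2 / 2) *\<^sub>R HO x + (s\<^sup>2 / 2) *\<^sub>R HO x" by (simp flip: scaleR_add_left)
  have blH: "bounded_linear (H x u)" "bounded_linear (\<lambda>u. H x u v)" for u v
    using H_bilinear[of x] by (auto simp: bilinear_def linear_conv_bounded_linear)
  have cont: "continuous_on UNIV (\<lambda>p. H x (fst p) (snd p))"
    using bounded_bilinear.continuous_on[OF H_bilinear[unfolded bilinear_conv_bounded_bilinear]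
        continuous_on_fst[OF continuous_on_id] continuous_on_snd[OF continuous_on_id]] .
  have meas [measurable]: "(\<lambda>p. H x (fst p) (snd p)) \<in> borel_measurable Q"
    using borel_measurable_pair_continuous[OF cont, of fst Q snd] by simp
  have meas2 [measurable]: "(\<lambda>p. H x (snd p) (fst p)) \<in> borel_measurable Q"
    using borel_measurable_pair_continuous[OF cont, of snd Q fst] by simp
  note pw = milstein_pointwise.norm_uv[OF pointwise]
  have c1: "integrable Q (\<lambda>p. H x (fst p) (snd p))" "integrable Q (\<lambda>p. H x (snd p) (fst p))"
  proof -
    have *: "norm a \<le> K * (1 + norm x) * s\<^sup>2 * \<rho> p ^ 2"
      if "norm a \<le> K * (1 + norm x) * (norm (fst p) * norm (snd p))" for a :: 'e and p
    proof -
      have "K * (1 + norm x) * (norm (fst p) * norm (snd p)) \<le> K * (1 + norm x) * (s\<^sup>2 * \<rho> p ^ 2)"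
        by (rule mult_left_mono[OF pw]) (use K_ge_1 in auto)
      with that show ?thesis by (simp only: mult.assoc)
    qed
    have "norm (H x (fst p) (snd p)) \<le> K * (1 + norm x) * s\<^sup>2 * \<rho> p ^ 2"
      "norm (H x (snd p) (fst p)) \<le> K * (1 + norm x) * s\<^sup>2 * \<rho> p ^ 2" for p
      by (rule *, use H_growth[of x "fst p" "snd p"] H_growth[of x "snd p" "fst p"] in \<open>simp add: mult_ac\<close>)+
    from integrable_rho_bound[OF meas this(1)] integrable_rho_bound[OF meas2 this(2)]
    show "integrable Q (\<lambda>p. H x (fst p) (snd p))" "integrable Q (\<lambda>p. H x (snd p) (fst p))" .
  qed
  have nu0: "(\<integral>v. v \<partial>\<nu>) = 0" using law_nu by (simp add: increment_law_def)
  have h0: "(\<integral>v. H x u v \<partial>\<nu>) = 0" "(\<integral>v. H x v u \<partial>\<nu>) = 0" for u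
    using integral_bounded_linear[OF blH(1)[of u] noise_mean(1)[OF law_nu]] linear_0[OF bounded_linear.linear[OF blH(1)[of u]]]
      integral_bounded_linear[OF blH(2)[of u] noise_mean(1)[OF law_nu]] linear_0[OF bounded_linear.linear[OF blH(2)[of u]]] nu0
    by simp_all
  have c2: "(\<integral>p. H x (fst p) (snd p) \<partial>Q) = 0"
    by (rule trans[OF integral_fst'[OF c1(1), symmetric]]) (simp add: h0)
  have c3: "(\<integral>p. H x (snd p) (fst p) \<partial>Q) = 0"
    by (rule trans[OF integral_fst'[OF c1(2), symmetric]]) (simp add: h0)
  note n1 = noise_mean(2-)[OF law_mu, of x] and n2 = noise_mean(2-)[OF law_nu, of x]
  note i = integrable_fst[OF n1(1)] integrable_snd[OF n2(1)] integrable_fst[OF n1(2)] integrable_snd[OF n2(2)]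
  note j = integral_fst_Q[OF n1(1)] integral_snd_Q[OF n2(1)] integral_fst_Q[OF n1(2)] integral_snd_Q[OF n2(2)]
  have eq: "coarse_increment (s\<^sup>2) x (fst p + snd p) = s\<^sup>2 *\<^sub>R f x - s\<^sup>2 *\<^sub>R HO x + (G x (fst p) + G x (snd p))
     + (H x (fst p) (fst p) + H x (snd p) (snd p)) + (H x (fst p) (snd p) + H x (snd p) (fst p))" for p
    by (simp add: coarse_increment_def linear_add[OF G_linear] H_add)
  have "(\<integral>p. coarse_increment (s\<^sup>2) x (fst p + snd p) \<partial>Q) = s\<^sup>2 *\<^sub>R f x - s\<^sup>2 *\<^sub>R HO x + (0 + 0)
     + ((s\<^sup>2 / 2) *\<^sub>R HO x + (s\<^sup>2 / 2) *\<^sub>R HO x) + (0 + 0)"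
    unfolding eq
    by (subst Bochner_Integration.integral_add Bochner_Integration.integral_diff,
        (intro Bochner_Integration.integrable_add i c1 integrable_const)+)+
       (simp only: j c2 c3 n1(3,4) n2(3,4) lebesgue_integral_const P.prob_space scaleR_one)
  then show ?thesis unfolding half by simp
qed

end

section \<open>The Lyapunov function\<close>

text \<open>A polynomial version of the eighth power of \<open>1 + norm x\<close>, whose increments
  expand through inner products.\<close>

definition moment_weight :: "'e::real_normed_vector \<Rightarrow> real" where
  "moment_weight x = (1 + (norm x)\<^sup>2) ^ 4"

lemma moment_weight_ge_1: "1 \<le> moment_weight x"
  by (simp add: moment_weight_def one_le_power)

lemma square_sum_le: "(a + b)\<^sup>2 \<le> 2 * (a\<^sup>2 + b\<^sup>2)" for a b :: real
  using sum_squares_bound[of a b] by (simp add: power2_sum)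

lemma power4_sum_le: "(a + b) ^ 4 \<le> 8 * (a ^ 4 + b ^ 4)" for a b :: real
proof -
  have "((a + b)\<^sup>2)\<^sup>2 \<le> (2 * (a\<^sup>2 + b\<^sup>2))\<^sup>2"
    by (intro power_mono square_sum_le) auto
  also have "\<dots> = 4 * (a\<^sup>2 + b\<^sup>2)\<^sup>2" by algebra
  also have "\<dots> \<le> 4 * (2 * ((a\<^sup>2)\<^sup>2 + (b\<^sup>2)\<^sup>2))"
    by (intro mult_left_mono square_sum_le) auto
  finally show ?thesis by simp
qed

lemma growth_square_le: "(1 + norm x)\<^sup>2 \<le> 2 * (1 + (norm x)\<^sup>2)"
  using square_sum_le[of 1 "norm x"] by simp

text \<open>The second power is used for the averaged error, the fourth for the fine-antithetic
  difference; one weight absorbs both.\<close>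

lemma
  fixes x y :: "'e::real_normed_vector"
  defines "B \<equiv> (1 + norm x)\<^sup>2 + (1 + norm y)\<^sup>2"
  shows growth_sum_square_le: "B\<^sup>2 \<le> 8 * (moment_weight x + moment_weight y)"
    and growth_sum_power4_le: "B ^ 4 \<le> 128 * (moment_weight x + moment_weight y)"
proof -
  define X Y where "X = 1 + (norm x)\<^sup>2" and "Y = 1 + (norm y)\<^sup>2"
  have 1: "1 \<le> X" "1 \<le> Y" by (auto simp: X_def Y_def)
  have B: "0 \<le> B" "B \<le> 2 * (X + Y)"
    using growth_square_le[of x] growth_square_le[of y] by (auto simp: B_def X_def Y_def)
  have V: "moment_weight x = X ^ 4" "moment_weight y = Y ^ 4" by (auto simp: X_def Y_def moment_weight_def)
  have "B\<^sup>2 \<le> (2 * (X + Y))\<^sup>2" by (rule power_mono) (use B in auto)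
  also have "\<dots> = 4 * (X + Y)\<^sup>2" by algebra
  also have "\<dots> \<le> 4 * (2 * (X\<^sup>2 + Y\<^sup>2))" by (intro mult_left_mono square_sum_le) auto
  also have "\<dots> = 8 * (X\<^sup>2 + Y\<^sup>2)" by simp
  also have "\<dots> \<le> 8 * (X ^ 4 + Y ^ 4)" using 1 by (intro mult_left_mono add_mono power_increasing) auto
  finally show "B\<^sup>2 \<le> 8 * (moment_weight x + moment_weight y)" by (simp add: V)
  have "B ^ 4 \<le> (2 * (X + Y)) ^ 4" by (rule power_mono) (use B in auto)
  also have "\<dots> = 16 * (X + Y) ^ 4" by algebra
  also have "\<dots> \<le> 16 * (8 * (X ^ 4 + Y ^ 4))" by (intro mult_left_mono power4_sum_le) auto
  also have "\<dots> = 128 * (X ^ 4 + Y ^ 4)" by simp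
  finally show "B ^ 4 \<le> 128 * (moment_weight x + moment_weight y)" by (simp add: V)
qed

lemma norm_add_square:
  fixes e \<Delta> :: "'e::real_inner"
  shows "(norm (e + \<Delta>))\<^sup>2 = (norm e)\<^sup>2 + 2 * (e \<bullet> \<Delta>) + (norm \<Delta>)\<^sup>2"
  by (simp add: power2_norm_eq_inner inner_add_left inner_add_right inner_commute)

text \<open>The first-order term stays an inner product, because in expectation it sees only the
  mean of the increment. All other terms are at least quadratic in \<open>\<Delta>\<close>; the 10
  is 2 from the expansion plus 8 from the Cauchy-Schwarz inequality.\<close>

lemma norm_add_power4_le:
  fixes d \<Delta> :: "'e::real_inner"
  shows "norm (d + \<Delta>) ^ 4 \<le> norm d ^ 4 + 4 * (norm d)\<^sup>2 * (d \<bullet> \<Delta>) + 10 * (norm d)\<^sup>2 * (norm \<Delta>)\<^sup>2 + 2 * norm \<Delta> ^ 4"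
proof -
  let ?a = "norm d" and ?b = "norm \<Delta>" and ?p = "d \<bullet> \<Delta>"
  have "?p\<^sup>2 \<le> (?a * ?b)\<^sup>2"
    using Cauchy_Schwarz_ineq2[of d \<Delta>] by (metis abs_ge_zero power2_abs power_mono)
  then have p: "?p\<^sup>2 \<le> ?a\<^sup>2 * ?b\<^sup>2" by (simp add: power_mult_distrib)
  have "norm (d + \<Delta>) ^ 4 = ((norm (d + \<Delta>))\<^sup>2)\<^sup>2" by simp
  also have "\<dots> = ?a ^ 4 + 4 * ?a\<^sup>2 * ?p + 2 * ?a\<^sup>2 * ?b\<^sup>2 + (2 * ?p + ?b\<^sup>2)\<^sup>2"
    unfolding norm_add_square by algebra
  also have "(2 * ?p + ?b\<^sup>2)\<^sup>2 \<le> 2 * ((2 * ?p)\<^sup>2 + (?b\<^sup>2)\<^sup>2)" by (rule square_sum_le)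
  also have "\<dots> \<le> 8 * (?a\<^sup>2 * ?b\<^sup>2) + 2 * ?b ^ 4" using p by (simp add: power_mult_distrib)
  finally show ?thesis by linarith
qed

text \<open>The counterpart for the moment weight: the linear term keeps its sign, and the rest is
  controlled by the square of the relative size \<open>q\<close> of the perturbation.\<close>

lemma power4_add_le:
  fixes W E :: real
  assumes "0 \<le> W" "\<bar>E\<bar> \<le> q * W" "0 \<le> q"
  shows "(W + E) ^ 4 \<le> W ^ 4 + 4 * W ^ 3 * E + W ^ 4 * q\<^sup>2 * (6 + 4 * q + q\<^sup>2)"
proof -
  have E2: "E\<^sup>2 \<le> (q * W)\<^sup>2" using assms power_mono[of "\<bar>E\<bar>" "q * W" 2] by simp
  have "4 * W * E \<le> 4 * W * (q * W)" using assms by (intro mult_left_mono) auto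
  then have "6 * W\<^sup>2 + 4 * W * E + E\<^sup>2 \<le> 6 * W\<^sup>2 + 4 * W * (q * W) + (q * W)\<^sup>2" using E2 by linarith
  moreover have "0 \<le> 6 * W\<^sup>2 + 4 * W * (q * W) + (q * W)\<^sup>2" using assms by auto
  ultimately have "E\<^sup>2 * (6 * W\<^sup>2 + 4 * W * E + E\<^sup>2) \<le> (q * W)\<^sup>2 * (6 * W\<^sup>2 + 4 * W * (q * W) + (q * W)\<^sup>2)"
    by (meson E2 mult_left_mono mult_right_mono order_trans zero_le_power2)
  also have "\<dots> = W ^ 4 * q\<^sup>2 * (6 + 4 * q + q\<^sup>2)" by algebra
  finally show ?thesis by (simp add: algebra_simps power_def)
qed

text \<open>This and the next two rates are growth rates per unit time, assembled from the estimates
  below. \<open>moment_rate\<close> is \<open>integral_moment_weight_le\<close> with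
  \<open>A = 15 * K^5\<close> and \<open>m = 4\<close>. In \<open>average_rate\<close>, 2916 is 81 *
  36. In \<open>difference_rate\<close>, 512 is 4 * 128, 3610 is 10 times the square of 19, and 2048
  is 2 * 1024.\<close>

definition moment_rate :: "real \<Rightarrow> (nat \<Rightarrow> real) \<Rightarrow> real" where
  "moment_rate K c = 16 * (K + 2 * K^4 * moment_constant c 2) + 8 * (15 * K^5)\<^sup>2 * moment_constant c 8
     + 16 * 6 ^ 4 * (15 * K^5) ^ 8 * K ^ 6 * moment_constant c 32"

definition average_rate :: "real \<Rightarrow> (nat \<Rightarrow> real) \<Rightarrow> real" where
  "average_rate K c = 3 * K + 8 * mean_constant K c + 2916 * K ^ 10 * moment_constant c 10"

definition difference_rate :: "real \<Rightarrow> (nat \<Rightarrow> real) \<Rightarrow> real" where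
  "difference_rate K c = 4 * K + 512 * K ^ 4 * mean_constant K c
     + 3610 * 256 * K ^ 12 * moment_constant c 10 + 2048 * 19 ^ 4 * K ^ 26 * moment_constant c 20"

text \<open>The triple is ordered coarse, fine, antithetic. The factor \<open>s ^ 4\<close> lets the
  remainders, which do not vanish with the errors, be bounded by a multiple of the function itself,
  so the recursion has no source term.\<close>

definition lyapunov :: "real \<Rightarrow> 'e::real_inner \<times> 'e \<times> 'e \<Rightarrow> real" where
  "lyapunov s = (\<lambda>(xc, x, y). (norm ((1/2) *\<^sub>R (x + y) - xc))\<^sup>2 + norm (x - y) ^ 4
     + s ^ 4 * (moment_weight x + moment_weight y))"

definition lyapunov_rate :: "real \<Rightarrow> (nat \<Rightarrow> real) \<Rightarrow> real" where
  "lyapunov_rate K c = average_rate K c + difference_rate K c + moment_rate K c"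

lemma lyapunov_nonneg: "0 \<le> lyapunov s z"
  using moment_weight_ge_1[of "fst (snd z)"] moment_weight_ge_1[of "snd (snd z)"]
  by (auto simp: lyapunov_def split_beta)

text \<open>A crude form of Young's inequality: the smaller of the two numbers is replaced by the
  larger.\<close>

lemma cube_mult_le: "a ^ 3 * b \<le> a ^ 4 + b ^ 4" if "0 \<le> a" "0 \<le> b" for a b :: real
proof (cases "a \<le> b")
  case True
  then have "a ^ 3 * b \<le> b ^ 3 * b" using that by (intro mult_right_mono power_mono) auto
  moreover have "b ^ 3 * b = b ^ 4" "0 \<le> a ^ 4" using that by (simp_all add: power4_eq_xxxx power3_eq_cube)
  ultimately show ?thesis by linarith
next
  case False
  then have "a ^ 3 * b \<le> a ^ 3 * a" using that by (intro mult_left_mono) auto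
  moreover have "a ^ 3 * a = a ^ 4" "0 \<le> b ^ 4" using that by (simp_all add: power4_eq_xxxx power3_eq_cube)
  ultimately show ?thesis by linarith
qed

definition (in milstein_coefficients) antithetic_step :: "real \<Rightarrow> 'e \<times> 'e \<times> 'e \<Rightarrow> 'u \<Rightarrow> 'u \<Rightarrow> 'e \<times> 'e \<times> 'e" where
  "antithetic_step \<tau> = (\<lambda>(xc, x, y) u v. (step \<tau> xc (u + v), two_step \<tau> x u v, two_step \<tau> y v u))"

section \<open>Expected growth of each part of the Lyapunov function in one step\<close>

context milstein_noise
begin

text \<open>A fluctuation of order \<open>s\<close> enters through its square and the first-order
  effect through the mean, so with a mean of order \<open>s^2\<close> both contributions have the
  order of one time step.\<close>

lemma integral_norm_square_le:
  fixes e :: 'e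
  assumes [measurable]: "\<Delta> \<in> borel_measurable Q" and A: "\<And>p. norm (\<Delta> p) \<le> A * \<rho> p ^ m"
  shows "integrable Q (\<lambda>p. (norm (e + \<Delta> p))\<^sup>2)"
    and "(\<integral>p. (norm (e + \<Delta> p))\<^sup>2 \<partial>Q) \<le> (norm e)\<^sup>2 + 2 * norm e * norm (\<integral>p. \<Delta> p \<partial>Q) + A\<^sup>2 * moment_constant c (2 * m)"
proof -
  have i1: "integrable Q \<Delta>" by (rule integrable_rho_bound[OF _ A]) measurable
  have A2: "\<bar>(norm (\<Delta> p))\<^sup>2\<bar> \<le> A\<^sup>2 * \<rho> p ^ (2 * m)" for p
    using power_mono[OF A[of p], of 2] by (simp add: power_mult_distrib power_mult[symmetric] mult.commute)
  have i2: "integrable Q (\<lambda>p. (norm (\<Delta> p))\<^sup>2)"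
    by (rule integrable_rho_bound[of _ "A\<^sup>2" "2 * m"]) (use A2 in auto)
  show "integrable Q (\<lambda>p. (norm (e + \<Delta> p))\<^sup>2)"
    unfolding norm_add_square using i1 i2 by simp
  have "(\<integral>p. (norm (e + \<Delta> p))\<^sup>2 \<partial>Q) = (norm e)\<^sup>2 + 2 * (e \<bullet> (\<integral>p. \<Delta> p \<partial>Q)) + (\<integral>p. (norm (\<Delta> p))\<^sup>2 \<partial>Q)"
    unfolding norm_add_square using i1 i2 by (simp add: P.prob_space)
  also have "\<dots> \<le> (norm e)\<^sup>2 + 2 * (norm e * norm (\<integral>p. \<Delta> p \<partial>Q)) + A\<^sup>2 * moment_constant c (2 * m)"
    by (intro add_mono mult_left_mono norm_cauchy_schwarz integral_rho_bound A2) auto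
  finally show "(\<integral>p. (norm (e + \<Delta> p))\<^sup>2 \<partial>Q) \<le> (norm e)\<^sup>2 + 2 * norm e * norm (\<integral>p. \<Delta> p \<partial>Q) + A\<^sup>2 * moment_constant c (2 * m)"
    by (simp add: mult.assoc)
qed

lemma integral_norm_power4_le:
  fixes d :: 'e
  assumes [measurable]: "\<Delta> \<in> borel_measurable Q" and A: "\<And>p. norm (\<Delta> p) \<le> A * \<rho> p ^ m"
  shows "integrable Q (\<lambda>p. norm (d + \<Delta> p) ^ 4)"
    and "(\<integral>p. norm (d + \<Delta> p) ^ 4 \<partial>Q) \<le> norm d ^ 4 + 4 * norm d ^ 3 * norm (\<integral>p. \<Delta> p \<partial>Q)
      + 10 * (norm d)\<^sup>2 * A\<^sup>2 * moment_constant c (2 * m) + 2 * A ^ 4 * moment_constant c (4 * m)"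
proof -
  have i1: "integrable Q \<Delta>" by (rule integrable_rho_bound[OF _ A]) measurable
  have A2: "\<bar>(norm (\<Delta> p))\<^sup>2\<bar> \<le> A\<^sup>2 * \<rho> p ^ (2 * m)" for p
    using power_mono[OF A[of p], of 2] by (simp add: power_mult_distrib power_mult[symmetric] mult.commute)
  have A4: "\<bar>norm (\<Delta> p) ^ 4\<bar> \<le> A ^ 4 * \<rho> p ^ (4 * m)" for p
    using power_mono[OF A[of p], of 4] by (simp add: power_mult_distrib power_mult[symmetric] mult.commute)
  have i2: "integrable Q (\<lambda>p. (norm (\<Delta> p))\<^sup>2)"
    by (rule integrable_rho_bound[of _ "A\<^sup>2" "2 * m"]) (use A2 in auto)
  have i4: "integrable Q (\<lambda>p. norm (\<Delta> p) ^ 4)"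
    by (rule integrable_rho_bound[of _ "A ^ 4" "4 * m"]) (use A4 in auto)
  let ?g = "\<lambda>p. norm d ^ 4 + 4 * (norm d)\<^sup>2 * (d \<bullet> \<Delta> p) + 10 * (norm d)\<^sup>2 * (norm (\<Delta> p))\<^sup>2 + 2 * norm (\<Delta> p) ^ 4"
  have g: "integrable Q ?g" using i1 i2 i4 by simp
  show i: "integrable Q (\<lambda>p. norm (d + \<Delta> p) ^ 4)"
    by (rule Bochner_Integration.integrable_bound[OF g])
       (auto intro!: AE_I2 order_trans[OF _ abs_ge_self] norm_add_power4_le)
  have "(\<integral>p. norm (d + \<Delta> p) ^ 4 \<partial>Q) \<le> (\<integral>p. ?g p \<partial>Q)"
    by (rule integral_mono[OF i g norm_add_power4_le])
  also have "\<dots> = norm d ^ 4 + 4 * (norm d)\<^sup>2 * (d \<bullet> (\<integral>p. \<Delta> p \<partial>Q)) + 10 * (norm d)\<^sup>2 * (\<integral>p. (norm (\<Delta> p))\<^sup>2 \<partial>Q)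
      + 2 * (\<integral>p. norm (\<Delta> p) ^ 4 \<partial>Q)"
    using i1 i2 i4 by (simp add: P.prob_space)
  also have "\<dots> \<le> norm d ^ 4 + 4 * (norm d)\<^sup>2 * (norm d * norm (\<integral>p. \<Delta> p \<partial>Q))
     + 10 * (norm d)\<^sup>2 * (A\<^sup>2 * moment_constant c (2 * m)) + 2 * (A ^ 4 * moment_constant c (4 * m))"
    by (intro add_mono mult_left_mono norm_cauchy_schwarz integral_rho_bound A2 A4) auto
  finally show "(\<integral>p. norm (d + \<Delta> p) ^ 4 \<partial>Q) \<le> norm d ^ 4 + 4 * norm d ^ 3 * norm (\<integral>p. \<Delta> p \<partial>Q)
      + 10 * (norm d)\<^sup>2 * A\<^sup>2 * moment_constant c (2 * m) + 2 * A ^ 4 * moment_constant c (4 * m)"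
    by (simp add: mult.assoc power2_eq_square power3_eq_cube)
qed

text \<open>The change \<open>E\<close> of the base \<open>W\<close> is of relative order
  \<open>s\<close>, while its mean is of relative order \<open>s^2\<close>. Expanding the fourth
  power about \<open>W\<close> therefore costs only a relative amount of order
  \<open>s^2\<close>.\<close>

lemma integral_moment_weight_le:
  fixes x :: 'e
  assumes [measurable]: "\<Delta> \<in> borel_measurable Q" and A: "\<And>p. norm (\<Delta> p) \<le> A * s * (1 + norm x) * \<rho> p ^ m"
    and mean: "norm (\<integral>p. \<Delta> p \<partial>Q) \<le> D * s\<^sup>2 * (1 + norm x)" and "1 \<le> A"
  shows "integrable Q (\<lambda>p. moment_weight (x + \<Delta> p))"
    and "(\<integral>p. moment_weight (x + \<Delta> p) \<partial>Q)
      \<le> (1 + s\<^sup>2 * (16 * D + 8 * A\<^sup>2 * moment_constant c (2 * m) + 16 * 6 ^ 4 * A ^ 8 * K ^ 6 * moment_constant c (8 * m))) * moment_weight x"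
proof -
  define W where "W = 1 + (norm x)\<^sup>2"
  define b where "b = 1 + norm x"
  have W: "1 \<le> W" by (simp add: W_def)
  have b: "1 \<le> b" "b\<^sup>2 \<le> 2 * W" "norm x \<le> b" using growth_square_le[of x] by (auto simp: b_def W_def)
  have "norm x * b \<le> b * b" by (rule mult_right_mono) (use b in auto)
  then have xb: "norm x * b \<le> 2 * W" using b(2) unfolding power2_eq_square by linarith
  define E where "E p = 2 * (x \<bullet> \<Delta> p) + (norm (\<Delta> p))\<^sup>2" for p
  have V: "moment_weight (x + \<Delta> p) = (W + E p) ^ 4" for p
    by (simp add: moment_weight_def norm_add_square W_def E_def add.assoc)
  have A2: "(norm (\<Delta> p))\<^sup>2 \<le> 2 * A\<^sup>2 * s\<^sup>2 * W * \<rho> p ^ (2 * m)" for p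
  proof -
    have "(norm (\<Delta> p))\<^sup>2 \<le> (A * s * b * \<rho> p ^ m)\<^sup>2" using A[of p] by (intro power_mono) (auto simp: b_def)
    also have "\<dots> = A\<^sup>2 * s\<^sup>2 * \<rho> p ^ (2 * m) * b\<^sup>2"
      by (simp add: power_mult_distrib power_mult[symmetric] mult_ac)
    also have "\<dots> \<le> A\<^sup>2 * s\<^sup>2 * \<rho> p ^ (2 * m) * (2 * W)"
      by (rule mult_left_mono) (use b rho_ge_1[of p] in auto)
    finally show ?thesis by (simp add: mult_ac)
  qed
  \<comment> \<open>The 6 consists of 4 from \<open>2 * (x \<bullet> \<Delta> p)\<close> and 2 from
    the squared increment.\<close>
  define q where "q p = 6 * A\<^sup>2 * K * s * \<rho> p ^ (2 * m)" for p
  have E_le: "\<bar>E p\<bar> \<le> q p * W" for p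
  proof -
    have "\<bar>x \<bullet> \<Delta> p\<bar> \<le> norm x * (A * s * b * \<rho> p ^ m)"
      by (rule order_trans[OF Cauchy_Schwarz_ineq2 mult_left_mono]) (use A in \<open>auto simp: b_def\<close>)
    also have "\<dots> = A * s * \<rho> p ^ m * (norm x * b)" by simp
    also have "\<dots> \<le> A * s * \<rho> p ^ m * (2 * W)"
      by (rule mult_left_mono[OF xb]) (use s_pos rho_ge_1[of p] \<open>1 \<le> A\<close> in auto)
    also have "\<dots> = 2 * (A * 1 * s * \<rho> p ^ m * W)" by simp
    also have "\<dots> \<le> 2 * (A\<^sup>2 * K * s * \<rho> p ^ (2 * m) * W)"
      using \<open>1 \<le> A\<close> K_ge_1 s_pos W rho_ge_1[of p]
      by (intro mult_left_mono[of _ _ 2] mult_right_mono mult_mono self_le_power power_increasing) auto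
    finally have 1: "\<bar>x \<bullet> \<Delta> p\<bar> \<le> 2 * (A\<^sup>2 * K * s * \<rho> p ^ (2 * m) * W)" .
    have "(norm (\<Delta> p))\<^sup>2 \<le> 2 * A\<^sup>2 * (K * s) * W * \<rho> p ^ (2 * m)"
      using s_le s_pos W rho_ge_1[of p]
      by (intro order_trans[OF A2] mult_right_mono mult_left_mono) (auto simp: power2_eq_square)
    also have "\<dots> = 2 * (A\<^sup>2 * K * s * \<rho> p ^ (2 * m) * W)" by simp
    finally have 2: "(norm (\<Delta> p))\<^sup>2 \<le> 2 * (A\<^sup>2 * K * s * \<rho> p ^ (2 * m) * W)" .
    have "q p * W = 6 * (A\<^sup>2 * K * s * \<rho> p ^ (2 * m) * W)" by (simp add: q_def)
    with 1 2 zero_le_power2[of "norm (\<Delta> p)"] show ?thesis unfolding E_def by linarith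
  qed
  let ?M = "6 ^ 4 * A ^ 8 * K ^ 6 * s\<^sup>2 * 11 * W ^ 4"
  have q_le: "q p ^ 2 * (6 + 4 * q p + q p ^ 2) \<le> 11 * (6 ^ 4 * A ^ 8 * K ^ 6) * s\<^sup>2 * \<rho> p ^ (8 * m)" for p
  proof -
    \<comment> \<open>\<open>r\<close> is \<open>q p\<close> with \<open>s\<close> replaced by
      \<open>K\<close>. It is at least 1 and dominates \<open>q p\<close>, so the bracket is at most
      \<open>11 * r\<^sup>2\<close>, while the outer \<open>q p ^ 2\<close> preserves the factor
      \<open>s\<^sup>2\<close>.\<close>
    define r where "r = 6 * A\<^sup>2 * K * K * \<rho> p ^ (2 * m)"
    have "1 * 1 * 1 * 1 * 1 \<le> 6 * A\<^sup>2 * K * K * \<rho> p ^ (2 * m)"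
      using \<open>1 \<le> A\<close> K_ge_1 rho_ge_1[of p] by (intro mult_mono one_le_power) auto
    then have r: "1 \<le> r" by (simp add: r_def)
    have q: "0 \<le> q p" "q p \<le> r" unfolding q_def r_def using s_le s_pos K_ge_1 rho_ge_1[of p]
      by (auto intro!: mult_right_mono mult_left_mono)
    have "q p ^ 2 * (6 + 4 * q p + q p ^ 2) \<le> q p ^ 2 * (6 * r\<^sup>2 + 4 * r\<^sup>2 + r\<^sup>2)"
      using q r by (intro mult_left_mono add_mono power_mono order_trans[OF q(2) self_le_power]) (auto simp: one_le_power)
    also have "\<dots> = 11 * (q p ^ 2 * r\<^sup>2)" by simp
    also have "q p ^ 2 * r\<^sup>2 = (6 ^ 4 * A ^ 8 * K ^ 6) * s\<^sup>2 * \<rho> p ^ (8 * m)"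
    proof -
      have t: "\<rho> p ^ (8 * m) = (\<rho> p ^ (2 * m)) ^ 4" by (simp flip: power_mult)
      show ?thesis unfolding q_def r_def t by algebra
    qed
    finally show ?thesis by simp
  qed
  have i1: "integrable Q \<Delta>" by (rule integrable_rho_bound[OF _ A]) measurable
  have i2: "integrable Q (\<lambda>p. (norm (\<Delta> p))\<^sup>2)"
    by (rule integrable_rho_bound[of _ "2 * A\<^sup>2 * s\<^sup>2 * W" "2 * m"]) (use A2 in auto)
  have iE: "integrable Q E" unfolding E_def using i1 i2 by simp
  let ?g = "\<lambda>p. W ^ 4 + 4 * W ^ 3 * E p + (W ^ 4 * (11 * (6 ^ 4 * A ^ 8 * K ^ 6) * s\<^sup>2)) * \<rho> p ^ (8 * m)"
  have g: "integrable Q ?g" using iE integrable_rho[of "8 * m"] by simp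
  have le: "moment_weight (x + \<Delta> p) \<le> ?g p" for p
  proof -
    have "moment_weight (x + \<Delta> p) \<le> W ^ 4 + 4 * W ^ 3 * E p + W ^ 4 * (q p)\<^sup>2 * (6 + 4 * q p + (q p)\<^sup>2)"
      unfolding V by (rule power4_add_le[OF _ E_le]) (use W K_ge_1 s_pos rho_ge_1[of p] in \<open>auto simp: q_def\<close>)
    also have "W ^ 4 * (q p)\<^sup>2 * (6 + 4 * q p + (q p)\<^sup>2) = W ^ 4 * (q p ^ 2 * (6 + 4 * q p + q p ^ 2))" by simp
    also have "\<dots> \<le> W ^ 4 * (11 * (6 ^ 4 * A ^ 8 * K ^ 6) * s\<^sup>2 * \<rho> p ^ (8 * m))"
      by (rule mult_left_mono[OF q_le]) (use W in auto)
    finally show ?thesis by (simp add: mult_ac)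
  qed
  have nonneg: "0 \<le> moment_weight z" for z :: 'e using moment_weight_ge_1[of z] by linarith
  have meas [measurable]: "(\<lambda>p. moment_weight (x + \<Delta> p)) \<in> borel_measurable Q"
    unfolding moment_weight_def by measurable
  show i: "integrable Q (\<lambda>p. moment_weight (x + \<Delta> p))"
    by (rule Bochner_Integration.integrable_bound[OF g meas])
       (use le nonneg in \<open>auto intro!: AE_I2 order_trans[OF _ abs_ge_self]\<close>)
  have E_mean: "(\<integral>p. E p \<partial>Q) \<le> s\<^sup>2 * (4 * D + 2 * A\<^sup>2 * moment_constant c (2 * m)) * W"
  proof -
    have "(\<integral>p. E p \<partial>Q) = 2 * (x \<bullet> (\<integral>p. \<Delta> p \<partial>Q)) + (\<integral>p. (norm (\<Delta> p))\<^sup>2 \<partial>Q)"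
      unfolding E_def using i1 i2 by simp
    also have "\<dots> \<le> 2 * (norm x * (D * s\<^sup>2 * b)) + (2 * A\<^sup>2 * s\<^sup>2 * W) * moment_constant c (2 * m)"
    proof (intro add_mono mult_left_mono[of _ _ 2])
      show "x \<bullet> (\<integral>p. \<Delta> p \<partial>Q) \<le> norm x * (D * s\<^sup>2 * b)"
        by (rule order_trans[OF norm_cauchy_schwarz mult_left_mono]) (use mean in \<open>auto simp: b_def\<close>)
      show "(\<integral>p. (norm (\<Delta> p))\<^sup>2 \<partial>Q) \<le> (2 * A\<^sup>2 * s\<^sup>2 * W) * moment_constant c (2 * m)"
        by (rule integral_rho_bound) (use A2 in auto)
    qed auto
    also have "norm x * (D * s\<^sup>2 * b) \<le> (D * s\<^sup>2) * (2 * W)"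
    proof -
      \<comment> \<open>The sign of \<open>D\<close> follows from the bound on the mean, whose
        left-hand side is a norm.\<close>
      have "0 \<le> D * s\<^sup>2 * b" using mean norm_ge_zero order_trans unfolding b_def by blast
      then have "0 \<le> D * s\<^sup>2" using b by (simp add: zero_le_mult_iff)
      from mult_left_mono[OF xb this] show ?thesis by (simp add: mult_ac)
    qed
    finally show ?thesis by (simp add: algebra_simps)
  qed
  have "(\<integral>p. moment_weight (x + \<Delta> p) \<partial>Q) \<le> (\<integral>p. ?g p \<partial>Q)"
    by (rule integral_mono[OF i g le])
  also have "\<dots> = W ^ 4 + 4 * W ^ 3 * (\<integral>p. E p \<partial>Q) + (W ^ 4 * (11 * (6 ^ 4 * A ^ 8 * K ^ 6) * s\<^sup>2)) * (\<integral>p. \<rho> p ^ (8 * m) \<partial>Q)"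
    using iE integrable_rho[of "8 * m"] by (simp add: P.prob_space)
  also have "\<dots> \<le> W ^ 4 + 4 * W ^ 3 * (s\<^sup>2 * (4 * D + 2 * A\<^sup>2 * moment_constant c (2 * m)) * W)
     + (W ^ 4 * (16 * (6 ^ 4 * A ^ 8 * K ^ 6) * s\<^sup>2)) * moment_constant c (8 * m)"
  proof (intro add_mono mult_left_mono E_mean order_refl)
    have "(W ^ 4 * (11 * (6 ^ 4 * A ^ 8 * K ^ 6) * s\<^sup>2)) * (\<integral>p. \<rho> p ^ (8 * m) \<partial>Q)
       \<le> (W ^ 4 * (11 * (6 ^ 4 * A ^ 8 * K ^ 6) * s\<^sup>2)) * moment_constant c (8 * m)"
      using W K_ge_1 \<open>1 \<le> A\<close> by (intro mult_left_mono integral_rho) auto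
    also have "\<dots> \<le> (W ^ 4 * (16 * (6 ^ 4 * A ^ 8 * K ^ 6) * s\<^sup>2)) * moment_constant c (8 * m)"
      using W K_ge_1 \<open>1 \<le> A\<close> moment_constant_ge_1[of "8 * m"]
      by (intro mult_right_mono mult_left_mono) auto
    finally show "(W ^ 4 * (11 * (6 ^ 4 * A ^ 8 * K ^ 6) * s\<^sup>2)) * (\<integral>p. \<rho> p ^ (8 * m) \<partial>Q)
       \<le> (W ^ 4 * (16 * (6 ^ 4 * A ^ 8 * K ^ 6) * s\<^sup>2)) * moment_constant c (8 * m)" .
  qed (use W in auto)
  also have "\<dots> = (1 + s\<^sup>2 * (16 * D + 8 * A\<^sup>2 * moment_constant c (2 * m) + 16 * 6 ^ 4 * A ^ 8 * K ^ 6 * moment_constant c (8 * m))) * W ^ 4"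
    by algebra
  finally show "(\<integral>p. moment_weight (x + \<Delta> p) \<partial>Q)
      \<le> (1 + s\<^sup>2 * (16 * D + 8 * A\<^sup>2 * moment_constant c (2 * m) + 16 * 6 ^ 4 * A ^ 8 * K ^ 6 * moment_constant c (8 * m))) * moment_weight x"
    by (simp add: moment_weight_def W_def)
qed

lemma mean_constant_nonneg: "0 \<le> mean_constant K c"
  using K_ge_1 moment_constant_ge_1[of 4] by (auto simp: mean_constant_def)

lemma two_step_integrable: "integrable Q (\<lambda>p. two_step (s\<^sup>2) x (fst p) (snd p) - x)"
  by (rule integrable_rho_bound[of _ "15 * K^5 * (1 + norm x) * s" 4])
     (use milstein_pointwise.two_step_bound[OF pointwise, of x] in auto)

lemma two_step_integrable_swapped: "integrable Q (\<lambda>p. two_step (s\<^sup>2) x (snd p) (fst p) - x)"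
  by (rule integrable_rho_bound[of _ "15 * K^5 * (1 + norm x) * s" 4])
     (use milstein_pointwise.two_step_bound[OF milstein_pointwise.swapped[OF pointwise], of x] in auto)

lemma
  shows integrable_moment_weight_two_step: "integrable Q (\<lambda>p. moment_weight (two_step (s\<^sup>2) x (fst p) (snd p)))"
    and integral_moment_weight_two_step: "(\<integral>p. moment_weight (two_step (s\<^sup>2) x (fst p) (snd p)) \<partial>Q)
      \<le> (1 + s\<^sup>2 * moment_rate K c) * moment_weight x"
proof -
  define \<Delta> where "\<Delta> = (\<lambda>p. two_step (s\<^sup>2) x (fst p) (snd p) - x)"
  have eq: "two_step (s\<^sup>2) x (fst p) (snd p) = x + \<Delta> p" for p by (simp add: \<Delta>_def)
  have m: "\<Delta> \<in> borel_measurable Q" unfolding \<Delta>_def by measurable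
  have A: "norm (\<Delta> p) \<le> (15 * K^5) * s * (1 + norm x) * \<rho> p ^ 4" for p
    using milstein_pointwise.two_step_bound[OF pointwise, of x p] by (simp add: \<Delta>_def mult_ac)
  have K: "1 \<le> 15 * K^5" using one_le_power[OF K_ge_1, of 5] by linarith
  note I = integral_moment_weight_le[OF m A two_step_mean_growth[of x, folded \<Delta>_def] K]
  show "integrable Q (\<lambda>p. moment_weight (two_step (s\<^sup>2) x (fst p) (snd p)))"
    unfolding eq by (rule I)
  show "(\<integral>p. moment_weight (two_step (s\<^sup>2) x (fst p) (snd p)) \<partial>Q) \<le> (1 + s\<^sup>2 * moment_rate K c) * moment_weight x"
    using I(2) unfolding eq moment_rate_def by simp
qed

text \<open>The fine case with the two factors of the product measure exchanged.\<close>

lemma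
  shows integrable_moment_weight_two_step_swapped: "integrable Q (\<lambda>p. moment_weight (two_step (s\<^sup>2) x (snd p) (fst p)))"
    and integral_moment_weight_two_step_swapped: "(\<integral>p. moment_weight (two_step (s\<^sup>2) x (snd p) (fst p)) \<partial>Q)
      \<le> (1 + s\<^sup>2 * moment_rate K c) * moment_weight x"
proof -
  interpret sw: milstein_noise f Df G DG H HO K s c \<nu> \<mu> by (rule swapped)
  let ?\<phi> = "\<lambda>p. moment_weight (two_step (s\<^sup>2) x (fst p) (snd p))"
  have i: "integrable sw.Q ?\<phi>" by (rule sw.integrable_moment_weight_two_step)
  show "integrable Q (\<lambda>p. moment_weight (two_step (s\<^sup>2) x (snd p) (fst p)))"
    using sw.integrable_product_swap[OF i] by (simp add: case_prod_unfold)
  show "(\<integral>p. moment_weight (two_step (s\<^sup>2) x (snd p) (fst p)) \<partial>Q) \<le> (1 + s\<^sup>2 * moment_rate K c) * moment_weight x"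
    using sw.integral_product_swap[of ?\<phi>] i sw.integral_moment_weight_two_step[of x]
    by (simp add: case_prod_unfold)
qed

text \<open>The drift error at the midpoint is quadratic in \<open>d\<close>, and this is decisive:
  a linear one would leave a cross term \<open>norm e * d\<close> of order \<open>s^3\<close>, too
  large for a Lyapunov function of order \<open>s^4\<close>.\<close>

lemma
  fixes xc x y :: 'e
  defines "e \<equiv> (1/2) *\<^sub>R (x + y) - xc"
  shows integrable_average_step: "integrable Q (\<lambda>p. (norm ((1/2) *\<^sub>R (two_step (s\<^sup>2) x (fst p) (snd p)
        + two_step (s\<^sup>2) y (snd p) (fst p)) - step (s\<^sup>2) xc (fst p + snd p)))\<^sup>2)"
    and integral_average_step: "(\<integral>p. (norm ((1/2) *\<^sub>R (two_step (s\<^sup>2) x (fst p) (snd p)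
        + two_step (s\<^sup>2) y (snd p) (fst p)) - step (s\<^sup>2) xc (fst p + snd p)))\<^sup>2 \<partial>Q)
      \<le> (norm e)\<^sup>2 + s\<^sup>2 * average_rate K c * lyapunov s (xc, x, y)"
proof -
  define \<Delta>1 where "\<Delta>1 = (\<lambda>p. two_step (s\<^sup>2) x (fst p) (snd p) - x)"
  define \<Delta>2 where "\<Delta>2 = (\<lambda>p. two_step (s\<^sup>2) y (snd p) (fst p) - y)"
  define \<Delta>c where "\<Delta>c = (\<lambda>p. coarse_increment (s\<^sup>2) xc (fst p + snd p))"
  define \<Delta> where "\<Delta> p = (1/2) *\<^sub>R (\<Delta>1 p + \<Delta>2 p) - \<Delta>c p" for p
  define d where "d = norm (x - y)"
  define B where "B = (1 + norm x)\<^sup>2 + (1 + norm y)\<^sup>2"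
  define L where "L = lyapunov s (xc, x, y)"
  define V where "V = moment_weight x + moment_weight y"
  define E where "E = norm e + d\<^sup>2 + s * d + s\<^sup>2 * B"
  have L: "L = (norm e)\<^sup>2 + d ^ 4 + s ^ 4 * V" by (simp add: L_def lyapunov_def e_def d_def V_def)
  have V: "1 \<le> V" using moment_weight_ge_1[of x] moment_weight_ge_1[of y] by (simp add: V_def)
  have B: "0 \<le> B" "B\<^sup>2 \<le> 8 * V" using growth_sum_square_le[of x y] by (auto simp: B_def V_def)
  have s4V: "s ^ 4 * B\<^sup>2 \<le> 8 * (s ^ 4 * V)" "s ^ 4 \<le> s ^ 4 * V"
    using mult_left_mono[OF B(2), of "s ^ 4"] mult_left_mono[OF V, of "s ^ 4"] by auto
  have nn: "0 \<le> s ^ 4 * V" "0 \<le> (norm e)\<^sup>2" "0 \<le> d ^ 4" using V by auto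
  have eq: "(1/2) *\<^sub>R (two_step (s\<^sup>2) x (fst p) (snd p) + two_step (s\<^sup>2) y (snd p) (fst p)) - step (s\<^sup>2) xc (fst p + snd p)
     = e + \<Delta> p" for p
    by (simp add: e_def \<Delta>_def \<Delta>1_def \<Delta>2_def \<Delta>c_def step_eq algebra_simps)
  have m: "\<Delta> \<in> borel_measurable Q" unfolding \<Delta>_def \<Delta>1_def \<Delta>2_def \<Delta>c_def by measurable
  have A: "norm (\<Delta> p) \<le> (9 * K^5 * s * E) * \<rho> p ^ 5" for p
    using milstein_pointwise.average_coarse_increment_bound[OF pointwise, of x p y xc]
    by (simp add: \<Delta>_def \<Delta>1_def \<Delta>2_def \<Delta>c_def E_def e_def d_def B_def mult_ac)
  note I = integral_norm_square_le[OF m A, of e]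
  show "integrable Q (\<lambda>p. (norm ((1/2) *\<^sub>R (two_step (s\<^sup>2) x (fst p) (snd p)
        + two_step (s\<^sup>2) y (snd p) (fst p)) - step (s\<^sup>2) xc (fst p + snd p)))\<^sup>2)"
    unfolding eq by (rule I)
  have E2: "E\<^sup>2 \<le> 36 * L"
  proof -
    have "E\<^sup>2 \<le> 2 * ((norm e + d\<^sup>2)\<^sup>2 + (s * d + s\<^sup>2 * B)\<^sup>2)"
      unfolding E_def using square_sum_le[of "norm e + d\<^sup>2" "s * d + s\<^sup>2 * B"] by (simp add: add.assoc)
    also have "\<dots> \<le> 2 * (2 * ((norm e)\<^sup>2 + (d\<^sup>2)\<^sup>2) + 2 * ((s * d)\<^sup>2 + (s\<^sup>2 * B)\<^sup>2))"
      by (intro mult_left_mono add_mono square_sum_le) auto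
    also have "\<dots> = 4 * ((norm e)\<^sup>2 + d ^ 4 + s\<^sup>2 * d\<^sup>2 + s ^ 4 * B\<^sup>2)" by algebra
    finally have "E\<^sup>2 \<le> 4 * ((norm e)\<^sup>2 + d ^ 4 + s\<^sup>2 * d\<^sup>2 + s ^ 4 * B\<^sup>2)" .
    \<comment> \<open>The mixed term is balanced between \<open>s ^ 4\<close>, which the weight
      absorbs, and \<open>d ^ 4\<close>.\<close>
    moreover have "s\<^sup>2 * d\<^sup>2 \<le> s ^ 4 + d ^ 4"
    proof -
      have "2 * (s\<^sup>2 * d\<^sup>2) \<le> s ^ 4 + d ^ 4" using sum_squares_bound[of "s\<^sup>2" "d\<^sup>2"] by simp
      moreover have "0 \<le> s\<^sup>2 * d\<^sup>2" by simp
      ultimately show ?thesis by linarith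
    qed
    ultimately show ?thesis using s4V nn unfolding L distrib_left by linarith
  qed
  have i: "integrable Q \<Delta>1" "integrable Q \<Delta>2" "integrable Q \<Delta>c"
  proof -
    show 1: "integrable Q \<Delta>1" unfolding \<Delta>1_def by (rule two_step_integrable)
    show 2: "integrable Q \<Delta>2" unfolding \<Delta>2_def by (rule two_step_integrable_swapped)
    have "integrable Q \<Delta>" by (rule integrable_rho_bound[OF m A])
    then have "integrable Q (\<lambda>p. (1/2) *\<^sub>R (\<Delta>1 p + \<Delta>2 p) - \<Delta> p)" using 1 2 by simp
    then show "integrable Q \<Delta>c" by (simp add: \<Delta>_def)
  qed
  \<comment> \<open>The defects, of order \<open>s^4\<close>, of the two mean increments from their
    drifts.\<close>
  define r1 r2 where "r1 = (\<integral>p. \<Delta>1 p \<partial>Q) - s\<^sup>2 *\<^sub>R f x" and "r2 = (\<integral>p. \<Delta>2 p \<partial>Q) - s\<^sup>2 *\<^sub>R f y"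
  let ?Cm = "mean_constant K c"
  have r: "norm r1 \<le> ?Cm * s ^ 4 * (1 + norm x)\<^sup>2" "norm r2 \<le> ?Cm * s ^ 4 * (1 + norm y)\<^sup>2"
    unfolding r1_def r2_def \<Delta>1_def \<Delta>2_def
    by (rule two_step_mean_bound two_step_mean_bound_swapped)+
  have mean: "norm (\<integral>p. \<Delta> p \<partial>Q) \<le> s\<^sup>2 * (K * norm e + K * d\<^sup>2 + ?Cm * s\<^sup>2 * B)"
  proof -
    define xm where "xm = (1/2) *\<^sub>R (x + y)"
    have meq: "(\<integral>p. \<Delta> p \<partial>Q) = (1/2) *\<^sub>R ((\<integral>p. \<Delta>1 p \<partial>Q) + (\<integral>p. \<Delta>2 p \<partial>Q)) - s\<^sup>2 *\<^sub>R f xc"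
      using i coarse_increment_mean[of xc] unfolding \<Delta>_def by (simp add: \<Delta>c_def[symmetric])
    \<comment> \<open>\<open>xm\<close> separates the quadratic midpoint error from a Lipschitz
      difference controlled by \<open>e\<close>; the final 0 only matches the shape of
      \<open>norm_sum5_le\<close>.\<close>
    have meq2: "(\<integral>p. \<Delta> p \<partial>Q) = s\<^sup>2 *\<^sub>R ((1/2) *\<^sub>R (f x + f y) - f xm) + s\<^sup>2 *\<^sub>R (f xm - f xc) + (1/2) *\<^sub>R r1 + (1/2) *\<^sub>R r2 - 0"
      unfolding meq r1_def r2_def by (simp add: algebra_simps)
    have "norm (\<integral>p. \<Delta> p \<partial>Q) \<le> norm (s\<^sup>2 *\<^sub>R ((1/2) *\<^sub>R (f x + f y) - f xm)) + norm (s\<^sup>2 *\<^sub>R (f xm - f xc))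
        + norm ((1/2) *\<^sub>R r1) + norm ((1/2) *\<^sub>R r2) + norm (0::'e)"
      unfolding meq2 by (rule norm_sum5_le)
    also have "\<dots> = s\<^sup>2 * norm ((1/2) *\<^sub>R (f x + f y) - f xm) + s\<^sup>2 * norm (f xm - f xc)
        + 1/2 * norm r1 + 1/2 * norm r2" by simp
    also have "\<dots> \<le> s\<^sup>2 * (K * d\<^sup>2) + s\<^sup>2 * (K * norm e)
        + 1 * (?Cm * s ^ 4 * (1 + norm x)\<^sup>2) + 1 * (?Cm * s ^ 4 * (1 + norm y)\<^sup>2)"
      using f_midpoint[of x y] f_lip[of xm xc] r
      by (intro add_mono mult_mono) (auto simp: d_def e_def xm_def)
    also have "\<dots> = s\<^sup>2 * (K * norm e + K * d\<^sup>2 + ?Cm * s\<^sup>2 * B)" unfolding B_def by algebra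
    finally show ?thesis .
  qed
  have "2 * norm e * norm (\<integral>p. \<Delta> p \<partial>Q) \<le> 2 * norm e * (s\<^sup>2 * (K * norm e + K * d\<^sup>2 + ?Cm * s\<^sup>2 * B))"
    by (intro mult_left_mono mean) auto
  also have "\<dots> = s\<^sup>2 * (2 * K * (norm e)\<^sup>2 + K * (2 * norm e * d\<^sup>2) + ?Cm * (2 * norm e * (s\<^sup>2 * B)))" by algebra
  also have "\<dots> \<le> s\<^sup>2 * (2 * K * (norm e)\<^sup>2 + K * ((norm e)\<^sup>2 + (d\<^sup>2)\<^sup>2) + ?Cm * ((norm e)\<^sup>2 + (s\<^sup>2 * B)\<^sup>2))"
    using K_ge_1 mean_constant_nonneg by (intro mult_left_mono add_mono sum_squares_bound order_refl) auto
  also have "\<dots> = s\<^sup>2 * ((3 * K + ?Cm) * (norm e)\<^sup>2 + K * d ^ 4 + ?Cm * (s ^ 4 * B\<^sup>2))" by algebra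
  also have "\<dots> \<le> s\<^sup>2 * ((3 * K + 8 * ?Cm) * (norm e)\<^sup>2 + (3 * K + 8 * ?Cm) * d ^ 4 + ?Cm * (8 * (s ^ 4 * V)))"
    using K_ge_1 mean_constant_nonneg s4V nn
    by (intro mult_left_mono add_mono mult_right_mono) auto
  also have "\<dots> \<le> s\<^sup>2 * ((3 * K + 8 * ?Cm) * L)"
  proof (rule mult_left_mono)
    have "?Cm * (8 * (s ^ 4 * V)) \<le> (3 * K + 8 * ?Cm) * (s ^ 4 * V)" using K_ge_1 nn by (simp add: algebra_simps)
    then show "(3 * K + 8 * ?Cm) * (norm e)\<^sup>2 + (3 * K + 8 * ?Cm) * d ^ 4 + ?Cm * (8 * (s ^ 4 * V)) \<le> (3 * K + 8 * ?Cm) * L"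
      unfolding L distrib_left[of "3 * K + 8 * ?Cm"] by linarith
  qed simp
  finally have 1: "2 * norm e * norm (\<integral>p. \<Delta> p \<partial>Q) \<le> s\<^sup>2 * ((3 * K + 8 * ?Cm) * L)" .
  have "(9 * K^5 * s * E)\<^sup>2 * moment_constant c (2 * 5) = 81 * K ^ 10 * s\<^sup>2 * moment_constant c 10 * E\<^sup>2"
    by (simp add: power_mult_distrib flip: power_mult)
  also have "\<dots> \<le> 81 * K ^ 10 * s\<^sup>2 * moment_constant c 10 * (36 * L)"
    using K_ge_1 moment_constant_ge_1[of 10] by (intro mult_left_mono E2) auto
  finally have 2: "(9 * K^5 * s * E)\<^sup>2 * moment_constant c (2 * 5) \<le> s\<^sup>2 * (2916 * K ^ 10 * moment_constant c 10 * L)"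
    by (simp add: mult_ac)
  have "(\<integral>p. (norm (e + \<Delta> p))\<^sup>2 \<partial>Q) \<le> (norm e)\<^sup>2 + s\<^sup>2 * ((3 * K + 8 * ?Cm) * L)
      + s\<^sup>2 * (2916 * K ^ 10 * moment_constant c 10 * L)"
    using I(2) 1 2 by linarith
  also have "\<dots> = (norm e)\<^sup>2 + s\<^sup>2 * average_rate K c * L" by (simp add: average_rate_def algebra_simps)
  finally show "(\<integral>p. (norm ((1/2) *\<^sub>R (two_step (s\<^sup>2) x (fst p) (snd p)
        + two_step (s\<^sup>2) y (snd p) (fst p)) - step (s\<^sup>2) xc (fst p + snd p)))\<^sup>2 \<partial>Q)
      \<le> (norm e)\<^sup>2 + s\<^sup>2 * average_rate K c * lyapunov s (xc, x, y)"
    unfolding eq L_def .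
qed

text \<open>Here a drift difference linear in \<open>d\<close> suffices, since it is multiplied by
  \<open>d ^ 3\<close>. The Levy terms do not cancel but are part of the fluctuation
  \<open>s * E\<close> with \<open>E = d + s * B\<close>, and the fourth power of \<open>E\<close>
  is bounded by the Lyapunov function.\<close>

lemma
  fixes xc x y :: 'e
  shows integrable_difference_step: "integrable Q (\<lambda>p. norm (two_step (s\<^sup>2) x (fst p) (snd p)
        - two_step (s\<^sup>2) y (snd p) (fst p)) ^ 4)"
    and integral_difference_step: "(\<integral>p. norm (two_step (s\<^sup>2) x (fst p) (snd p)
        - two_step (s\<^sup>2) y (snd p) (fst p)) ^ 4 \<partial>Q)
      \<le> norm (x - y) ^ 4 + s\<^sup>2 * difference_rate K c * lyapunov s (xc, x, y)"
proof -
  define \<Delta>1 where "\<Delta>1 = (\<lambda>p. two_step (s\<^sup>2) x (fst p) (snd p) - x)"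
  define \<Delta>2 where "\<Delta>2 = (\<lambda>p. two_step (s\<^sup>2) y (snd p) (fst p) - y)"
  define \<Delta> where "\<Delta> p = \<Delta>1 p - \<Delta>2 p" for p
  define d where "d = norm (x - y)"
  define B where "B = (1 + norm x)\<^sup>2 + (1 + norm y)\<^sup>2"
  define L where "L = lyapunov s (xc, x, y)"
  define V where "V = moment_weight x + moment_weight y"
  define E where "E = d + s * B"
  have L: "d ^ 4 + s ^ 4 * V \<le> L" by (simp add: L_def lyapunov_def d_def V_def)
  have V: "1 \<le> V" using moment_weight_ge_1[of x] moment_weight_ge_1[of y] by (simp add: V_def)
  have B: "0 \<le> B" "B ^ 4 \<le> 128 * V" using growth_sum_power4_le[of x y] by (auto simp: B_def V_def)
  have d: "0 \<le> d" by (simp add: d_def)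
  have s4V: "s ^ 4 * B ^ 4 \<le> 128 * (s ^ 4 * V)"
    using mult_left_mono[OF B(2), of "s ^ 4"] by auto
  have nn: "0 \<le> s ^ 4 * V" "0 \<le> d ^ 4" using V by auto
  have dB: "d ^ 4 + s ^ 4 * B ^ 4 \<le> 128 * L" using s4V L nn by linarith
  have eq: "two_step (s\<^sup>2) x (fst p) (snd p) - two_step (s\<^sup>2) y (snd p) (fst p) = (x - y) + \<Delta> p" for p
    by (simp add: \<Delta>_def \<Delta>1_def \<Delta>2_def)
  have m: "\<Delta> \<in> borel_measurable Q" unfolding \<Delta>_def \<Delta>1_def \<Delta>2_def by measurable
  have A: "norm (\<Delta> p) \<le> (19 * K^6 * s * E) * \<rho> p ^ 5" for p
    using milstein_pointwise.fine_antithetic_increment_bound[OF pointwise, of x p y]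
    by (simp add: \<Delta>_def \<Delta>1_def \<Delta>2_def E_def d_def B_def mult_ac)
  note I = integral_norm_power4_le[OF m A, of "x - y", folded d_def]
  show "integrable Q (\<lambda>p. norm (two_step (s\<^sup>2) x (fst p) (snd p) - two_step (s\<^sup>2) y (snd p) (fst p)) ^ 4)"
    unfolding eq by (rule I)
  have i: "integrable Q \<Delta>1" "integrable Q \<Delta>2"
    unfolding \<Delta>1_def \<Delta>2_def by (rule two_step_integrable two_step_integrable_swapped)+
  define r1 r2 where "r1 = (\<integral>p. \<Delta>1 p \<partial>Q) - s\<^sup>2 *\<^sub>R f x" and "r2 = (\<integral>p. \<Delta>2 p \<partial>Q) - s\<^sup>2 *\<^sub>R f y"
  let ?Cm = "mean_constant K c"
  have r: "norm r1 \<le> ?Cm * s ^ 4 * (1 + norm x)\<^sup>2" "norm r2 \<le> ?Cm * s ^ 4 * (1 + norm y)\<^sup>2"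
    unfolding r1_def r2_def \<Delta>1_def \<Delta>2_def
    by (rule two_step_mean_bound two_step_mean_bound_swapped)+
  have mean: "norm (\<integral>p. \<Delta> p \<partial>Q) \<le> s\<^sup>2 * (K * d + ?Cm * s\<^sup>2 * B)"
  proof -
    have meq: "(\<integral>p. \<Delta> p \<partial>Q) = s\<^sup>2 *\<^sub>R (f x - f y) + r1 - r2"
      using i by (simp add: \<Delta>_def r1_def r2_def algebra_simps)
    have "norm (\<integral>p. \<Delta> p \<partial>Q) \<le> s\<^sup>2 * norm (f x - f y) + norm r1 + norm r2"
      unfolding meq by (intro order_trans[OF norm_triangle_ineq4] add_right_mono norm_triangle_le) simp
    also have "\<dots> \<le> s\<^sup>2 * (K * d) + ?Cm * s ^ 4 * (1 + norm x)\<^sup>2 + ?Cm * s ^ 4 * (1 + norm y)\<^sup>2"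
      using f_lip[of x y] r by (intro add_mono mult_left_mono) (auto simp: d_def)
    also have "\<dots> = s\<^sup>2 * (K * d + ?Cm * s\<^sup>2 * B)" unfolding B_def by algebra
    finally show ?thesis .
  qed
  have "4 * d ^ 3 * norm (\<integral>p. \<Delta> p \<partial>Q) \<le> 4 * d ^ 3 * (s\<^sup>2 * (K * d + ?Cm * s\<^sup>2 * B))"
    by (intro mult_left_mono mean) (use d in auto)
  also have "\<dots> = s\<^sup>2 * (4 * K * d ^ 4 + 4 * ?Cm * (d ^ 3 * (s\<^sup>2 * B)))" by algebra
  also have "\<dots> \<le> s\<^sup>2 * (4 * K * L + 4 * ?Cm * (K ^ 4 * (128 * L)))"
  proof (intro mult_left_mono add_mono)
    show "d ^ 4 \<le> L" using L nn by linarith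
    \<comment> \<open>Young's inequality leaves a surplus \<open>s ^ 4\<close> on the second term,
      which is bounded by \<open>K ^ 4\<close>.\<close>
    have "d ^ 3 * (s\<^sup>2 * B) \<le> d ^ 4 + (s\<^sup>2 * B) ^ 4" using d B by (intro cube_mult_le) auto
    also have "(s\<^sup>2 * B) ^ 4 = s ^ 4 * (s ^ 4 * B ^ 4)" by algebra
    also have "\<dots> \<le> K ^ 4 * (s ^ 4 * B ^ 4)" using s_pos s_le by (intro mult_right_mono power_mono) auto
    also have "d ^ 4 \<le> K ^ 4 * d ^ 4" using K_ge_1 mult_right_mono[of 1 "K ^ 4" "d ^ 4"] by simp
    finally have "d ^ 3 * (s\<^sup>2 * B) \<le> K ^ 4 * (d ^ 4 + s ^ 4 * B ^ 4)" by (simp add: distrib_left)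
    also have "\<dots> \<le> K ^ 4 * (128 * L)" using dB K_ge_1 by (intro mult_left_mono) auto
    finally show "d ^ 3 * (s\<^sup>2 * B) \<le> K ^ 4 * (128 * L)" .
  qed (use K_ge_1 mean_constant_nonneg in auto)
  finally have 1: "4 * d ^ 3 * norm (\<integral>p. \<Delta> p \<partial>Q) \<le> s\<^sup>2 * (4 * K * L + 4 * ?Cm * (K ^ 4 * (128 * L)))" .
  have dE: "d\<^sup>2 * E\<^sup>2 \<le> 256 * L"
  proof -
    have "d\<^sup>2 * E\<^sup>2 \<le> d\<^sup>2 * (2 * (d\<^sup>2 + (s * B)\<^sup>2))"
      unfolding E_def by (intro mult_left_mono square_sum_le) auto
    also have "\<dots> = 2 * d ^ 4 + 2 * d\<^sup>2 * (s * B)\<^sup>2" by algebra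
    also have "\<dots> \<le> 2 * d ^ 4 + ((d\<^sup>2)\<^sup>2 + ((s * B)\<^sup>2)\<^sup>2)" by (intro add_left_mono sum_squares_bound)
    also have "\<dots> = 3 * d ^ 4 + s ^ 4 * B ^ 4" by algebra
    finally show ?thesis using s4V L nn by linarith
  qed
  have "10 * d\<^sup>2 * (19 * K^6 * s * E)\<^sup>2 * moment_constant c (2 * 5)
      = 3610 * K ^ 12 * s\<^sup>2 * moment_constant c 10 * (d\<^sup>2 * E\<^sup>2)"
    by (simp add: power_mult_distrib flip: power_mult)
  also have "\<dots> \<le> 3610 * K ^ 12 * s\<^sup>2 * moment_constant c 10 * (256 * L)"
    using K_ge_1 moment_constant_ge_1[of 10] by (intro mult_left_mono dE) auto
  finally have 2: "10 * d\<^sup>2 * (19 * K^6 * s * E)\<^sup>2 * moment_constant c (2 * 5)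
     \<le> 3610 * K ^ 12 * s\<^sup>2 * moment_constant c 10 * (256 * L)" .
  have E4: "E ^ 4 \<le> 1024 * L"
  proof -
    have "E ^ 4 \<le> 8 * (d ^ 4 + s ^ 4 * B ^ 4)"
      using power4_sum_le[of d "s * B"] unfolding E_def power_mult_distrib .
    also have "\<dots> \<le> 8 * (128 * L)" using dB by (rule mult_left_mono) simp
    finally show ?thesis by simp
  qed
  have L0: "0 \<le> L" using L nn by linarith
  have "2 * (19 * K^6 * s * E) ^ 4 * moment_constant c (4 * 5)
     = (2 * 19 ^ 4 * K ^ 24 * moment_constant c 20 * E ^ 4) * s ^ 4"
    by (simp add: power_mult_distrib flip: power_mult)
  also have "\<dots> \<le> (2 * 19 ^ 4 * K ^ 24 * moment_constant c 20 * (1024 * L)) * (K\<^sup>2 * s\<^sup>2)"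
  proof (rule mult_mono)
    show "2 * 19 ^ 4 * K ^ 24 * moment_constant c 20 * E ^ 4 \<le> 2 * 19 ^ 4 * K ^ 24 * moment_constant c 20 * (1024 * L)"
      using K_ge_1 moment_constant_ge_1[of 20] by (intro mult_left_mono E4) auto
    \<comment> \<open>One factor \<open>s\<^sup>2\<close> is kept for the rate; the other is bounded
      by a constant.\<close>
    have "s ^ 4 = s\<^sup>2 * s\<^sup>2" by algebra
    also have "\<dots> \<le> K\<^sup>2 * s\<^sup>2" using s_le s_pos by (intro mult_right_mono power_mono) auto
    finally show "s ^ 4 \<le> K\<^sup>2 * s\<^sup>2" .
  qed (use K_ge_1 L0 moment_constant_ge_1[of 20] in auto)
  finally have 3: "2 * (19 * K^6 * s * E) ^ 4 * moment_constant c (4 * 5)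
     \<le> (2 * 19 ^ 4 * K ^ 24 * moment_constant c 20 * (1024 * L)) * (K\<^sup>2 * s\<^sup>2)" .
  have "(\<integral>p. norm ((x - y) + \<Delta> p) ^ 4 \<partial>Q) \<le> d ^ 4 + s\<^sup>2 * (4 * K * L + 4 * ?Cm * (K ^ 4 * (128 * L)))
     + 3610 * K ^ 12 * s\<^sup>2 * moment_constant c 10 * (256 * L)
     + (2 * 19 ^ 4 * K ^ 24 * moment_constant c 20 * (1024 * L)) * (K\<^sup>2 * s\<^sup>2)"
    using I(2) 1 2 3 by linarith
  also have "(2 * 19 ^ 4 * K ^ 24 * moment_constant c 20 * (1024 * L)) * (K\<^sup>2 * s\<^sup>2)
     = s\<^sup>2 * (2048 * 19 ^ 4 * (K ^ 24 * K\<^sup>2) * moment_constant c 20 * L)" by simp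
  also have "K ^ 24 * K\<^sup>2 = K ^ 26" by (simp flip: power_add)
  also have "d ^ 4 + s\<^sup>2 * (4 * K * L + 4 * ?Cm * (K ^ 4 * (128 * L)))
     + 3610 * K ^ 12 * s\<^sup>2 * moment_constant c 10 * (256 * L)
     + s\<^sup>2 * (2048 * 19 ^ 4 * K ^ 26 * moment_constant c 20 * L) = d ^ 4 + s\<^sup>2 * difference_rate K c * L"
    by (simp add: difference_rate_def algebra_simps)
  finally show "(\<integral>p. norm (two_step (s\<^sup>2) x (fst p) (snd p) - two_step (s\<^sup>2) y (snd p) (fst p)) ^ 4 \<partial>Q)
      \<le> norm (x - y) ^ 4 + s\<^sup>2 * difference_rate K c * lyapunov s (xc, x, y)"
    unfolding eq L_def d_def .
qed

lemma moment_rate_nonneg: "0 \<le> moment_rate K c"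
  unfolding moment_rate_def using K_ge_1 moment_constant_ge_1[of 2] moment_constant_ge_1[of 8] moment_constant_ge_1[of 32]
  by (intro mult_nonneg_nonneg add_nonneg_nonneg) auto

lemma lyapunov_rate_nonneg: "0 \<le> lyapunov_rate K c"
proof -
  have "0 \<le> average_rate K c" "0 \<le> difference_rate K c"
    unfolding average_rate_def difference_rate_def
    using K_ge_1 mean_constant_nonneg moment_constant_ge_1[of 10] moment_constant_ge_1[of 20]
    by (intro mult_nonneg_nonneg add_nonneg_nonneg; simp)+
  then show ?thesis using moment_rate_nonneg by (simp add: lyapunov_rate_def)
qed

text \<open>The growth of each summand is bounded by a multiple of the whole function, so the
  coupling between the summands disappears and the rates add.\<close>

lemma
  shows integrable_lyapunov_step: "integrable Q (\<lambda>p. lyapunov s (antithetic_step (s\<^sup>2) z (fst p) (snd p)))"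
    and integral_lyapunov_step: "(\<integral>p. lyapunov s (antithetic_step (s\<^sup>2) z (fst p) (snd p)) \<partial>Q)
      \<le> (1 + s\<^sup>2 * lyapunov_rate K c) * lyapunov s z"
proof -
  obtain xc x y where z: "z = (xc, x, y)" by (cases z)
  note i = integrable_average_step[of x y xc] integrable_difference_step[of x y]
    integrable_moment_weight_two_step[of x] integrable_moment_weight_two_step_swapped[of y]
  have eq: "lyapunov s (antithetic_step (s\<^sup>2) z (fst p) (snd p)) =
     (norm ((1/2) *\<^sub>R (two_step (s\<^sup>2) x (fst p) (snd p)
        + two_step (s\<^sup>2) y (snd p) (fst p)) - step (s\<^sup>2) xc (fst p + snd p)))\<^sup>2
     + norm (two_step (s\<^sup>2) x (fst p) (snd p) - two_step (s\<^sup>2) y (snd p) (fst p)) ^ 4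
     + s ^ 4 * (moment_weight (two_step (s\<^sup>2) x (fst p) (snd p)) + moment_weight (two_step (s\<^sup>2) y (snd p) (fst p)))" for p
    by (simp add: z lyapunov_def antithetic_step_def)
  show "integrable Q (\<lambda>p. lyapunov s (antithetic_step (s\<^sup>2) z (fst p) (snd p)))"
    unfolding eq by (intro Bochner_Integration.integrable_add integrable_mult_right i)
  let ?L = "lyapunov s z"
  have "(\<integral>p. lyapunov s (antithetic_step (s\<^sup>2) z (fst p) (snd p)) \<partial>Q)
     = (\<integral>p. (norm ((1/2) *\<^sub>R (two_step (s\<^sup>2) x (fst p) (snd p)
        + two_step (s\<^sup>2) y (snd p) (fst p)) - step (s\<^sup>2) xc (fst p + snd p)))\<^sup>2 \<partial>Q)
     + (\<integral>p. norm (two_step (s\<^sup>2) x (fst p) (snd p) - two_step (s\<^sup>2) y (snd p) (fst p)) ^ 4 \<partial>Q)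
     + s ^ 4 * ((\<integral>p. moment_weight (two_step (s\<^sup>2) x (fst p) (snd p)) \<partial>Q)
         + (\<integral>p. moment_weight (two_step (s\<^sup>2) y (snd p) (fst p)) \<partial>Q))"
    unfolding eq using i by simp
  also have "\<dots> \<le> ((norm ((1/2) *\<^sub>R (x + y) - xc))\<^sup>2 + s\<^sup>2 * average_rate K c * ?L)
     + (norm (x - y) ^ 4 + s\<^sup>2 * difference_rate K c * ?L)
     + s ^ 4 * ((1 + s\<^sup>2 * moment_rate K c) * moment_weight x + (1 + s\<^sup>2 * moment_rate K c) * moment_weight y)"
    unfolding z
    by (intro add_mono mult_left_mono integral_average_step integral_difference_step
        integral_moment_weight_two_step integral_moment_weight_two_step_swapped) auto
  also have "\<dots> = ((norm ((1/2) *\<^sub>R (x + y) - xc))\<^sup>2 + norm (x - y) ^ 4 + s ^ 4 * (moment_weight x + moment_weight y))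
      + s\<^sup>2 * average_rate K c * ?L + s\<^sup>2 * difference_rate K c * ?L
      + s\<^sup>2 * moment_rate K c * (s ^ 4 * (moment_weight x + moment_weight y))" by algebra
  also have "(norm ((1/2) *\<^sub>R (x + y) - xc))\<^sup>2 + norm (x - y) ^ 4 + s ^ 4 * (moment_weight x + moment_weight y) = ?L"
    by (simp add: z lyapunov_def)
  also have "?L + s\<^sup>2 * average_rate K c * ?L + s\<^sup>2 * difference_rate K c * ?L
      + s\<^sup>2 * moment_rate K c * (s ^ 4 * (moment_weight x + moment_weight y))
    \<le> ?L + s\<^sup>2 * average_rate K c * ?L + s\<^sup>2 * difference_rate K c * ?L + s\<^sup>2 * moment_rate K c * ?L"
  proof (intro add_left_mono mult_left_mono)
    show "s ^ 4 * (moment_weight x + moment_weight y) \<le> ?L" by (simp add: z lyapunov_def)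
    show "0 \<le> s\<^sup>2 * moment_rate K c" using moment_rate_nonneg by simp
  qed
  also have "\<dots> = (1 + s\<^sup>2 * lyapunov_rate K c) * ?L" unfolding lyapunov_rate_def by algebra
  finally show "(\<integral>p. lyapunov s (antithetic_step (s\<^sup>2) z (fst p) (snd p)) \<partial>Q)
      \<le> (1 + s\<^sup>2 * lyapunov_rate K c) * ?L" .
qed

end

section \<open>Propagation along the Brownian path\<close>

lemma lyapunov_continuous: "continuous_on UNIV (lyapunov s :: 'e::real_inner \<times> 'e \<times> 'e \<Rightarrow> real)"
  unfolding lyapunov_def moment_weight_def case_prod_unfold by (intro continuous_intros)

lemma lyapunov_measurable [measurable]:
  "(lyapunov s :: 'e::euclidean_space \<times> 'e \<times> 'e \<Rightarrow> real) \<in> borel_measurable borel"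
  by (rule borel_measurable_continuous_onI[OF lyapunov_continuous])

context milstein_coefficients
begin

lemma antithetic_step_measurable [measurable (raw)]:
  assumes Z [measurable]: "Z \<in> borel_measurable M" and [measurable]: "U \<in> borel_measurable M" "V \<in> borel_measurable M"
  shows "(\<lambda>\<omega>. antithetic_step \<tau> (Z \<omega>) (U \<omega>) (V \<omega>)) \<in> borel_measurable M"
proof -
  have m: "\<phi> \<in> borel_measurable borel \<Longrightarrow> (\<lambda>\<omega>. \<phi> (Z \<omega>)) \<in> borel_measurable M" for \<phi> :: "'e \<times> 'e \<times> 'e \<Rightarrow> 'e"
    by (rule measurable_compose[OF Z])
  have [measurable]: "(\<lambda>\<omega>. fst (Z \<omega>)) \<in> borel_measurable M" "(\<lambda>\<omega>. fst (snd (Z \<omega>))) \<in> borel_measurable M"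
    "(\<lambda>\<omega>. snd (snd (Z \<omega>))) \<in> borel_measurable M"
    by (intro m borel_measurable_continuous_onI continuous_intros)+
  show ?thesis unfolding antithetic_step_def case_prod_unfold
    by (intro borel_measurable_Pair) measurable
qed

text \<open>The two product laws express that \<open>U\<close> is independent of the state and
  \<open>V\<close> of both. The expectation becomes an iterated integral, and the inner integrals
  are the one-step bound at a frozen state \<open>z\<close>. Nonnegative integrals are meaningful
  before any moment of the state is known to be finite.\<close>

lemma nn_integral_lyapunov_step:
  assumes "prob_space M" and s: "0 < s" "s \<le> K"
    and meas [measurable]: "Z \<in> borel_measurable M" "U \<in> borel_measurable M" "V \<in> borel_measurable M"
    and ZU: "distr M (borel \<Otimes>\<^sub>M borel) (\<lambda>\<omega>. (Z \<omega>, U \<omega>)) = distr M borel Z \<Otimes>\<^sub>M distr M borel U"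
    and ZUV: "distr M (borel \<Otimes>\<^sub>M borel) (\<lambda>\<omega>. ((Z \<omega>, U \<omega>), V \<omega>))
      = distr M borel (\<lambda>\<omega>. (Z \<omega>, U \<omega>)) \<Otimes>\<^sub>M distr M borel V"
    and law: "increment_law s c (distr M borel U)" "increment_law s c (distr M borel V)"
  shows "(\<integral>\<^sup>+\<omega>. ennreal (lyapunov s (antithetic_step (s\<^sup>2) (Z \<omega>) (U \<omega>) (V \<omega>))) \<partial>M)
    \<le> ennreal (1 + s\<^sup>2 * lyapunov_rate K c) * (\<integral>\<^sup>+\<omega>. ennreal (lyapunov s (Z \<omega>)) \<partial>M)"
proof -
  interpret prob_space M by fact
  define \<mu> \<nu> where "\<mu> = distr M borel U" and "\<nu> = distr M borel V"
  interpret noise: milstein_noise f Df G DG H HO K s c \<mu> \<nu>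
    by unfold_locales (use s law in \<open>auto simp: \<mu>_def \<nu>_def\<close>)
  \<comment> \<open>The product of the Borel sigma-algebras is identified with the Borel
    sigma-algebra of the product, in which continuous projections are measurable.\<close>
  have d1: "distr M borel (\<lambda>\<omega>. (Z \<omega>, U \<omega>)) = distr M borel Z \<Otimes>\<^sub>M \<mu>"
    using ZU by (simp add: \<mu>_def borel_prod)
  have d2: "distr M borel (\<lambda>\<omega>. ((Z \<omega>, U \<omega>), V \<omega>)) = (distr M borel Z \<Otimes>\<^sub>M \<mu>) \<Otimes>\<^sub>M \<nu>"
    using ZUV by (simp add: \<nu>_def d1 borel_prod)
  define \<phi> where "\<phi> = (\<lambda>q. ennreal (lyapunov s (antithetic_step (s\<^sup>2) (fst (fst q)) (snd (fst q)) (snd q))))"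
  have \<phi>_borel [measurable]: "\<phi> \<in> borel_measurable borel"
  proof -
    have "(\<lambda>q :: (('e \<times> 'e \<times> 'e) \<times> 'u) \<times> 'u. fst (fst q)) \<in> borel_measurable borel"
      "(\<lambda>q :: (('e \<times> 'e \<times> 'e) \<times> 'u) \<times> 'u. snd (fst q)) \<in> borel_measurable borel"
      "(\<lambda>q :: (('e \<times> 'e \<times> 'e) \<times> 'u) \<times> 'u. snd q) \<in> borel_measurable borel"
      by (intro borel_measurable_continuous_onI continuous_intros)+
    then show ?thesis unfolding \<phi>_def
      by (intro measurable_compose[OF _ measurable_ennreal] measurable_compose[OF antithetic_step_measurable lyapunov_measurable])
  qed
  have \<phi>_pair [measurable]: "\<phi> \<in> borel_measurable ((distr M borel Z \<Otimes>\<^sub>M \<mu>) \<Otimes>\<^sub>M \<nu>)"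
    unfolding d2[symmetric] by simp
  have one: "(\<integral>\<^sup>+u. \<integral>\<^sup>+v. \<phi> ((z, u), v) \<partial>\<nu> \<partial>\<mu>) \<le> ennreal (1 + s\<^sup>2 * lyapunov_rate K c) * ennreal (lyapunov s z)" for z
  proof -
    let ?g = "\<lambda>p. lyapunov s (antithetic_step (s\<^sup>2) z (fst p) (snd p))"
    have i: "integrable noise.Q ?g" by (rule noise.integrable_lyapunov_step)
    have "(\<integral>\<^sup>+u. \<integral>\<^sup>+v. \<phi> ((z, u), v) \<partial>\<nu> \<partial>\<mu>) = (\<integral>\<^sup>+p. ennreal (?g p) \<partial>noise.Q)"
      using noise.nu.nn_integral_fst[of "\<lambda>p. ennreal (?g p)" \<mu>] borel_measurable_integrable[OF i]
      by (simp add: \<phi>_def)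
    also have "\<dots> = ennreal (\<integral>p. ?g p \<partial>noise.Q)"
      by (rule nn_integral_eq_integral[OF i]) (simp add: lyapunov_nonneg)
    also have "\<dots> \<le> ennreal ((1 + s\<^sup>2 * lyapunov_rate K c) * lyapunov s z)"
      by (rule ennreal_leI[OF noise.integral_lyapunov_step])
    finally show ?thesis by (simp add: ennreal_mult'' lyapunov_nonneg)
  qed
  have "(\<integral>\<^sup>+\<omega>. ennreal (lyapunov s (antithetic_step (s\<^sup>2) (Z \<omega>) (U \<omega>) (V \<omega>))) \<partial>M)
      = (\<integral>\<^sup>+q. \<phi> q \<partial>distr M borel (\<lambda>\<omega>. ((Z \<omega>, U \<omega>), V \<omega>)))"
  proof -
    have "(\<lambda>\<omega>. ((Z \<omega>, U \<omega>), V \<omega>)) \<in> borel_measurable M" by (intro borel_measurable_Pair meas)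
    from nn_integral_distr[OF this, of \<phi>] \<phi>_borel have "(\<integral>\<^sup>+q. \<phi> q \<partial>distr M borel (\<lambda>\<omega>. ((Z \<omega>, U \<omega>), V \<omega>))) = (\<integral>\<^sup>+\<omega>. \<phi> ((Z \<omega>, U \<omega>), V \<omega>) \<partial>M)"
      by simp
    then show ?thesis by (simp only: \<phi>_def fst_conv snd_conv)
  qed
  also have "\<dots> = (\<integral>\<^sup>+z. \<integral>\<^sup>+u. \<integral>\<^sup>+v. \<phi> ((z, u), v) \<partial>\<nu> \<partial>\<mu> \<partial>distr M borel Z)"
    unfolding d2 noise.nu.nn_integral_fst[OF \<phi>_pair, symmetric]
    by (rule noise.mu.nn_integral_fst[OF noise.nu.borel_measurable_nn_integral_fst[OF \<phi>_pair], symmetric])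
  also have "\<dots> \<le> (\<integral>\<^sup>+z. ennreal (1 + s\<^sup>2 * lyapunov_rate K c) * ennreal (lyapunov s z) \<partial>distr M borel Z)"
    by (intro nn_integral_mono one)
  also have "\<dots> = ennreal (1 + s\<^sup>2 * lyapunov_rate K c) * (\<integral>\<^sup>+\<omega>. ennreal (lyapunov s (Z \<omega>)) \<partial>M)"
    by (simp add: nn_integral_cmult nn_integral_distr)
  finally show ?thesis .
qed

end

section \<open>Independence of a Brownian increment from the past\<close>

context usual_filtered_prob_space
begin

lemma space_F: "0 \<le> t \<Longrightarrow> space (F t) = space M"
  using subalgebra_F by (simp add: subalgebra_def)

lemma measurable_F_mono:
  "0 \<le> s \<Longrightarrow> s \<le> t \<Longrightarrow> X \<in> measurable (F s) N \<Longrightarrow> X \<in> measurable (F t) N"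
  using sets_F_mono[of s t] space_F[of s] space_F[of t] unfolding measurable_def by auto

lemma measurable_F_M: "0 \<le> t \<Longrightarrow> X \<in> measurable (F t) N \<Longrightarrow> X \<in> measurable M N"
  by (rule measurable_from_subalg[OF subalgebra_F])

end

context correlated_brownian_motion
begin

lemma increment_measurable: "0 \<le> s \<Longrightarrow> s \<le> t \<Longrightarrow> (\<lambda>\<omega>. w t \<omega> - w s \<omega>) \<in> borel_measurable (F t)"
  by (intro borel_measurable_diff adapted measurable_F_mono[of s t]) auto

text \<open>Independence of events is the product rule on rectangles, and rectangles determine the
  joint law. The target space of \<open>X\<close> is left open because \<open>X\<close> will be the
  state as well as the state paired with the first half increment.\<close>

lemma distr_pair_increment:
  assumes st: "0 \<le> s" "s < t" and X: "X \<in> measurable (F s) N"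
  shows "distr M (N \<Otimes>\<^sub>M borel) (\<lambda>\<omega>. (X \<omega>, w t \<omega> - w s \<omega>))
    = distr M N X \<Otimes>\<^sub>M distr M borel (\<lambda>\<omega>. w t \<omega> - w s \<omega>)"
proof -
  let ?W = "\<lambda>\<omega>. w t \<omega> - w s \<omega>"
  have W [measurable]: "random_variable borel ?W"
    using increment_measurable[of s t] st by (intro measurable_F_M[of t]) auto
  have XM [measurable]: "random_variable N X" using measurable_F_M[OF st(1) X] .
  interpret X: prob_space "distr M N X" by (rule prob_space_distr) simp
  interpret W: prob_space "distr M borel ?W" by (rule prob_space_distr) simp
  show ?thesis
  proof (rule pair_measure_eqI[symmetric])
    fix A B assume A: "A \<in> sets (distr M N X)" and B: "B \<in> sets (distr M borel ?W)"
    have "X -` A \<inter> space M \<in> sets (F s)" using measurable_sets[OF X, of A] A space_F[OF st(1)] by simp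
    have "prob ((X -` A \<inter> space M) \<inter> (?W -` B \<inter> space M)) = prob (X -` A \<inter> space M) * prob (?W -` B \<inter> space M)"
    proof -
      have "?W -` B \<inter> space M \<in> {?W -` A \<inter> space M |A. A \<in> sets borel}" using B by auto
      with increment_indep[OF st] \<open>X -` A \<inter> space M \<in> sets (F s)\<close> show ?thesis
        unfolding indep_sets2_eq by blast
    qed
    moreover have "(\<lambda>\<omega>. (X \<omega>, ?W \<omega>)) -` (A \<times> B) \<inter> space M = (X -` A \<inter> space M) \<inter> (?W -` B \<inter> space M)"
      by auto
    ultimately show "emeasure (distr M N X) A * emeasure (distr M borel ?W) B
        = emeasure (distr M (N \<Otimes>\<^sub>M borel) (\<lambda>\<omega>. (X \<omega>, ?W \<omega>))) (A \<times> B)"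
      using A B by (simp add: emeasure_distr emeasure_eq_measure ennreal_mult)
  qed (simp_all add: X.sigma_finite_measure_axioms W.sigma_finite_measure_axioms)
qed

end

text \<open>The constants \<open>c\<close> are common to all starting times and all step sizes; this
  uniformity keeps the final constant independent of the number of steps.\<close>

locale milstein_brownian =
  milstein_coefficients f Df G DG H HO K + correlated_brownian_motion M F w \<Omega>
  for f :: "'e::euclidean_space \<Rightarrow> 'e" and Df and G :: "'e \<Rightarrow> real^'D \<Rightarrow> 'e" and DG H HO K
    and M :: "'w measure" and F w \<Omega> +
  fixes c :: "nat \<Rightarrow> real"
  assumes increment_law_increment:
    "\<And>s r. 0 < s \<Longrightarrow> 0 \<le> r \<Longrightarrow> increment_law s c (distr M borel (\<lambda>\<omega>. w (r + s\<^sup>2 / 2) \<omega> - w r \<omega>))"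
begin

context
  fixes s :: real and Z :: "nat \<Rightarrow> 'w \<Rightarrow> 'e \<times> 'e \<times> 'e" and z0
  assumes s: "0 < s" "s \<le> K"
    and Z_0: "\<And>\<omega>. Z 0 \<omega> = z0"
    and Z_Suc: "\<And>n \<omega>. Z (Suc n) \<omega> = antithetic_step (s\<^sup>2) (Z n \<omega>)
      (w ((real n + 1 / 2) * s\<^sup>2) \<omega> - w (real n * s\<^sup>2) \<omega>)
      (w (real (n + 1) * s\<^sup>2) \<omega> - w ((real n + 1 / 2) * s\<^sup>2) \<omega>)"
begin

text \<open>Adaptedness is what makes the state independent of the increments still to come.\<close>

lemma Z_measurable: "Z n \<in> borel_measurable (F (real n * s\<^sup>2))"
proof (induction n)
  case 0
  have "Z 0 = (\<lambda>_. z0)" using Z_0 by auto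
  then show ?case by simp
next
  case (Suc n)
  have t: "0 \<le> real n * s\<^sup>2" "real n * s\<^sup>2 \<le> (real n + 1 / 2) * s\<^sup>2" "(real n + 1 / 2) * s\<^sup>2 \<le> real (n + 1) * s\<^sup>2"
    by (auto intro!: mult_right_mono)
  have "Z (Suc n) = (\<lambda>\<omega>. antithetic_step (s\<^sup>2) (Z n \<omega>)
      (w ((real n + 1 / 2) * s\<^sup>2) \<omega> - w (real n * s\<^sup>2) \<omega>)
      (w (real (n + 1) * s\<^sup>2) \<omega> - w ((real n + 1 / 2) * s\<^sup>2) \<omega>))"
    using Z_Suc by auto
  moreover have "Z n \<in> borel_measurable (F (real (Suc n) * s\<^sup>2))"
    using measurable_F_mono[OF t(1) _ Suc] by (simp add: mult_right_mono)
  moreover have "(\<lambda>\<omega>. w ((real n + 1 / 2) * s\<^sup>2) \<omega> - w (real n * s\<^sup>2) \<omega>) \<in> borel_measurable (F (real (Suc n) * s\<^sup>2))"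
    by (rule measurable_F_mono[OF _ _ increment_measurable[OF t(1,2)]]) (use t in auto)
  moreover have "(\<lambda>\<omega>. w (real (n + 1) * s\<^sup>2) \<omega> - w ((real n + 1 / 2) * s\<^sup>2) \<omega>) \<in> borel_measurable (F (real (Suc n) * s\<^sup>2))"
    using increment_measurable[of "(real n + 1 / 2) * s\<^sup>2" "real (n + 1) * s\<^sup>2"] t by simp
  ultimately show ?case by (auto intro: antithetic_step_measurable)
qed

text \<open>A discrete Gronwall argument without source term. Independence is used at the start of
  the step, between the state and \<open>U\<close>, and at its middle, between both of these and
  \<open>V\<close>.\<close>

lemma nn_integral_lyapunov_path:
  "(\<integral>\<^sup>+\<omega>. ennreal (lyapunov s (Z n \<omega>)) \<partial>M) \<le> ennreal ((1 + s\<^sup>2 * lyapunov_rate K c) ^ n * lyapunov s z0)"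
proof (induction n)
  case 0
  then show ?case by (simp add: Z_0 emeasure_space_1)
next
  case (Suc n)
  define r where "r = real n * s\<^sup>2"
  have r: "0 \<le> r" "(real n + 1 / 2) * s\<^sup>2 = r + s\<^sup>2 / 2" "real (n + 1) * s\<^sup>2 = r + s\<^sup>2 / 2 + s\<^sup>2 / 2"
    by (auto simp: r_def algebra_simps)
  have s2: "0 < s\<^sup>2 / 2" using s by simp
  define U V where "U = (\<lambda>\<omega>. w (r + s\<^sup>2 / 2) \<omega> - w r \<omega>)"
    and "V = (\<lambda>\<omega>. w (r + s\<^sup>2 / 2 + s\<^sup>2 / 2) \<omega> - w (r + s\<^sup>2 / 2) \<omega>)"
  have law: "increment_law s c (distr M borel U)" "increment_law s c (distr M borel V)"
    using increment_law_increment[OF s(1) r(1)] increment_law_increment[OF s(1), of "r + s\<^sup>2 / 2"] r(1)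
    by (simp_all add: U_def V_def)
  have Z: "Z n \<in> borel_measurable (F r)" using Z_measurable[of n] by (simp add: r_def)
  have U: "U \<in> borel_measurable (F (r + s\<^sup>2 / 2))"
    unfolding U_def using increment_measurable[of r "r + s\<^sup>2 / 2"] r(1) s2 by simp
  have V: "V \<in> borel_measurable (F (r + s\<^sup>2 / 2 + s\<^sup>2 / 2))"
    unfolding V_def using increment_measurable[of "r + s\<^sup>2 / 2" "r + s\<^sup>2 / 2 + s\<^sup>2 / 2"] r(1) s2 by simp
  have ZU: "(\<lambda>\<omega>. (Z n \<omega>, U \<omega>)) \<in> borel_measurable (F (r + s\<^sup>2 / 2))"
    using U measurable_F_mono[OF r(1) _ Z, of "r + s\<^sup>2 / 2"] by (intro borel_measurable_Pair) auto
  have "(\<integral>\<^sup>+\<omega>. ennreal (lyapunov s (antithetic_step (s\<^sup>2) (Z n \<omega>) (U \<omega>) (V \<omega>))) \<partial>M)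
    \<le> ennreal (1 + s\<^sup>2 * lyapunov_rate K c) * (\<integral>\<^sup>+\<omega>. ennreal (lyapunov s (Z n \<omega>)) \<partial>M)"
  proof (rule nn_integral_lyapunov_step[OF prob_space_axioms s _ _ _ _ _ law])
    show "distr M (borel \<Otimes>\<^sub>M borel) (\<lambda>\<omega>. (Z n \<omega>, U \<omega>)) = distr M borel (Z n) \<Otimes>\<^sub>M distr M borel U"
      unfolding U_def by (rule distr_pair_increment[OF _ _ Z]) (use r s2 in auto)
    show "distr M (borel \<Otimes>\<^sub>M borel) (\<lambda>\<omega>. ((Z n \<omega>, U \<omega>), V \<omega>))
      = distr M borel (\<lambda>\<omega>. (Z n \<omega>, U \<omega>)) \<Otimes>\<^sub>M distr M borel V"
      unfolding V_def by (rule distr_pair_increment[OF _ _ ZU]) (use r s2 in auto)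
    show "Z n \<in> borel_measurable M" "U \<in> borel_measurable M" "V \<in> borel_measurable M"
      using measurable_F_M[OF _ Z] measurable_F_M[OF _ U] measurable_F_M[OF _ V] r(1) by auto
  qed
  also have "\<dots> \<le> ennreal (1 + s\<^sup>2 * lyapunov_rate K c) * ennreal ((1 + s\<^sup>2 * lyapunov_rate K c) ^ n * lyapunov s z0)"
    by (rule mult_left_mono[OF Suc]) simp
  also have "\<dots> = ennreal ((1 + s\<^sup>2 * lyapunov_rate K c) ^ Suc n * lyapunov s z0)"
  proof -
    \<comment> \<open>This provides the sign of the rate, so that the product of real numbers can be
      taken out of \<open>ennreal\<close>.\<close>
    interpret noise: milstein_noise f Df G DG H HO K s c "distr M borel U" "distr M borel V"
      by unfold_locales (use s law in auto)
    show ?thesis using noise.lyapunov_rate_nonneg s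
      by (subst ennreal_mult'[symmetric]) (auto simp: mult.assoc)
  qed
  finally have "(\<integral>\<^sup>+\<omega>. ennreal (lyapunov s (antithetic_step (s\<^sup>2) (Z n \<omega>) (U \<omega>) (V \<omega>))) \<partial>M)
    \<le> ennreal ((1 + s\<^sup>2 * lyapunov_rate K c) ^ Suc n * lyapunov s z0)" .
  moreover have "antithetic_step (s\<^sup>2) (Z n \<omega>) (U \<omega>) (V \<omega>) = Z (Suc n) \<omega>" for \<omega>
    unfolding Z_Suc r(2) r(3) U_def V_def r_def[symmetric] ..
  ultimately show ?case by simp
qed

end

end

section \<open>Gaussian increments and bounded partial derivatives\<close>

text \<open>The quotient is (2m-1)!!, the moment of order 2m of the standard normal law; adding 1
  gives a bound for the absolute moment of order m, whatever its parity.\<close>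

definition normal_moment_constant :: "nat \<Rightarrow> real" where
  "normal_moment_constant m = 1 + fact (2 * m) / (2 ^ m * fact m)"

lemma sets_centred_normal_law [simp, measurable_cong]: "sets (centred_normal_law v) = sets borel"
  by (simp add: centred_normal_law_def)

lemma centred_normal_law_mean:
  assumes "0 < v"
  shows "(\<integral>x. x \<partial>centred_normal_law v) = 0"
  using assms integral_normal_moment_nz_1[of "sqrt v" 0]
  by (simp add: centred_normal_law_def integral_density)

text \<open>Variance zero is included because a linear functional of the increment may degenerate,
  such as the sum of two perfectly anticorrelated coordinates.\<close>

lemma centred_normal_law_square:
  assumes "0 \<le> v"
  shows "integrable (centred_normal_law v) (\<lambda>x. x\<^sup>2)" "(\<integral>x. x\<^sup>2 \<partial>centred_normal_law v) = v"
proof -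
  show "integrable (centred_normal_law v) (\<lambda>x. x\<^sup>2)"
    using assms integrable_normal_moment[of "sqrt v" 0 2]
    by (cases "v = 0")
       (auto simp: centred_normal_law_def integrable_density intro!: integrableI_bounded simp: nn_integral_return)
  show "(\<integral>x. x\<^sup>2 \<partial>centred_normal_law v) = v"
    using assms integral_normal_moment_even[of "sqrt v" 0 1]
    by (cases "v = 0") (simp_all add: centred_normal_law_def integral_density integral_return)
qed

text \<open>The inequality between arithmetic and geometric means bounds
  \<open>\<bar>x\<bar> ^ m\<close> by \<open>\<sigma> ^ m + x ^ (2 * m) / \<sigma> ^ m\<close>, so
  the closed formula for even moments serves every \<open>m\<close>.\<close>

lemma centred_normal_law_abs_moment:
  assumes "0 < v"
  shows "integrable (centred_normal_law v) (\<lambda>x. \<bar>x\<bar> ^ m)"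
    "(\<integral>x. \<bar>x\<bar> ^ m \<partial>centred_normal_law v) \<le> sqrt v ^ m * normal_moment_constant m"
proof -
  let ?\<sigma> = "sqrt v"
  let ?n = "normal_density 0 ?\<sigma>"
  have \<sigma>: "0 < ?\<sigma>" using assms by simp
  have i: "integrable lborel (\<lambda>x. ?n x * \<bar>x\<bar> ^ m)"
    using integrable_normal_moment_abs[OF \<sigma>, of 0 m] by simp
  have i2: "integrable lborel (\<lambda>x. ?n x * x ^ (2 * m))"
    using integrable_normal_moment[OF \<sigma>, of 0 "2 * m"] by simp
  show "integrable (centred_normal_law v) (\<lambda>x. \<bar>x\<bar> ^ m)"
    using assms i by (simp add: centred_normal_law_def integrable_density)
  have le: "?n x * \<bar>x\<bar> ^ m \<le> ?\<sigma> ^ m * ?n x + (1 / ?\<sigma> ^ m) * (?n x * x ^ (2 * m))" for x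
  proof -
    have "\<bar>x\<bar> ^ m * ?\<sigma> ^ m \<le> (?\<sigma> ^ m)\<^sup>2 + (\<bar>x\<bar> ^ m)\<^sup>2"
    proof -
      have "0 \<le> \<bar>x\<bar> ^ m * ?\<sigma> ^ m" using \<sigma> by simp
      moreover have "2 * (\<bar>x\<bar> ^ m * ?\<sigma> ^ m) \<le> (\<bar>x\<bar> ^ m)\<^sup>2 + (?\<sigma> ^ m)\<^sup>2"
        using sum_squares_bound[of "\<bar>x\<bar> ^ m" "?\<sigma> ^ m"] by (simp only: mult.assoc)
      ultimately show ?thesis by linarith
    qed
    then have "\<bar>x\<bar> ^ m \<le> ((?\<sigma> ^ m)\<^sup>2 + (\<bar>x\<bar> ^ m)\<^sup>2) / ?\<sigma> ^ m"
      by (rule mult_imp_le_div_pos[OF zero_less_power[OF \<sigma>]])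
    also have "(\<bar>x\<bar> ^ m)\<^sup>2 = x ^ (2 * m)"
      by (simp add: mult.commute[of 2 m] flip: power_mult) (simp add: mult.commute[of m 2] power_even_abs)
    also have "((?\<sigma> ^ m)\<^sup>2 + x ^ (2 * m)) / ?\<sigma> ^ m = ?\<sigma> ^ m + (1 / ?\<sigma> ^ m) * x ^ (2 * m)"
      using \<sigma> by (simp add: add_divide_distrib power2_eq_square)
    finally have "?n x * \<bar>x\<bar> ^ m \<le> ?n x * (?\<sigma> ^ m + (1 / ?\<sigma> ^ m) * x ^ (2 * m))"
      by (rule mult_left_mono) simp
    then show ?thesis by (simp add: algebra_simps)
  qed
  have "(\<integral>x. \<bar>x\<bar> ^ m \<partial>centred_normal_law v) = (\<integral>x. ?n x * \<bar>x\<bar> ^ m \<partial>lborel)"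
    using assms by (simp add: centred_normal_law_def integral_density)
  also have "\<dots> \<le> (\<integral>x. ?\<sigma> ^ m * ?n x + (1 / ?\<sigma> ^ m) * (?n x * x ^ (2 * m)) \<partial>lborel)"
    using i2 \<sigma> by (intro integral_mono i le) auto
  also have "\<dots> = ?\<sigma> ^ m + (1 / ?\<sigma> ^ m) * (fact (2 * m) / ((2 / ?\<sigma>\<^sup>2) ^ m * fact m))"
    using i2 \<sigma> integral_normal_moment_even[OF \<sigma>, of 0 m] by simp
  also have "\<dots> = ?\<sigma> ^ m * normal_moment_constant m"
  proof -
    have "?\<sigma> ^ m * ?\<sigma> ^ m = v ^ m" using assms by (simp flip: power_mult_distrib)
    then show ?thesis
      using \<sigma> by (simp add: normal_moment_constant_def field_simps power_divide power2_eq_square power_mult_distrib)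
  qed
  finally show "(\<integral>x. \<bar>x\<bar> ^ m \<partial>centred_normal_law v) \<le> ?\<sigma> ^ m * normal_moment_constant m" .
qed

text \<open>The norm is at most the number of coordinates times the largest one, whose power is one
  of the summands.\<close>

lemma power_norm_vec_le:
  fixes u :: "real^'n"
  shows "norm u ^ m \<le> real CARD('n) ^ m * (\<Sum>j\<in>UNIV. \<bar>u $ j\<bar> ^ m)"
proof -
  define M where "M = Max (range (\<lambda>j. \<bar>u $ j\<bar>))"
  have M: "\<bar>u $ j\<bar> \<le> M" for j unfolding M_def by (intro Max_ge) auto
  have "M \<in> range (\<lambda>j. \<bar>u $ j\<bar>)" unfolding M_def by (intro Max_in) auto
  then obtain j0 where j0: "M = \<bar>u $ j0\<bar>" by auto
  have "norm u \<le> (\<Sum>j\<in>UNIV. \<bar>u $ j\<bar>)" by (rule norm_le_l1_cart)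
  also have "\<dots> \<le> real CARD('n) * M" using sum_bounded_above[of UNIV "\<lambda>j. \<bar>u $ j\<bar>" M] M by simp
  finally have "norm u ^ m \<le> (real CARD('n) * M) ^ m" by (intro power_mono) auto
  also have "\<dots> = real CARD('n) ^ m * \<bar>u $ j0\<bar> ^ m" by (simp add: power_mult_distrib j0)
  also have "\<dots> \<le> real CARD('n) ^ m * (\<Sum>j\<in>UNIV. \<bar>u $ j\<bar> ^ m)"
    by (intro mult_left_mono member_le_sum) auto
  finally show ?thesis .
qed

section \<open>Mean, covariance and moments of a correlated Gaussian increment\<close>

locale gaussian_increment = prob_space \<mu> for \<mu> :: "(real^'D) measure" +
  fixes h :: real and \<Omega> :: "real^'D^'D"
  assumes sets_mu [measurable_cong, simp]: "sets \<mu> = sets borel"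
    and gaussian: "centred_gaussian \<mu> (h *\<^sub>R \<Omega>)" and h_pos: "0 < h" and diagonal: "\<Omega> $ j $ j = 1"
begin

lemma symmetric: "\<Omega> $ j $ k = \<Omega> $ k $ j"
proof -
  have "transpose (h *\<^sub>R \<Omega>) $ k $ j = (h *\<^sub>R \<Omega>) $ k $ j"
    using gaussian by (simp add: centred_gaussian_def)
  then show ?thesis using h_pos by (simp add: transpose_def)
qed

lemma
  fixes \<phi> :: "real \<Rightarrow> real"
  assumes [measurable]: "\<phi> \<in> borel_measurable borel"
  shows integrable_linear_functional:
      "integrable (centred_normal_law (a \<bullet> ((h *\<^sub>R \<Omega>) *v a))) \<phi> \<longleftrightarrow> integrable \<mu> (\<lambda>x. \<phi> (a \<bullet> x))"
    and integral_linear_functional: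
      "(\<integral>y. \<phi> y \<partial>centred_normal_law (a \<bullet> ((h *\<^sub>R \<Omega>) *v a))) = (\<integral>x. \<phi> (a \<bullet> x) \<partial>\<mu>)"
proof -
  have d: "centred_normal_law (a \<bullet> ((h *\<^sub>R \<Omega>) *v a)) = distr \<mu> borel (\<lambda>x. a \<bullet> x)"
    using gaussian by (simp add: centred_gaussian_def)
  show "integrable (centred_normal_law (a \<bullet> ((h *\<^sub>R \<Omega>) *v a))) \<phi> \<longleftrightarrow> integrable \<mu> (\<lambda>x. \<phi> (a \<bullet> x))"
    unfolding d by (rule integrable_distr_eq) auto
  show "(\<integral>y. \<phi> y \<partial>centred_normal_law (a \<bullet> ((h *\<^sub>R \<Omega>) *v a))) = (\<integral>x. \<phi> (a \<bullet> x) \<partial>\<mu>)"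
    unfolding d by (rule integral_distr) auto
qed

lemma axis_form: "axis j 1 \<bullet> ((h *\<^sub>R \<Omega>) *v axis k 1) = h * \<Omega> $ j $ k"
  by (simp add: matrix_vector_mult_basis column_def inner_axis')

lemma coordinate_moment:
  "integrable \<mu> (\<lambda>u. \<bar>u $ j\<bar> ^ m)" "(\<integral>u. \<bar>u $ j\<bar> ^ m \<partial>\<mu>) \<le> sqrt h ^ m * normal_moment_constant m"
  using integrable_linear_functional[of "\<lambda>x. \<bar>x\<bar> ^ m" "axis j 1", unfolded axis_form diagonal mult_1_right]
    integral_linear_functional[of "\<lambda>x. \<bar>x\<bar> ^ m" "axis j 1", unfolded axis_form diagonal mult_1_right]
    centred_normal_law_abs_moment[OF h_pos, of m]
  by (simp_all add: inner_axis')

lemma coordinate_mean: "(\<integral>u. u $ j \<partial>\<mu>) = 0"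
  using integral_linear_functional[of "\<lambda>x. x" "axis j 1", unfolded axis_form diagonal mult_1_right]
    centred_normal_law_mean[OF h_pos]
  by (simp add: inner_axis')

lemma square_moment:
  "integrable \<mu> (\<lambda>u. (a \<bullet> u)\<^sup>2)" "(\<integral>u. (a \<bullet> u)\<^sup>2 \<partial>\<mu>) = a \<bullet> ((h *\<^sub>R \<Omega>) *v a)"
proof -
  have "0 \<le> a \<bullet> ((h *\<^sub>R \<Omega>) *v a)" using gaussian by (simp add: centred_gaussian_def)
  from centred_normal_law_square[OF this]
  show "integrable \<mu> (\<lambda>u. (a \<bullet> u)\<^sup>2)" "(\<integral>u. (a \<bullet> u)\<^sup>2 \<partial>\<mu>) = a \<bullet> ((h *\<^sub>R \<Omega>) *v a)"
    using integrable_linear_functional[of "\<lambda>x. x\<^sup>2" a] integral_linear_functional[of "\<lambda>x. x\<^sup>2" a] by simp_all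
qed

text \<open>The Gaussian law is given through linear functionals, so the mean of a product is
  recovered by polarization from the variances of two coordinates and of their sum.\<close>

lemma covariance:
  "integrable \<mu> (\<lambda>u. u $ j * u $ k)" "(\<integral>u. u $ j * u $ k \<partial>\<mu>) = h * \<Omega> $ j $ k"
proof -
  let ?s = "axis j 1 + axis k 1 :: real^'D"
  have eq: "u $ j * u $ k = ((?s \<bullet> u)\<^sup>2 - (axis j 1 \<bullet> u)\<^sup>2 - (axis k 1 \<bullet> u)\<^sup>2) / 2" for u :: "real^'D"
    by (simp add: inner_axis' inner_add_left power2_sum)
  show "integrable \<mu> (\<lambda>u. u $ j * u $ k)"
    unfolding eq by (intro integrable_divide Bochner_Integration.integrable_diff square_moment)
  have "(\<integral>u. u $ j * u $ k \<partial>\<mu>) = (?s \<bullet> ((h *\<^sub>R \<Omega>) *v ?s) - h - h) / 2"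
    unfolding eq using square_moment[of ?s] square_moment[of "axis j 1"] square_moment[of "axis k 1"]
    by (simp only: integral_divide_zero Bochner_Integration.integral_diff Bochner_Integration.integrable_diff axis_form diagonal mult_1_right)
  also have "?s \<bullet> ((h *\<^sub>R \<Omega>) *v ?s) = h + h + 2 * h * \<Omega> $ j $ k"
    unfolding matrix_vector_right_distrib inner_add_left inner_add_right axis_form
    by (simp add: diagonal symmetric[of k j])
  finally show "(\<integral>u. u $ j * u $ k \<partial>\<mu>) = h * \<Omega> $ j $ k" by simp
qed

lemma norm_moment:
  "integrable \<mu> (\<lambda>u. norm u ^ m)"
  "(\<integral>u. norm u ^ m \<partial>\<mu>) \<le> real CARD('D) ^ m * (real CARD('D) * normal_moment_constant m) * sqrt h ^ m"
proof -
  let ?g = "\<lambda>u. real CARD('D) ^ m * (\<Sum>j\<in>UNIV. \<bar>u $ j\<bar> ^ m)"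
  have g: "integrable \<mu> ?g" by (intro integrable_mult_right Bochner_Integration.integrable_sum coordinate_moment)
  show i: "integrable \<mu> (\<lambda>u. norm u ^ m)"
    by (rule Bochner_Integration.integrable_bound[OF g])
       (auto intro!: AE_I2 order_trans[OF power_norm_vec_le abs_ge_self] simp del: abs_mult)
  have "(\<integral>u. norm u ^ m \<partial>\<mu>) \<le> (\<integral>u. ?g u \<partial>\<mu>)" by (rule integral_mono[OF i g power_norm_vec_le])
  also have "\<dots> = real CARD('D) ^ m * (\<Sum>j\<in>UNIV. (\<integral>u. \<bar>u $ j\<bar> ^ m \<partial>\<mu>))"
    using coordinate_moment by (simp add: Bochner_Integration.integral_sum)
  also have "\<dots> \<le> real CARD('D) ^ m * (\<Sum>j\<in>(UNIV :: 'D set). sqrt h ^ m * normal_moment_constant m)"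
    by (intro mult_left_mono sum_mono coordinate_moment) auto
  finally show "(\<integral>u. norm u ^ m \<partial>\<mu>) \<le> real CARD('D) ^ m * (real CARD('D) * normal_moment_constant m) * sqrt h ^ m"
    by (simp add: mult_ac)
qed

lemma vector_mean: "(\<integral>u. u \<partial>\<mu>) = 0"
proof -
  have i: "integrable \<mu> (\<lambda>u. u)"
    by (rule Bochner_Integration.integrable_bound[OF norm_moment(1)[of 1]]) auto
  have "axis j 1 \<bullet> (\<integral>u. u \<partial>\<mu>) = 0" for j
    using integral_inner_left[OF i, of "axis j 1"] coordinate_mean[of j]
    by (simp add: inner_axis' inner_axis inner_commute)
  then show ?thesis by (simp add: vec_eq_iff inner_axis')
qed

end

section \<open>Lipschitz and Taylor bounds from bounded partial derivatives\<close>

definition grad :: "(real^'d \<Rightarrow> real) \<Rightarrow> real^'d \<Rightarrow> real^'d" where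
  "grad \<phi> x = (\<chi> l. partial_deriv l \<phi> x)"

text \<open>\<open>partial_deriv\<close> is a \<open>deriv\<close> along a line, which is
  informative only where that derivative exists. Total differentiability provides it and identifies
  it with the derivative on a basis vector.\<close>

lemma has_derivative_grad:
  fixes \<phi> :: "real^'d \<Rightarrow> real"
  assumes "\<phi> differentiable_on UNIV"
  shows "(\<phi> has_derivative (\<lambda>z. grad \<phi> x \<bullet> z)) (at x)"
proof -
  obtain D where D: "(\<phi> has_derivative D) (at x)"
    using assms by (auto simp: differentiable_on_def differentiable_def)
  interpret D: bounded_linear D using D by (rule has_derivative_bounded_linear)
  have partial: "partial_deriv l \<phi> x = D (axis l 1)" for l
  proof -
    have "((\<lambda>s. x + s *\<^sub>R axis l 1) has_derivative (\<lambda>s. s *\<^sub>R axis l 1)) (at 0)"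
      by (auto intro!: derivative_eq_intros)
    then have "((\<lambda>s. \<phi> (x + s *\<^sub>R axis l 1)) has_derivative (\<lambda>s. D (s *\<^sub>R axis l 1))) (at 0)"
      using D by (intro has_derivative_compose[of "\<lambda>s. x + s *\<^sub>R axis l 1" _ _ _ \<phi> D]) auto
    then have "((\<lambda>s. \<phi> (x + s *\<^sub>R axis l 1)) has_real_derivative D (axis l 1)) (at 0)"
      unfolding has_field_derivative_def
      by (rule has_derivative_eq_rhs) (simp add: fun_eq_iff D.scaleR mult.commute)
    then show ?thesis unfolding partial_deriv_def by (rule DERIV_imp_deriv)
  qed
  have "D z = grad \<phi> x \<bullet> z" for z
  proof -
    have "D z = D (\<Sum>l\<in>UNIV. (z $ l) *\<^sub>R axis l 1)"
      by (simp only: scalar_mult_eq_scaleR[symmetric] basis_expansion)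
    also have "\<dots> = grad \<phi> x \<bullet> z"
      by (simp add: D.sum D.scaleR inner_vec_def grad_def partial mult.commute)
    finally show ?thesis .
  qed
  then have "D = (\<lambda>z. grad \<phi> x \<bullet> z)" by auto
  with D show ?thesis by simp
qed

lemma norm_vec_le_CARD:
  fixes v :: "real^'d"
  assumes "\<And>i. \<bar>v $ i\<bar> \<le> C"
  shows "norm v \<le> real CARD('d) * C"
  using order_trans[OF norm_le_l1_cart sum_bounded_above[of UNIV "\<lambda>i. \<bar>v $ i\<bar>" C]] assms by simp

lemma bounded_first_partials_lipschitz:
  fixes \<phi> :: "real^'d \<Rightarrow> real"
  assumes "\<phi> differentiable_on UNIV" "bounded_first_partials \<phi> K"
  shows "norm (grad \<phi> x) \<le> real CARD('d) * K" "\<bar>\<phi> x - \<phi> y\<bar> \<le> real CARD('d) * K * norm (x - y)"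
proof -
  show g: "norm (grad \<phi> x) \<le> real CARD('d) * K" for x
    using assms(2) by (intro norm_vec_le_CARD) (simp add: grad_def bounded_first_partials_def)
  have "norm (\<phi> x - \<phi> y) \<le> (real CARD('d) * K) * norm (x - y)"
  proof (rule differentiable_bound[OF convex_UNIV])
    show "(\<phi> has_derivative (\<lambda>z. grad \<phi> x \<bullet> z)) (at x within UNIV)" for x
      using has_derivative_grad[OF assms(1)] by simp
    show "onorm (\<lambda>z. grad \<phi> x \<bullet> z) \<le> real CARD('d) * K" for x
    proof (rule onorm_le)
      fix z
      have "\<bar>grad \<phi> x \<bullet> z\<bar> \<le> norm (grad \<phi> x) * norm z" by (rule Cauchy_Schwarz_ineq2)
      also have "\<dots> \<le> real CARD('d) * K * norm z" by (rule mult_right_mono[OF g]) simp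
      finally show "norm (grad \<phi> x \<bullet> z) \<le> real CARD('d) * K * norm z" by simp
    qed
  qed auto
  then show "\<bar>\<phi> x - \<phi> y\<bar> \<le> real CARD('d) * K * norm (x - y)" by simp
qed

text \<open>The components of the gradient have bounded partial derivatives, so the gradient is
  Lipschitz, and the linearization error is its oscillation on a ball times the distance. The
  dimension enters once through a component and once through the vector norm.\<close>

lemma bounded_second_partials_taylor:
  fixes \<phi> :: "real^'d \<Rightarrow> real"
  assumes \<phi>: "C2 \<phi>" "bounded_second_partials \<phi> K"
  shows "\<bar>\<phi> y - \<phi> x - grad \<phi> x \<bullet> (y - x)\<bar> \<le> (real CARD('d))\<^sup>2 * K * (norm (y - x))\<^sup>2"
proof -
  let ?d = "real CARD('d)"
  have grad_lip: "norm (grad \<phi> a - grad \<phi> b) \<le> ?d * (?d * K * norm (a - b))" for a b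
  proof (rule norm_vec_le_CARD)
    fix l
    show "\<bar>(grad \<phi> a - grad \<phi> b) $ l\<bar> \<le> ?d * K * norm (a - b)"
      unfolding grad_def using \<phi>
      by (auto simp: C2_def C1_def bounded_first_partials_def bounded_second_partials_def
          intro!: bounded_first_partials_lipschitz(2))
  qed
  have "norm (\<phi> y - \<phi> x - grad \<phi> x \<bullet> (y - x)) \<le> norm (y - x) * (?d * (?d * K * norm (y - x)))"
  proof (rule differentiable_bound_linearization[where S = "cball x (norm (y - x))"
      and f' = "\<lambda>z h. grad \<phi> z \<bullet> h" and ?x0.0 = x and f = \<phi> and a = x and b = y])
    fix t :: real assume "t \<in> {0..1}"
    then show "x + t *\<^sub>R (y - x) \<in> cball x (norm (y - x))"
      by (simp add: dist_norm mult_left_le_one_le)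
  next
    fix z
    show "(\<phi> has_derivative (\<lambda>h. grad \<phi> z \<bullet> h)) (at z within cball x (norm (y - x)))"
      by (rule has_derivative_at_withinI[OF has_derivative_grad]) (use \<phi> in \<open>simp add: C2_def C1_def\<close>)
    assume z: "z \<in> cball x (norm (y - x))"
    \<comment> \<open>Any instance of the bound shows that \<open>K\<close> is nonnegative.\<close>
    have "\<bar>partial_deriv undefined (partial_deriv undefined \<phi>) x\<bar> \<le> K"
      using \<phi>(2) by (simp add: bounded_second_partials_def)
    then have K: "0 \<le> K" by linarith
    have "onorm ((\<lambda>h. grad \<phi> z \<bullet> h) - (\<lambda>h. grad \<phi> x \<bullet> h)) \<le> norm (grad \<phi> z - grad \<phi> x)"
      by (rule onorm_le) (simp add: inner_diff_left[symmetric] Cauchy_Schwarz_ineq2)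
    also have "\<dots> \<le> ?d * (?d * K * norm (z - x))" by (rule grad_lip)
    also have "\<dots> \<le> ?d * (?d * K * norm (y - x))"
      using z K by (intro mult_left_mono) (auto simp: dist_norm norm_minus_commute)
    finally show "onorm ((\<lambda>h. grad \<phi> z \<bullet> h) - (\<lambda>h. grad \<phi> x \<bullet> h)) \<le> ?d * (?d * K * norm (y - x))" .
  qed auto
  then show ?thesis by (simp add: power2_eq_square mult_ac)
qed

section \<open>The abstract coefficients realised by the Milstein scheme\<close>

definition jacobian :: "(real^'d \<Rightarrow> real^'d) \<Rightarrow> real^'d \<Rightarrow> real^'d \<Rightarrow> real^'d" where
  "jacobian f x z = (\<chi> i. grad (\<lambda>y. f y $ i) x \<bullet> z)"

definition diffusion_derivative :: "(real^'d \<Rightarrow> real^'D^'d) \<Rightarrow> real^'d \<Rightarrow> real^'d \<Rightarrow> real^'D \<Rightarrow> real^'d" where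
  "diffusion_derivative g x z u = (\<chi> i. \<Sum>j\<in>UNIV. (grad (\<lambda>y. g y $ i $ j) x \<bullet> z) * u $ j)"

definition milstein_vector :: "(real^'d \<Rightarrow> real^'D^'d) \<Rightarrow> 'D \<Rightarrow> 'D \<Rightarrow> real^'d \<Rightarrow> real^'d" where
  "milstein_vector g j k x = (\<chi> i. milstein_h g i j k x)"

text \<open>The first argument carries the index of the differentiated column, the second that of
  the column giving the direction. In general the form is not symmetric, and this is where the Levy
  term comes from.\<close>

definition milstein_bilinear :: "(real^'d \<Rightarrow> real^'D^'d) \<Rightarrow> real^'d \<Rightarrow> real^'D \<Rightarrow> real^'D \<Rightarrow> real^'d" where
  "milstein_bilinear g x u v = (\<Sum>j\<in>UNIV. \<Sum>k\<in>UNIV. (u $ j * v $ k) *\<^sub>R milstein_vector g j k x)"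

text \<open>The mean of the quadratic noise per unit time.\<close>

definition milstein_correction :: "(real^'d \<Rightarrow> real^'D^'d) \<Rightarrow> real^'D^'D \<Rightarrow> real^'d \<Rightarrow> real^'d" where
  "milstein_correction g \<Omega> x = (\<Sum>j\<in>UNIV. \<Sum>k\<in>UNIV. \<Omega> $ j $ k *\<^sub>R milstein_vector g j k x)"

lemma norm_rows_le:
  fixes u :: "real^'D" and a :: "'d::finite \<Rightarrow> 'D \<Rightarrow> real"
  assumes "\<And>i j. \<bar>a i j\<bar> \<le> C"
  shows "norm (\<chi> i. \<Sum>j\<in>UNIV. a i j * u $ j) \<le> real CARD('d) * real CARD('D) * C * norm u"
proof -
  have "\<bar>\<Sum>j\<in>UNIV. a i j * u $ j\<bar> \<le> real CARD('D) * (C * norm u)" for i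
  proof -
    have "\<bar>\<Sum>j\<in>UNIV. a i j * u $ j\<bar> \<le> (\<Sum>j\<in>UNIV. \<bar>a i j * u $ j\<bar>)" by (rule sum_abs)
    also have "\<dots> \<le> (\<Sum>j\<in>(UNIV :: 'D set). C * norm u)"
      unfolding abs_mult using assms order_trans[OF abs_ge_zero assms]
      by (intro sum_mono mult_mono component_le_norm_cart) auto
    finally show ?thesis by simp
  qed
  then have "norm (\<chi> i. \<Sum>j\<in>UNIV. a i j * u $ j) \<le> real CARD('d) * (real CARD('D) * (C * norm u))"
    by (intro norm_vec_le_CARD) simp
  then show ?thesis by (simp add: mult.assoc)
qed

lemma norm_bilinear_sum_le:
  fixes u v :: "real^'D" and p :: "'D \<Rightarrow> 'D \<Rightarrow> 'e::real_normed_vector"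
  assumes "\<And>j k. norm (p j k) \<le> C"
  shows "norm (\<Sum>j\<in>UNIV. \<Sum>k\<in>UNIV. (u $ j * v $ k) *\<^sub>R p j k) \<le> (real CARD('D))\<^sup>2 * C * norm u * norm v"
proof -
  have "norm (\<Sum>j\<in>UNIV. \<Sum>k\<in>UNIV. (u $ j * v $ k) *\<^sub>R p j k)
      \<le> (\<Sum>j\<in>UNIV. \<Sum>k\<in>UNIV. norm ((u $ j * v $ k) *\<^sub>R p j k))"
    by (intro order_trans[OF norm_sum sum_mono] norm_sum)
  also have "\<dots> \<le> (\<Sum>j\<in>(UNIV :: 'D set). \<Sum>k\<in>(UNIV :: 'D set). (norm u * norm v) * C)"
    unfolding norm_scaleR abs_mult
    by (intro sum_mono mult_mono component_le_norm_cart assms) auto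
  finally show ?thesis by (simp add: power2_eq_square mult_ac)
qed

lemma norm_weighted_sum_le:
  fixes \<Omega> :: "real^'D^'D" and p :: "'D \<Rightarrow> 'D \<Rightarrow> 'e::real_normed_vector"
  assumes "\<And>j k. norm (p j k) \<le> C"
  shows "norm (\<Sum>j\<in>UNIV. \<Sum>k\<in>UNIV. \<Omega> $ j $ k *\<^sub>R p j k) \<le> (\<Sum>j\<in>UNIV. \<Sum>k\<in>UNIV. \<bar>\<Omega> $ j $ k\<bar>) * C"
proof -
  have "norm (\<Sum>j\<in>UNIV. \<Sum>k\<in>UNIV. \<Omega> $ j $ k *\<^sub>R p j k)
      \<le> (\<Sum>j\<in>UNIV. \<Sum>k\<in>UNIV. norm (\<Omega> $ j $ k *\<^sub>R p j k))"
    by (intro order_trans[OF norm_sum sum_mono] norm_sum)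
  also have "\<dots> \<le> (\<Sum>j\<in>UNIV. \<Sum>k\<in>UNIV. \<bar>\<Omega> $ j $ k\<bar> * C)"
    unfolding norm_scaleR by (intro sum_mono mult_left_mono assms) auto
  finally show ?thesis by (simp add: sum_distrib_right)
qed

lemma milstein_h_differentiable:
  assumes "\<And>i j. C2 (\<lambda>x. g x $ i $ j)"
  shows "milstein_h g i j k differentiable_on UNIV"
  using assms unfolding milstein_h_def[abs_def] differentiable_on_def
  by (auto simp: C2_def C1_def differentiable_on_def intro!: differentiable_mult differentiable_sum)

text \<open>Exchanging the sum over the components of the direction with the sum over the columns of
  \<open>g\<close> reproduces the sum in \<open>milstein_h\<close>; the 2 removes its one
  half.\<close>

lemma diffusion_derivative_diffusion:
  "diffusion_derivative g x (g x *v u) v = 2 *\<^sub>R milstein_bilinear g x v u"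
proof -
  have "(\<Sum>j\<in>UNIV. (\<Sum>l\<in>UNIV. partial_deriv l (\<lambda>y. g y $ i $ j) x * (\<Sum>k\<in>UNIV. g x $ l $ k * u $ k)) * v $ j)
      = 2 * (\<Sum>j\<in>UNIV. \<Sum>k\<in>UNIV. (v $ j * u $ k) * milstein_h g i j k x)" for i
  proof -
    have "(\<Sum>l\<in>UNIV. partial_deriv l (\<lambda>y. g y $ i $ j) x * (\<Sum>k\<in>UNIV. g x $ l $ k * u $ k)) * v $ j
      = 2 * (\<Sum>k\<in>UNIV. (v $ j * u $ k) * milstein_h g i j k x)" for j
    proof -
      have "(\<Sum>l\<in>UNIV. partial_deriv l (\<lambda>y. g y $ i $ j) x * (\<Sum>k\<in>UNIV. g x $ l $ k * u $ k)) * v $ j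
        = (\<Sum>l\<in>UNIV. \<Sum>k\<in>UNIV. v $ j * u $ k * (g x $ l $ k * partial_deriv l (\<lambda>y. g y $ i $ j) x))"
        by (simp add: sum_distrib_left sum_distrib_right mult_ac)
      also have "\<dots> = (\<Sum>k\<in>UNIV. \<Sum>l\<in>UNIV. v $ j * u $ k * (g x $ l $ k * partial_deriv l (\<lambda>y. g y $ i $ j) x))"
        by (rule sum.swap)
      also have "\<dots> = (\<Sum>k\<in>UNIV. 2 * ((v $ j * u $ k) * milstein_h g i j k x))"
        by (simp add: milstein_h_def sum_distrib_left)
      finally show ?thesis by (simp add: sum_distrib_left)
    qed
    then show ?thesis by (simp add: sum_distrib_left)
  qed
  then show ?thesis
    by (simp add: vec_eq_iff diffusion_derivative_def milstein_bilinear_def milstein_vector_def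
        grad_def inner_vec_def matrix_vector_mult_def)
qed

text \<open>All hypotheses on the coefficients are absorbed into one constant, which also dominates
  the square root \<open>r\<close> of the time horizon.\<close>

lemma milstein_coefficients_exists:
  fixes f :: "real^'d \<Rightarrow> real^'d" and g :: "real^'d \<Rightarrow> real^'D^'d" and \<Omega> :: "real^'D^'D"
  assumes f: "\<And>i. C2 (\<lambda>x. f x $ i)" and g: "\<And>i j. C2 (\<lambda>x. g x $ i $ j)"
    and bounded: "bounded_coefficient_derivs f g" and "0 \<le> r"
  shows "\<exists>K\<ge>r. milstein_coefficients f (jacobian f) (\<lambda>x u. g x *v u) (diffusion_derivative g)
    (milstein_bilinear g) (milstein_correction g \<Omega>) K"
proof -
  obtain K0 where
    f1: "\<And>i. bounded_first_partials (\<lambda>x. f x $ i) K0" and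
    f2: "\<And>i. bounded_second_partials (\<lambda>x. f x $ i) K0" and
    g1: "\<And>i j. bounded_first_partials (\<lambda>x. g x $ i $ j) K0" and
    g2: "\<And>i j. bounded_second_partials (\<lambda>x. g x $ i $ j) K0" and
    h1: "\<And>i j k. bounded_first_partials (milstein_h g i j k) K0"
    using bounded unfolding bounded_coefficient_derivs_def by blast
  let ?d = "real CARD('d)" and ?D = "real CARD('D)"
  have d: "1 \<le> ?d" "1 \<le> ?D" by (auto simp: Suc_leI)
  have "\<bar>partial_deriv undefined (\<lambda>x. f x $ undefined) 0\<bar> \<le> K0"
    using f1 by (auto simp: bounded_first_partials_def)
  then have K0: "0 \<le> K0" by linarith
  \<comment> \<open>\<open>b\<close> dominates all coefficient values at 0 as well as the Lipschitz
    and Taylor constants, so linear growth follows from the Lipschitz bound.\<close>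
  define b where "b = (\<Sum>i\<in>UNIV. \<bar>f 0 $ i\<bar>) + (\<Sum>i\<in>UNIV. \<Sum>j\<in>UNIV. \<bar>g 0 $ i $ j\<bar>)
     + (\<Sum>i\<in>UNIV. \<Sum>j\<in>UNIV. \<Sum>k\<in>UNIV. \<bar>milstein_h g i j k 0\<bar>) + ?d\<^sup>2 * K0"
  have sums: "0 \<le> (\<Sum>i\<in>UNIV. \<bar>f 0 $ i\<bar>)" "0 \<le> (\<Sum>i\<in>UNIV. \<Sum>j\<in>UNIV. \<bar>g 0 $ i $ j\<bar>)"
    "0 \<le> (\<Sum>i\<in>UNIV. \<Sum>j\<in>UNIV. \<Sum>k\<in>UNIV. \<bar>milstein_h g i j k 0\<bar>)" "0 \<le> ?d\<^sup>2 * K0"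
    using K0 by (auto intro!: sum_nonneg)
  have b_d2: "?d\<^sup>2 * K0 \<le> b" using sums unfolding b_def by linarith
  have "?d * K0 \<le> ?d\<^sup>2 * K0" using d K0 by (intro mult_right_mono self_le_power) auto
  then have b_d: "?d * K0 \<le> b" using b_d2 by linarith
  have b0: "0 \<le> b" using sums b_d2 by linarith
  have f0: "\<bar>f 0 $ i\<bar> \<le> b" for i
  proof -
    have "\<bar>f 0 $ i\<bar> \<le> (\<Sum>i\<in>UNIV. \<bar>f 0 $ i\<bar>)" by (rule member_le_sum) auto
    then show ?thesis using sums unfolding b_def by linarith
  qed
  have g0: "\<bar>g 0 $ i $ j\<bar> \<le> b" for i j
  proof -
    have "\<bar>g 0 $ i $ j\<bar> \<le> (\<Sum>j\<in>UNIV. \<bar>g 0 $ i $ j\<bar>)" by (rule member_le_sum) auto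
    also have "\<dots> \<le> (\<Sum>i\<in>UNIV. \<Sum>j\<in>UNIV. \<bar>g 0 $ i $ j\<bar>)"
      by (rule member_le_sum) (auto intro: sum_nonneg)
    finally show ?thesis using sums unfolding b_def by linarith
  qed
  have h0: "\<bar>milstein_h g i j k 0\<bar> \<le> b" for i j k
  proof -
    have "\<bar>milstein_h g i j k 0\<bar> \<le> (\<Sum>k\<in>UNIV. \<bar>milstein_h g i j k 0\<bar>)" by (rule member_le_sum) auto
    also have "\<dots> \<le> (\<Sum>j\<in>UNIV. \<Sum>k\<in>UNIV. \<bar>milstein_h g i j k 0\<bar>)"
      by (rule member_le_sum) (auto intro: sum_nonneg)
    also have "\<dots> \<le> (\<Sum>i\<in>UNIV. \<Sum>j\<in>UNIV. \<Sum>k\<in>UNIV. \<bar>milstein_h g i j k 0\<bar>)"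
      by (rule member_le_sum) (auto intro: sum_nonneg)
    finally show ?thesis using sums unfolding b_def by linarith
  qed
  have lip: "\<bar>\<phi> x - \<phi> y\<bar> \<le> b * norm (x - y)"
    if "\<phi> differentiable_on UNIV" "bounded_first_partials \<phi> K0" for \<phi> :: "real^'d \<Rightarrow> real" and x y
    by (rule order_trans[OF bounded_first_partials_lipschitz(2)[OF that] mult_right_mono[OF b_d]]) simp
  have grow: "\<bar>\<phi> x\<bar> \<le> b * (1 + norm x)"
    if "\<phi> differentiable_on UNIV" "bounded_first_partials \<phi> K0" "\<bar>\<phi> 0\<bar> \<le> b" for \<phi> :: "real^'d \<Rightarrow> real" and x
    using lip[OF that(1,2), of x 0] that(3) by (simp add: distrib_left)
  have grad: "\<bar>grad \<phi> x \<bullet> z\<bar> \<le> b * norm z"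
    if "\<phi> differentiable_on UNIV" "bounded_first_partials \<phi> K0" for \<phi> :: "real^'d \<Rightarrow> real" and x z
    by (rule order_trans[OF Cauchy_Schwarz_ineq2 mult_right_mono])
       (use bounded_first_partials_lipschitz(1)[OF that, of x] b_d in auto)
  have taylor: "\<bar>\<phi> y - \<phi> x - grad \<phi> x \<bullet> (y - x)\<bar> \<le> b * (norm (y - x))\<^sup>2"
    if "C2 \<phi>" "bounded_second_partials \<phi> K0" for \<phi> :: "real^'d \<Rightarrow> real" and x y
    by (rule order_trans[OF bounded_second_partials_taylor[OF that] mult_right_mono[OF b_d2]]) simp
  have fd: "(\<lambda>x. f x $ i) differentiable_on UNIV" and gd: "(\<lambda>x. g x $ i $ j) differentiable_on UNIV" for i j
    using f g by (auto simp: C2_def C1_def)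
  note hd = milstein_h_differentiable[OF g]
  define S where "S = (\<Sum>j\<in>UNIV. \<Sum>k\<in>UNIV. \<bar>\<Omega> $ j $ k\<bar>)"
  have S: "0 \<le> S" unfolding S_def by (intro sum_nonneg) auto
  \<comment> \<open>The summands are the factors that arise when scalar bounds pass to vectors,
    matrices, bilinear forms and the contraction with \<open>\<Omega>\<close>. All are nonnegative,
    so their sum dominates each of them.\<close>
  define K where "K = 1 + r + ?d * b * (1 + ?D + ?D\<^sup>2 + S)"
  have K_split: "K = 1 + r + ?d * b + ?d * ?D * b + ?D\<^sup>2 * (?d * b) + S * (?d * b)"
    by (simp add: K_def algebra_simps)
  have parts: "0 \<le> ?d * b" "0 \<le> ?d * ?D * b" "0 \<le> ?D\<^sup>2 * (?d * b)" "0 \<le> S * (?d * b)"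
    using b0 S by auto
  have K: "1 \<le> K" "r \<le> K" "?d * b \<le> K" "?d * ?D * b \<le> K" "?D\<^sup>2 * (?d * b) \<le> K" "S * (?d * b) \<le> K"
    using parts \<open>0 \<le> r\<close> unfolding K_split by linarith+
  have vec_K: "norm v \<le> K * q" if "\<And>i. \<bar>v $ i\<bar> \<le> b * q" "0 \<le> q" for v :: "real^'d" and q
    using order_trans[OF norm_vec_le_CARD[OF that(1)]] mult_right_mono[OF K(3) that(2)] by (simp add: mult.assoc)
  have rows_K: "norm (\<chi> i. \<Sum>j\<in>UNIV. a i j * u $ j) \<le> K * q * norm u"
    if "\<And>i j. \<bar>a i j\<bar> \<le> b * q" "0 \<le> q" for a :: "'d \<Rightarrow> 'D \<Rightarrow> real" and u :: "real^'D" and q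
  proof -
    have "norm (\<chi> i. \<Sum>j\<in>UNIV. a i j * u $ j) \<le> ?d * ?D * (b * q) * norm u" by (rule norm_rows_le[OF that(1)])
    also have "\<dots> = (?d * ?D * b) * q * norm u" by simp
    also have "\<dots> \<le> K * q * norm u" by (intro mult_right_mono K that) auto
    finally show ?thesis .
  qed
  have h_grow: "norm (milstein_vector g j k x) \<le> ?d * (b * (1 + norm x))" for j k x
    by (rule norm_vec_le_CARD) (simp add: milstein_vector_def grow[OF hd h1 h0])
  have h_lip: "norm (milstein_vector g j k x - milstein_vector g j k y) \<le> ?d * (b * norm (x - y))" for j k x y
    by (rule norm_vec_le_CARD) (simp add: milstein_vector_def lip[OF hd h1])
  have h_cont: "continuous_on UNIV (milstein_vector g j k)" for j k
    by (rule lipschitz_on_continuous_on[OF lipschitz_onI[of _ _ "?d * b"]])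
       (use h_lip parts in \<open>auto simp: dist_norm mult.assoc\<close>)
  have "milstein_coefficients f (jacobian f) (\<lambda>x u. g x *v u) (diffusion_derivative g)
    (milstein_bilinear g) (milstein_correction g \<Omega>) K"
  proof (rule milstein_coefficients.intro)
    show "1 \<le> K" by fact
    show "norm (f x) \<le> K * (1 + norm x)" for x
      by (rule vec_K[OF grow[OF fd f1 f0]]) simp
    show "norm (f x - f y) \<le> K * norm (x - y)" for x y
      by (rule vec_K) (use lip[OF fd f1] in auto)
    show "norm (f y - f x - jacobian f x (y - x)) \<le> K * (norm (y - x))\<^sup>2" for x y
      by (rule vec_K) (use taylor[OF f f2] in \<open>auto simp: jacobian_def\<close>)
    show "linear (jacobian f x)" for x
      by (rule linearI) (auto simp: jacobian_def vec_eq_iff inner_add_right)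
    show "norm (jacobian f x z) \<le> K * norm z" for x z
      by (rule vec_K) (use grad[OF fd f1] in \<open>auto simp: jacobian_def\<close>)
    show "linear (\<lambda>u. g x *v u)" for x by simp
    show "norm (g x *v u) \<le> K * (1 + norm x) * norm u" for x u
      unfolding matrix_vector_mult_def by (rule rows_K[OF grow[OF gd g1 g0]]) simp
    show "norm (g x *v u - g y *v u) \<le> K * norm (x - y) * norm u" for x y u
    proof -
      have "g x *v u - g y *v u = (\<chi> i. \<Sum>j\<in>UNIV. (g x $ i $ j - g y $ i $ j) * u $ j)"
        by (simp add: vec_eq_iff matrix_vector_mult_def left_diff_distrib sum_subtractf)
      then show ?thesis by (simp only:) (rule rows_K[OF lip[OF gd g1]], simp)
    qed
    show "norm (g y *v u - g x *v u - diffusion_derivative g x (y - x) u) \<le> K * (norm (y - x))\<^sup>2 * norm u" for x y u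
    proof -
      have "g y *v u - g x *v u - diffusion_derivative g x (y - x) u
        = (\<chi> i. \<Sum>j\<in>UNIV. (g y $ i $ j - g x $ i $ j - grad (\<lambda>y. g y $ i $ j) x \<bullet> (y - x)) * u $ j)"
        by (simp add: vec_eq_iff matrix_vector_mult_def diffusion_derivative_def left_diff_distrib sum_subtractf)
      then show ?thesis by (simp only:) (rule rows_K[OF taylor[OF g g2]], simp)
    qed
    show "linear (\<lambda>z. diffusion_derivative g x z u)" for x u
      by (rule linearI)
         (auto simp: diffusion_derivative_def vec_eq_iff inner_add_right distrib_right sum.distrib sum_distrib_left mult.assoc)
    show "norm (diffusion_derivative g x z u) \<le> K * norm z * norm u" for x z u
      unfolding diffusion_derivative_def by (rule rows_K[OF grad[OF gd g1]]) simp
    show "diffusion_derivative g x (g x *v u) v = 2 *\<^sub>R milstein_bilinear g x v u" for x u v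
      by (rule diffusion_derivative_diffusion)
    show "bilinear (milstein_bilinear g x)" for x
      unfolding bilinear_def milstein_bilinear_def
      by (auto intro!: linearI simp: distrib_left distrib_right scaleR_add_left sum.distrib scaleR_sum_right mult_ac)
    show "norm (milstein_bilinear g x u v) \<le> K * (1 + norm x) * norm u * norm v" for x u v
    proof -
      have "norm (milstein_bilinear g x u v) \<le> ?D\<^sup>2 * (?d * (b * (1 + norm x))) * norm u * norm v"
        unfolding milstein_bilinear_def by (rule norm_bilinear_sum_le[OF h_grow])
      also have "\<dots> = (?D\<^sup>2 * (?d * b)) * (1 + norm x) * norm u * norm v" by simp
      also have "\<dots> \<le> K * (1 + norm x) * norm u * norm v" by (intro mult_right_mono K) auto
      finally show ?thesis .
    qed
    show "norm (milstein_bilinear g x u v - milstein_bilinear g y u v) \<le> K * norm (x - y) * norm u * norm v" for x y u v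
    proof -
      have "milstein_bilinear g x u v - milstein_bilinear g y u v
        = (\<Sum>j\<in>UNIV. \<Sum>k\<in>UNIV. (u $ j * v $ k) *\<^sub>R (milstein_vector g j k x - milstein_vector g j k y))"
        by (simp add: milstein_bilinear_def scaleR_diff_right sum_subtractf)
      then have "norm (milstein_bilinear g x u v - milstein_bilinear g y u v)
        \<le> ?D\<^sup>2 * (?d * (b * norm (x - y))) * norm u * norm v"
        by (simp only:) (rule norm_bilinear_sum_le[OF h_lip])
      also have "\<dots> = (?D\<^sup>2 * (?d * b)) * norm (x - y) * norm u * norm v" by simp
      also have "\<dots> \<le> K * norm (x - y) * norm u * norm v" by (intro mult_right_mono K) auto
      finally show ?thesis .
    qed
    show "norm (milstein_correction g \<Omega> x) \<le> K * (1 + norm x)" for x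
    proof -
      have "norm (milstein_correction g \<Omega> x) \<le> S * (?d * (b * (1 + norm x)))"
        unfolding milstein_correction_def S_def by (rule norm_weighted_sum_le[OF h_grow])
      also have "\<dots> = (S * (?d * b)) * (1 + norm x)" by simp
      also have "\<dots> \<le> K * (1 + norm x)" by (intro mult_right_mono K) auto
      finally show ?thesis .
    qed
    show "norm (milstein_correction g \<Omega> x - milstein_correction g \<Omega> y) \<le> K * norm (x - y)" for x y
    proof -
      have "milstein_correction g \<Omega> x - milstein_correction g \<Omega> y
        = (\<Sum>j\<in>UNIV. \<Sum>k\<in>UNIV. \<Omega> $ j $ k *\<^sub>R (milstein_vector g j k x - milstein_vector g j k y))"
        by (simp add: milstein_correction_def scaleR_diff_right sum_subtractf)
      then have "norm (milstein_correction g \<Omega> x - milstein_correction g \<Omega> y) \<le> S * (?d * (b * norm (x - y)))"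
        unfolding S_def by (simp only:) (rule norm_weighted_sum_le[OF h_lip])
      also have "\<dots> = (S * (?d * b)) * norm (x - y)" by simp
      also have "\<dots> \<le> K * norm (x - y)" by (intro mult_right_mono K) auto
      finally show ?thesis .
    qed
    have gij: "continuous_on UNIV (\<lambda>p :: (real^'d) \<times> (real^'D). g (fst p) $ i $ j)" for i j
      by (rule continuous_on_compose2[OF differentiable_imp_continuous_on[OF gd] continuous_on_fst[OF continuous_on_id]]) auto
    show "continuous_on UNIV (\<lambda>(x, u). g x *v u)"
      unfolding matrix_vector_mult_def case_prod_unfold
      by (intro continuous_on_vec_lambda continuous_on_sum continuous_on_mult gij continuous_intros)
    have hjk: "continuous_on UNIV (\<lambda>p :: (real^'d) \<times> (real^'D). milstein_vector g j k (fst p))" for j k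
      by (rule continuous_on_compose2[OF h_cont continuous_on_fst[OF continuous_on_id]]) auto
    show "continuous_on UNIV (\<lambda>(x, u). milstein_bilinear g x u u)"
      unfolding milstein_bilinear_def case_prod_unfold
      by (intro continuous_on_sum continuous_on_scaleR hjk continuous_intros)
  qed
  with K(2) show ?thesis by blast
qed

section \<open>The variance bound\<close>

lemma integral_milstein_bilinear:
  assumes "gaussian_increment \<mu> h \<Omega>"
  shows "(\<integral>u. milstein_bilinear g x u u \<partial>\<mu>) = h *\<^sub>R milstein_correction g \<Omega> x"
proof -
  interpret gaussian_increment \<mu> h \<Omega> by fact
  have i: "integrable \<mu> (\<lambda>u. (u $ j * u $ k) *\<^sub>R milstein_vector g j k x)" for j k
    by (rule integrable_scaleR_left[OF covariance(1)])
  have "(\<integral>u. milstein_bilinear g x u u \<partial>\<mu>)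
    = (\<Sum>j\<in>UNIV. \<Sum>k\<in>UNIV. (\<integral>u. (u $ j * u $ k) *\<^sub>R milstein_vector g j k x \<partial>\<mu>))"
    unfolding milstein_bilinear_def using i by (simp add: Bochner_Integration.integral_sum)
  also have "\<dots> = h *\<^sub>R milstein_correction g \<Omega> x"
    using covariance by (simp add: milstein_correction_def scaleR_sum_right)
  finally show ?thesis .
qed

text \<open>It depends on the dimension and the order only: the coordinates have unit variance per
  unit time, and the powers of the step size are split off.\<close>

definition gaussian_moment_bound :: "nat \<Rightarrow> nat \<Rightarrow> real" where
  "gaussian_moment_bound D m = real D ^ m * (real D * normal_moment_constant m)"

lemma (in correlated_brownian_motion) gaussian_increment_increment:
  assumes "0 \<le> r" "0 < h"
  shows "gaussian_increment (distr M borel (\<lambda>\<omega>. w (r + h) \<omega> - w r \<omega>)) h \<Omega>"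
proof -
  have W: "random_variable borel (\<lambda>\<omega>. w (r + h) \<omega> - w r \<omega>)"
    by (rule measurable_F_M[OF _ increment_measurable]) (use assms in auto)
  interpret W: prob_space "distr M borel (\<lambda>\<omega>. w (r + h) \<omega> - w r \<omega>)"
    by (rule prob_space_distr[OF W])
  show ?thesis
    by unfold_locales (use increment_law[of r "r + h"] assms unit_diagonal in auto)
qed

section \<open>The concrete scheme as an instance of the abstract step\<close>

context
  fixes f :: "real^'d \<Rightarrow> real^'d" and g :: "real^'d \<Rightarrow> real^'D^'d" and \<Omega> :: "real^'D^'D" and K :: real
  assumes coefficients: "milstein_coefficients f (jacobian f) (\<lambda>x u. g x *v u) (diffusion_derivative g)
    (milstein_bilinear g) (milstein_correction g \<Omega>) K"
begin

interpretation milstein_coefficients f "jacobian f" "\<lambda>x u. g x *v u" "diffusion_derivative g"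
    "milstein_bilinear g" "milstein_correction g \<Omega>" K
  by (rule coefficients)

lemma milstein_step_eq: "milstein_step f g \<Omega> x \<tau> u = step \<tau> x u"
  unfolding step_def
  by (simp add: milstein_step_def vec_eq_iff matrix_vector_mult_def milstein_bilinear_def
      milstein_correction_def milstein_vector_def right_diff_distrib sum_subtractf sum_distrib_left mult_ac)

lemma gaussian_increment_law:
  fixes \<mu> :: "(real^'D) measure"
  assumes gi: "gaussian_increment \<mu> (s\<^sup>2 / 2) \<Omega>" and s: "0 < s"
  shows "increment_law s (gaussian_moment_bound CARD('D)) \<mu>"
proof -
  interpret gaussian_increment \<mu> "s\<^sup>2 / 2" \<Omega> by (rule gi)
  have "(\<integral>u. norm u ^ m \<partial>\<mu>) \<le> gaussian_moment_bound CARD('D) m * s ^ m" for m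
  proof -
    have "sqrt (s\<^sup>2 / 2) \<le> s" using s by (intro real_le_lsqrt) auto
    then have "sqrt (s\<^sup>2 / 2) ^ m \<le> s ^ m" by (intro power_mono) auto
    moreover have "0 \<le> gaussian_moment_bound CARD('D) m"
      by (simp add: gaussian_moment_bound_def normal_moment_constant_def)
    ultimately have "gaussian_moment_bound CARD('D) m * sqrt (s\<^sup>2 / 2) ^ m \<le> gaussian_moment_bound CARD('D) m * s ^ m"
      by (rule mult_left_mono)
    with norm_moment(2)[of m] show ?thesis unfolding gaussian_moment_bound_def by linarith
  qed
  then show ?thesis
    unfolding increment_law_def
    using prob_space_axioms vector_mean norm_moment(1) integral_milstein_bilinear[OF gi] by auto
qed

lemma milstein_brownian:
  assumes "correlated_brownian_motion M F w \<Omega>"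
  shows "milstein_brownian f (jacobian f) (\<lambda>x u. g x *v u) (diffusion_derivative g)
    (milstein_bilinear g) (milstein_correction g \<Omega>) K M F w \<Omega> (gaussian_moment_bound CARD('D))"
proof -
  interpret correlated_brownian_motion M F w \<Omega> by fact
  show ?thesis
    by unfold_locales (auto intro!: gaussian_increment_law gaussian_increment_increment)
qed

lemma antithetic_paths_Suc:
  fixes x0 :: "real^'d" and W :: "real \<Rightarrow> real^'D" and dt :: real
  defines "Z \<equiv> \<lambda>n. (coarse_path f g \<Omega> x0 dt W n, fine_path f g \<Omega> x0 dt W n, antithetic_path f g \<Omega> x0 dt W n)"
  shows "Z (Suc n) = antithetic_step dt (Z n) (W ((real n + 1 / 2) * dt) - W (real n * dt))
     (W (real (n + 1) * dt) - W ((real n + 1 / 2) * dt))"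
  by (simp add: Z_def antithetic_step_def two_step_def milstein_step_eq first_half_increment_def
      second_half_increment_def)

end

text \<open>Both states are expanded about their midpoint, where the gradient terms are opposite. A
  quadratic term in \<open>x - y\<close> and the distance from the midpoint to \<open>xc\<close>
  remain, and their squares are bounded by parts of the Lyapunov function.\<close>

lemma antithetic_payoff_bound:
  fixes P :: "real^'d \<Rightarrow> real" and x y xc :: "real^'d"
  assumes P: "C2 P" "bounded_first_partials P K" "bounded_second_partials P K" and "0 \<le> s"
  shows "(1 / 2 * (P x + P y) - P xc)\<^sup>2 \<le> 2 * ((real CARD('d))\<^sup>2 * K)\<^sup>2 * lyapunov s (xc, x, y)"
proof -
  let ?B = "(real CARD('d))\<^sup>2 * K"
  define m where "m = (1/2) *\<^sub>R (x + y)"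
  note mid = midpoint_diff[where x = x and y = y, folded m_def]
  have diff: "P differentiable_on UNIV" using P(1) by (simp add: C2_def C1_def)
  have "\<bar>partial_deriv undefined P 0\<bar> \<le> K" using P(2) by (simp add: bounded_first_partials_def)
  then have K: "0 \<le> K" by linarith
  \<comment> \<open>One constant then serves both the first-order and the second-order
    bound.\<close>
  have "real CARD('d) * K \<le> ?B" using K by (intro mult_right_mono self_le_power) (auto simp: Suc_leI)
  then have 1: "\<bar>P m - P xc\<bar> \<le> ?B * norm (m - xc)"
    by (intro order_trans[OF bounded_first_partials_lipschitz(2)[OF diff P(2)] mult_right_mono]) auto
  have 2: "\<bar>P x - P m - grad P m \<bullet> (x - m)\<bar> \<le> ?B * (norm (x - y))\<^sup>2"
    "\<bar>P y - P m - grad P m \<bullet> (y - m)\<bar> \<le> ?B * (norm (x - y))\<^sup>2"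
    by (rule order_trans[OF bounded_second_partials_taylor[OF P(1,3)]],
        intro mult_left_mono power_mono mid, use K in auto)+
  have 3: "grad P m \<bullet> (y - m) = - (grad P m \<bullet> (x - m))" unfolding mid(2) by (rule inner_minus_right)
  have "\<bar>1 / 2 * (px + py) - pc\<bar> \<le> B1 + B2"
    if "\<bar>pm - pc\<bar> \<le> B1" "\<bar>px - pm - q\<bar> \<le> B2" "\<bar>py - pm - q'\<bar> \<le> B2" "q' = - q"
    for px py pm pc q q' B1 B2 :: real
    using that unfolding abs_le_iff by (auto simp: field_simps)
  from this[OF 1 2 3]
  have "\<bar>1 / 2 * (P x + P y) - P xc\<bar> \<le> ?B * norm (m - xc) + ?B * (norm (x - y))\<^sup>2" .
  then have "(1 / 2 * (P x + P y) - P xc)\<^sup>2 \<le> (?B * norm (m - xc) + ?B * (norm (x - y))\<^sup>2)\<^sup>2"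
    using power_mono[of "\<bar>1 / 2 * (P x + P y) - P xc\<bar>" _ 2] by simp
  also have "\<dots> \<le> 2 * ((?B * norm (m - xc))\<^sup>2 + (?B * (norm (x - y))\<^sup>2)\<^sup>2)" by (rule square_sum_le)
  also have "\<dots> = 2 * ?B\<^sup>2 * ((norm (m - xc))\<^sup>2 + norm (x - y) ^ 4)" by algebra
  also have "\<dots> \<le> 2 * ?B\<^sup>2 * lyapunov s (xc, x, y)"
    using moment_weight_ge_1[of x] moment_weight_ge_1[of y]
    by (intro mult_left_mono) (auto simp: lyapunov_def m_def)
  finally show ?thesis .
qed

lemma (in prob_space) variance_le_second_moment:
  fixes Y :: "'a \<Rightarrow> real"
  assumes Y: "random_variable borel Y" and "0 \<le> B" and bound: "(\<integral>\<^sup>+\<omega>. ennreal ((Y \<omega>)\<^sup>2) \<partial>M) \<le> ennreal B"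
  shows "integrable M Y" "integrable M (\<lambda>\<omega>. (Y \<omega>)\<^sup>2)" "variance Y \<le> B"
proof -
  show i2: "integrable M (\<lambda>\<omega>. (Y \<omega>)\<^sup>2)"
    using Y bound by (intro integrableI_bounded) (auto simp: order.strict_trans1[OF bound])
  show i: "integrable M Y" by (rule square_integrable_imp_integrable[OF Y i2])
  have "ennreal (expectation (\<lambda>\<omega>. (Y \<omega>)\<^sup>2)) \<le> ennreal B"
    using bound nn_integral_eq_integral[OF i2] by simp
  then have "expectation (\<lambda>\<omega>. (Y \<omega>)\<^sup>2) \<le> B" using \<open>0 \<le> B\<close> by (simp add: ennreal_le_iff)
  then show "variance Y \<le> B" using variance_eq[OF i i2] zero_le_power2[of "expectation Y"] by linarith
qed

text \<open>The second moment itself obeys the bound. The two integrability claims ensure that the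
  variance is not the default value of an integral that does not exist.\<close>

theorem mainTheorem3:
  fixes M :: "'w measure" and F :: "real \<Rightarrow> 'w measure"
    and w :: "real \<Rightarrow> 'w \<Rightarrow> real^'D" and \<Omega> :: "real^'D^'D"
    and f :: "real^'d \<Rightarrow> real^'d" and g :: "real^'d \<Rightarrow> real^'D^'d"
    and P :: "real^'d \<Rightarrow> real" and x0 :: "real^'d" and T :: real
  assumes "correlated_brownian_motion M F w \<Omega>"
    and "T > 0"
    and "\<And>i. C2 (\<lambda>x. f x $ i)"
    and "\<And>i j. C2 (\<lambda>x. g x $ i $ j)"
    and "bounded_coefficient_derivs f g"
    and "C2 P"
    and "\<exists>K. bounded_first_partials P K \<and> bounded_second_partials P K"
  shows "\<exists>C. \<forall>N\<ge>1.
      (let Y = (\<lambda>\<omega>. antithetic_difference f g \<Omega> x0 P (T / real N) N (\<lambda>t. w t \<omega>))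
       in integrable M Y \<and> integrable M (\<lambda>\<omega>. (Y \<omega>)\<^sup>2) \<and>
          prob_space.variance M Y \<le> C * (T / real N)\<^sup>2)"
proof -
  \<comment> \<open>\<open>sqrt (T / real N)\<close> never exceeds \<open>sqrt T\<close>, so a
    single \<open>K\<close> works for every \<open>N\<close>.\<close>
  obtain K where "sqrt T \<le> K" and
    coefficients: "milstein_coefficients f (jacobian f) (\<lambda>x u. g x *v u) (diffusion_derivative g)
      (milstein_bilinear g) (milstein_correction g \<Omega>) K"
    using milstein_coefficients_exists[OF assms(3-5), of "sqrt T" \<Omega>] \<open>T > 0\<close> by auto
  interpret milstein_brownian f "jacobian f" "\<lambda>x u. g x *v u" "diffusion_derivative g"
    "milstein_bilinear g" "milstein_correction g \<Omega>" K M F w \<Omega> "gaussian_moment_bound CARD('D)"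
    by (rule milstein_brownian[OF coefficients assms(1)])
  obtain L where L: "bounded_first_partials P L" "bounded_second_partials P L" using assms(7) by blast
  define B where "B = 2 * ((real CARD('d))\<^sup>2 * L)\<^sup>2"
  define \<kappa> where "\<kappa> = lyapunov_rate K (gaussian_moment_bound CARD('D))"
  \<comment> \<open>\<open>B\<close> comes from the payoff expansion, the exponential from
    \<open>(1 + s\<^sup>2 * \<kappa>) ^ N\<close> with \<open>N * s\<^sup>2 = T\<close>, and the
    last factor is the initial Lyapunov value divided by \<open>s ^ 4\<close>.\<close>
  define C where "C = B * (exp (T * \<kappa>) * (2 * moment_weight x0))"
  have B: "0 \<le> B" by (simp add: B_def)
  have P_cont: "continuous_on UNIV P"
    using assms(6) by (auto simp: C2_def C1_def intro: differentiable_imp_continuous_on)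
  show ?thesis unfolding Let_def
  proof (intro exI[of _ C] allI impI)
    fix N :: nat assume N: "1 \<le> N"
    define s where "s = sqrt (T / real N)"
    have s: "0 < s" "s\<^sup>2 = T / real N" using \<open>T > 0\<close> N by (auto simp: s_def)
    have "T / real N \<le> T" using \<open>T > 0\<close> N by (simp add: divide_le_eq)
    then have "s \<le> K" using \<open>sqrt T \<le> K\<close> unfolding s_def by (meson order_trans real_sqrt_le_mono)
    define Z where "Z n \<omega> = (coarse_path f g \<Omega> x0 (s\<^sup>2) (\<lambda>t. w t \<omega>) n, fine_path f g \<Omega> x0 (s\<^sup>2) (\<lambda>t. w t \<omega>) n,
      antithetic_path f g \<Omega> x0 (s\<^sup>2) (\<lambda>t. w t \<omega>) n)" for n \<omega>
    have Z_0: "Z 0 \<omega> = (x0, x0, x0)" for \<omega> by (simp add: Z_def)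
    have Z_Suc: "Z (Suc n) \<omega> = antithetic_step (s\<^sup>2) (Z n \<omega>)
      (w ((real n + 1 / 2) * s\<^sup>2) \<omega> - w (real n * s\<^sup>2) \<omega>)
      (w (real (n + 1) * s\<^sup>2) \<omega> - w ((real n + 1 / 2) * s\<^sup>2) \<omega>)" for n \<omega>
      unfolding Z_def by (rule antithetic_paths_Suc[OF coefficients])
    note path = nn_integral_lyapunov_path[OF \<open>0 < s\<close> \<open>s \<le> K\<close>, of Z, OF Z_0 Z_Suc]
      and Z_meas = Z_measurable[OF \<open>0 < s\<close> \<open>s \<le> K\<close>, of Z, OF Z_0 Z_Suc]
    have Z_M: "Z N \<in> borel_measurable M" by (rule measurable_F_M[OF _ Z_meas[of N]]) simp
    define Y where "Y = (\<lambda>\<omega>. antithetic_difference f g \<Omega> x0 P (T / real N) N (\<lambda>t. w t \<omega>))"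
    have Y_eq: "Y = (\<lambda>\<omega>. 1 / 2 * (P (fst (snd (Z N \<omega>))) + P (snd (snd (Z N \<omega>)))) - P (fst (Z N \<omega>)))"
      by (simp add: Y_def Z_def antithetic_difference_def s)
    have "continuous_on UNIV (\<lambda>z. 1 / 2 * (P (fst (snd z)) + P (snd (snd z))) - P (fst z))"
      by (intro continuous_intros continuous_on_compose2[OF P_cont]) auto
    from measurable_compose[OF Z_M borel_measurable_continuous_onI[OF this]]
    have Y_meas: "random_variable borel Y" unfolding Y_eq .
    have Y_le: "(Y \<omega>)\<^sup>2 \<le> B * lyapunov s (Z N \<omega>)" for \<omega>
      unfolding Y_eq B_def
      using antithetic_payoff_bound[OF assms(6) L, of s "fst (snd (Z N \<omega>))" "snd (snd (Z N \<omega>))" "fst (Z N \<omega>)"] s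
      by simp
    have "(\<integral>\<^sup>+\<omega>. ennreal ((Y \<omega>)\<^sup>2) \<partial>M) \<le> (\<integral>\<^sup>+\<omega>. ennreal B * ennreal (lyapunov s (Z N \<omega>)) \<partial>M)"
      using Y_le B by (intro nn_integral_mono) (simp add: ennreal_mult[symmetric] lyapunov_nonneg ennreal_leI)
    also have "\<dots> = ennreal B * (\<integral>\<^sup>+\<omega>. ennreal (lyapunov s (Z N \<omega>)) \<partial>M)"
      using Z_M by (intro nn_integral_cmult) (auto intro: measurable_compose[OF _ lyapunov_measurable])
    also have "\<dots> \<le> ennreal B * ennreal (exp (T * \<kappa>) * (s ^ 4 * (2 * moment_weight x0)))"
    proof (rule mult_left_mono[OF order_trans[OF path ennreal_leI]])
      \<comment> \<open>All three paths start at \<open>x0\<close>, so the two error parts vanish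
        and only the weights contribute.\<close>
      have l0: "lyapunov s (x0, x0, x0) = s ^ 4 * (2 * moment_weight x0)"
        using scaleR_half_double[of x0] by (simp add: lyapunov_def)
      have rate: "0 \<le> lyapunov_rate K (gaussian_moment_bound CARD('D))"
      proof -
        have "increment_law s (gaussian_moment_bound CARD('D)) (distr M borel (\<lambda>\<omega>. w (0 + s\<^sup>2 / 2) \<omega> - w 0 \<omega>))"
          by (rule increment_law_increment) (use s in auto)
        \<comment> \<open>Any admissible pair of laws gives the sign of the rate; here both are the
          law of the first half increment.\<close>
        then interpret noise: milstein_noise f "jacobian f" "\<lambda>x u. g x *v u" "diffusion_derivative g"
          "milstein_bilinear g" "milstein_correction g \<Omega>" K s "gaussian_moment_bound CARD('D)"
          "distr M borel (\<lambda>\<omega>. w (0 + s\<^sup>2 / 2) \<omega> - w 0 \<omega>)" "distr M borel (\<lambda>\<omega>. w (0 + s\<^sup>2 / 2) \<omega> - w 0 \<omega>)"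
          by unfold_locales (use s \<open>s \<le> K\<close> in auto)
        show ?thesis by (rule noise.lyapunov_rate_nonneg)
      qed
      have "(1 + s\<^sup>2 * \<kappa>) ^ N \<le> exp (s\<^sup>2 * \<kappa>) ^ N"
        by (intro power_mono exp_ge_add_one_self) (use rate in \<open>simp add: \<kappa>_def\<close>)
      also have "\<dots> = exp (T * \<kappa>)" using N s by (simp flip: exp_of_nat_mult)
      finally show "(1 + s\<^sup>2 * lyapunov_rate K (gaussian_moment_bound CARD('D))) ^ N * lyapunov s (x0, x0, x0)
        \<le> exp (T * \<kappa>) * (s ^ 4 * (2 * moment_weight x0))"
        unfolding l0 \<kappa>_def[symmetric] using moment_weight_ge_1[of x0] by (intro mult_right_mono) auto
    qed simp
    also have "\<dots> = ennreal (C * (T / real N)\<^sup>2)"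
    proof -
      have "s ^ 4 = (T / real N)\<^sup>2" unfolding s(2)[symmetric] by simp
      then show ?thesis using B moment_weight_ge_1[of x0]
        by (simp add: C_def ennreal_mult[symmetric] mult_ac)
    qed
    finally have bound: "(\<integral>\<^sup>+\<omega>. ennreal ((Y \<omega>)\<^sup>2) \<partial>M) \<le> ennreal (C * (T / real N)\<^sup>2)" .
    have C: "0 \<le> C * (T / real N)\<^sup>2" using B moment_weight_ge_1[of x0] by (simp add: C_def)
    note variance_le_second_moment[OF Y_meas C bound]
    then show "integrable M (\<lambda>\<omega>. antithetic_difference f g \<Omega> x0 P (T / real N) N (\<lambda>t. w t \<omega>)) \<and>
         integrable M (\<lambda>\<omega>. (antithetic_difference f g \<Omega> x0 P (T / real N) N (\<lambda>t. w t \<omega>))\<^sup>2) \<and>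
         variance (\<lambda>\<omega>. antithetic_difference f g \<Omega> x0 P (T / real N) N (\<lambda>t. w t \<omega>)) \<le> C * (T / real N)\<^sup>2"
      by (simp add: Y_def)
  qed
qed

end
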